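(* For every $p\in[1,\infty)$ and every $d\in\{2,3,4,\dots\}$, the $L^p$-Cuntz algebra $\mathcal{O}_d^p$ is $p$-nuclear.
   Context: Leavitt algebra. For $d\in\{2,3,\dots\}$, $L_d$ is the universal unital complex associative algebra on generators $s_1,\dots,s_d,t_1,\dots,t_d$ with relations $\sum_{j=1}^d s_jt_j=1$, $t_js_j=1$, and $t_js_k=0$ for $j\neq k$. $L^p$-Cuntz algebra. $\mathcal{O}_d^p$ is the completion of $L_d$ in the norm $a\mapsto\|\rho(a)\|$ for any spatial (unital) representation $\rho$ of $L_d$ on a nonzero space $L^p(X,\mu)$ with $(X,\mathcal{B},\mu)$ $\sigma$-finite (the norm does not depend on $\rho$). Thus $\mathcal{O}_d^p$ is regarded concretely as the norm closure of $\rho(L_d)$ in $\mathcal{B}(L^p(X,\mu))$ for a spatial representation $\rho$. Here $\rho$ is spatial if for each $j$ the operators $\rho(s_j)$ and $\rho(t_j)$ are spatial partial isometries and $\rho(t_j)$ is the reverse of $\rho(s_j)$. A spatial partial isometry on $L^p(X,\mu)$ is an operator $s$ determined by measurable sets $K,L\subset X$, an isomorphism $S$ (mod null sets) from the $\sigma$-algebra of measurable subsets of $K$ onto that of $L$, and a measurable function $g:L\to\mathbb{C}$ with $|g|=1$ a.e., by $(s\xi)(y)=g(y)\left(\frac{dS_*(\mu|_K)}{d\mu|_L}(y)\right)^{1/p}S_*(\xi|_K)(y)$ for $y\in L$ and $(s\xi)(y)=0$ for $y\notin L$, where $S_*$ is the induced map on measurable functions (with $S_*(\chi_M)=\chi_{S(M)}$)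 and on measures ($S_*(\mu|_K)(M)=\mu(S^{-1}(M))$). Its reverse is the spatial partial isometry determined by $(L,K,S^{-1},(S^{-1})_*(g)^{-1})$. Matrix norms and $p$-nuclearity. $l_n^p=L^p(\{1,\dots,n\})$ with counting measure and $M_n^p=\mathcal{B}(l_n^p)$, with matrix units $e_{i,j}$. For a norm closed subalgebra $A\subset\mathcal{B}(L^p(X,\mu))$, $M_n^p\otimes_p A$ is the norm closed subalgebra of $\mathcal{B}(L^p(\{1,\dots,n\}\times X))$ generated by all $T\otimes a$ with $T\in M_n^p$, $a\in A$; its elements are the matrices $\sum_{i,j}e_{i,j}\otimes a_{i,j}$ with $a_{i,j}\in A$. For norm closed subalgebras $A\subset\mathcal{B}(L^p(X,\mu))$, $B\subset\mathcal{B}(L^p(Y,\nu))$, a linear map $\varphi:A\to B$ is $p$-completely contractive if the maps $\mathrm{id}_{M_n^p}\otimes\varphi:\sum e_{i,j}\otimes a_{i,j}\mapsto\sum e_{i,j}\otimes\varphi(a_{i,j})$ satisfy $\sup_n\|\mathrm{id}_{M_n^p}\otimes\varphi\|\le 1$. The algebra $A$ is $p$-nuclear if for every finite $F\subset A$ and $\varepsilon>0$ there exist a positive integer $n$ and $p$-completely contractive maps $\varphi:A\to M_n^p$, $\psi:M_n^p\to A$ with $\|\psi\circ\varphi(a)-a\|<\varepsilon$ for all $a\in F$. *)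

theory Defs
  imports "HOL-Analysis.Analysis" "HOL-Algebra.QuotRing" "HOL-Algebra.Module"
begin

section \<open>The spaces \<open>L\<^sup>p(X,\<mu>)\<close> and their bounded operators\<close>

text \<open>Elements of \<open>L\<^sup>p\<close> are full almost-everywhere classes of measurable complex functions.
  Classes and operators on classes (rather than functions) are used so that equality of vectors and
  of operators is HOL equality.\<close>

definition ae_class :: "'a measure \<Rightarrow> ('a \<Rightarrow> complex) \<Rightarrow> ('a \<Rightarrow> complex) set" where
  "ae_class M f = {g \<in> borel_measurable M. AE x in M. g x = f x}"

definition Lp :: "real \<Rightarrow> 'a measure \<Rightarrow> ('a \<Rightarrow> complex) set set" where
  "Lp p M = ae_class M ` {f \<in> borel_measurable M. integrable M (\<lambda>x. cmod (f x) powr p)}"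

definition rep :: "('a \<Rightarrow> complex) set \<Rightarrow> 'a \<Rightarrow> complex" where
  "rep U = (SOME f. f \<in> U)"

definition lp_norm :: "real \<Rightarrow> 'a measure \<Rightarrow> ('a \<Rightarrow> complex) set \<Rightarrow> real" where
  "lp_norm p M U = (\<integral>x. cmod (rep U x) powr p \<partial>M) powr (1 / p)"

definition lp_zero :: "'a measure \<Rightarrow> ('a \<Rightarrow> complex) set" where
  "lp_zero M = ae_class M (\<lambda>_. 0)"

definition lp_add ::
  "'a measure \<Rightarrow> ('a \<Rightarrow> complex) set \<Rightarrow> ('a \<Rightarrow> complex) set \<Rightarrow> ('a \<Rightarrow> complex) set" where
  "lp_add M U V = ae_class M (\<lambda>x. rep U x + rep V x)"

definition lp_scale :: "'a measure \<Rightarrow> complex \<Rightarrow> ('a \<Rightarrow> complex) set \<Rightarrow> ('a \<Rightarrow> complex) set" where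
  "lp_scale M c U = ae_class M (\<lambda>x. c * rep U x)"

type_synonym 'a lp_op = "('a \<Rightarrow> complex) set \<Rightarrow> ('a \<Rightarrow> complex) set"

definition bounded_lp_op :: "real \<Rightarrow> 'a measure \<Rightarrow> 'a lp_op \<Rightarrow> bool" where
  "bounded_lp_op p M T \<longleftrightarrow>
     T \<in> Lp p M \<rightarrow>\<^sub>E Lp p M \<and>
     (\<forall>U\<in>Lp p M. \<forall>V\<in>Lp p M. T (lp_add M U V) = lp_add M (T U) (T V)) \<and>
     (\<forall>c. \<forall>U\<in>Lp p M. T (lp_scale M c U) = lp_scale M c (T U)) \<and>
     (\<exists>C. \<forall>U\<in>Lp p M. lp_norm p M (T U) \<le> C * lp_norm p M U)"

definition op_norm :: "real \<Rightarrow> 'a measure \<Rightarrow> 'a lp_op \<Rightarrow> real" where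
  "op_norm p M T = (SUP U\<in>{U \<in> Lp p M. lp_norm p M U \<le> 1}. lp_norm p M (T U))"

text \<open>Complex algebras are \<^const>\<open>module\<close>-style records of HOL-Algebra: ring operations together
  with a scalar multiplication by complex numbers.\<close>

definition Bop :: "real \<Rightarrow> 'a measure \<Rightarrow> (complex, 'a lp_op) module" where
  "Bop p M =
     \<lparr>carrier = {T. bounded_lp_op p M T},
      mult = (\<lambda>S T. compose (Lp p M) S T),
      one = (\<lambda>U\<in>Lp p M. U),
      zero = (\<lambda>U\<in>Lp p M. lp_zero M),
      add = (\<lambda>S T. \<lambda>U\<in>Lp p M. lp_add M (S U) (T U)),
      smult = (\<lambda>c T. \<lambda>U\<in>Lp p M. lp_scale M c (T U))\<rparr>"

definition op_closure :: "real \<Rightarrow> 'a measure \<Rightarrow> 'a lp_op set \<Rightarrow> 'a lp_op set" where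
  "op_closure p M A =
     {T \<in> carrier (Bop p M). \<forall>\<epsilon>>0. \<exists>S\<in>A. op_norm p M (T \<ominus>\<^bsub>Bop p M\<^esub> S) < \<epsilon>}"

definition algebra_hom ::
  "(complex, 'a, 'm) module_scheme \<Rightarrow> (complex, 'b, 'n) module_scheme \<Rightarrow> ('a \<Rightarrow> 'b) set" where
  "algebra_hom A B =
     {h \<in> ring_hom A B. \<forall>c. \<forall>x\<in>carrier A. h (c \<odot>\<^bsub>A\<^esub> x) = c \<odot>\<^bsub>B\<^esub> h x}"


section \<open>The Leavitt algebra\<close>

text \<open>The free unital complex algebra on \<open>G\<close>: finitely supported functions on words over \<open>G\<close>,
  with the convolution product.\<close>

definition free_algebra :: "'g set \<Rightarrow> (complex, 'g list \<Rightarrow> complex) module" where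
  "free_algebra G =
     \<lparr>carrier = {f. finite {w. f w \<noteq> 0} \<and> {w. f w \<noteq> 0} \<subseteq> lists G},
      mult = (\<lambda>f g w. \<Sum>i\<le>length w. f (take i w) * g (drop i w)),
      one = (\<lambda>w. if w = [] then 1 else 0),
      zero = (\<lambda>w. 0),
      add = (\<lambda>f g w. f w + g w),
      smult = (\<lambda>c f w. c * f w)\<rparr>"

definition word :: "'g list \<Rightarrow> 'g list \<Rightarrow> complex" where
  "word v = (\<lambda>w. if w = v then 1 else 0)"

datatype leavitt_gen = S_gen nat | T_gen nat

definition leavitt_free :: "nat \<Rightarrow> (complex, leavitt_gen list \<Rightarrow> complex) module" where
  "leavitt_free d = free_algebra (S_gen ` {1..d} \<union> T_gen ` {1..d})"

definition leavitt_relators :: "nat \<Rightarrow> (leavitt_gen list \<Rightarrow> complex) set" where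
  "leavitt_relators d =
     {\<lambda>w. (\<Sum>j=1..d. word [S_gen j, T_gen j] w) - word [] w} \<union>
     {\<lambda>w. word [T_gen j, S_gen j] w - word [] w | j. j \<in> {1..d}} \<union>
     {word [T_gen j, S_gen k] | j k. j \<in> {1..d} \<and> k \<in> {1..d} \<and> j \<noteq> k}"

definition leavitt_ideal :: "nat \<Rightarrow> (leavitt_gen list \<Rightarrow> complex) set" where
  "leavitt_ideal d = Idl\<^bsub>leavitt_free d\<^esub> leavitt_relators d"

text \<open>\<open>FactRing\<close> forgets the scalars, so these are put back: \<open>c\<cdot>(I + x) = I + c\<cdot>x\<close> (all members
  of the union below coincide).\<close>

definition leavitt :: "nat \<Rightarrow> (complex, (leavitt_gen list \<Rightarrow> complex) set) module" where
  "leavitt d =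
     ring.extend (leavitt_free d Quot leavitt_ideal d)
       (module.fields
         (\<lambda>c X. \<Union>x\<in>X. leavitt_ideal d +>\<^bsub>leavitt_free d\<^esub> (c \<odot>\<^bsub>leavitt_free d\<^esub> x)))"

definition leavitt_s :: "nat \<Rightarrow> nat \<Rightarrow> (leavitt_gen list \<Rightarrow> complex) set" where
  "leavitt_s d j = leavitt_ideal d +>\<^bsub>leavitt_free d\<^esub> word [S_gen j]"

definition leavitt_t :: "nat \<Rightarrow> nat \<Rightarrow> (leavitt_gen list \<Rightarrow> complex) set" where
  "leavitt_t d j = leavitt_ideal d +>\<^bsub>leavitt_free d\<^esub> word [T_gen j]"


section \<open>Spatial partial isometries\<close>

text \<open>A map of measurable sets is represented by a function on sets which is only meaningful up to
  null sets; \<open>set_iso N P S\<close> says that it induces an isomorphism of the measure algebras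
  (measurable sets modulo null sets) of \<open>N\<close> and \<open>P\<close>.\<close>

definition eq_mod_null :: "'a measure \<Rightarrow> 'a set \<Rightarrow> 'a set \<Rightarrow> bool" where
  "eq_mod_null M A B \<longleftrightarrow> sym_diff A B \<in> null_sets M"

definition set_iso :: "'a measure \<Rightarrow> 'b measure \<Rightarrow> ('a set \<Rightarrow> 'b set) \<Rightarrow> bool" where
  "set_iso N P S \<longleftrightarrow>
     (\<forall>A\<in>sets N. S A \<in> sets P) \<and>
     (\<forall>A\<in>sets N. \<forall>B\<in>sets N. eq_mod_null N A B \<longleftrightarrow> eq_mod_null P (S A) (S B)) \<and>
     (\<forall>B\<in>sets P. \<exists>A\<in>sets N. eq_mod_null P (S A) B) \<and>
     (\<forall>A\<in>sets N. eq_mod_null P (S (space N - A)) (space P - S A)) \<and>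
     (\<forall>A :: nat \<Rightarrow> 'a set. range A \<subseteq> sets N \<longrightarrow> eq_mod_null P (S (\<Union>n. A n)) (\<Union>n. S (A n)))"

definition set_iso_inv :: "'a measure \<Rightarrow> 'b measure \<Rightarrow> ('a set \<Rightarrow> 'b set) \<Rightarrow> 'b set \<Rightarrow> 'a set" where
  "set_iso_inv N P S B = (SOME A. A \<in> sets N \<and> eq_mod_null P (S A) B)"

definition push_measure :: "'a measure \<Rightarrow> 'b measure \<Rightarrow> ('a set \<Rightarrow> 'b set) \<Rightarrow> 'b measure" where
  "push_measure N P S = measure_of (space P) (sets P) (\<lambda>B. emeasure N (set_iso_inv N P S B))"

text \<open>\<open>S\<^sub>*\<xi>\<close> is the function, unique up to null sets, whose level sets are the images under \<open>S\<close> of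
  the level sets of \<open>\<xi>\<close>; in particular \<open>S\<^sub>*\<chi>\<^bsub>A\<^esub> = \<chi>\<^bsub>S(A)\<^esub>\<close> almost everywhere.\<close>

definition is_push_fun ::
  "'a measure \<Rightarrow> 'b measure \<Rightarrow> ('a set \<Rightarrow> 'b set) \<Rightarrow> ('a \<Rightarrow> complex) \<Rightarrow> ('b \<Rightarrow> complex) \<Rightarrow> bool" where
  "is_push_fun N P S \<xi> \<eta> \<longleftrightarrow>
     \<eta> \<in> borel_measurable P \<and>
     (\<forall>E\<in>sets borel. eq_mod_null P (S (\<xi> -` E \<inter> space N)) (\<eta> -` E \<inter> space P))"

definition push_fun ::
  "'a measure \<Rightarrow> 'b measure \<Rightarrow> ('a set \<Rightarrow> 'b set) \<Rightarrow> ('a \<Rightarrow> complex) \<Rightarrow> 'b \<Rightarrow> complex" where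
  "push_fun N P S \<xi> = (SOME \<eta>. is_push_fun N P S \<xi> \<eta>)"

definition spatial_system ::
  "'a measure \<Rightarrow> 'a set \<Rightarrow> 'a set \<Rightarrow> ('a set \<Rightarrow> 'a set) \<Rightarrow> ('a \<Rightarrow> complex) \<Rightarrow> bool" where
  "spatial_system M K L S g \<longleftrightarrow>
     K \<in> sets M \<and> L \<in> sets M \<and>
     set_iso (restrict_space M K) (restrict_space M L) S \<and>
     g \<in> borel_measurable (restrict_space M L) \<and>
     (AE y in restrict_space M L. cmod (g y) = 1)"

definition spatial_op ::
  "real \<Rightarrow> 'a measure \<Rightarrow> 'a set \<Rightarrow> 'a set \<Rightarrow> ('a set \<Rightarrow> 'a set) \<Rightarrow> ('a \<Rightarrow> complex) \<Rightarrow> 'a lp_op" where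
  "spatial_op p M K L S g =
     (let N = restrict_space M K; P = restrict_space M L;
          h = RN_deriv P (push_measure N P S)
      in (\<lambda>U\<in>Lp p M. ae_class M (\<lambda>y.
           if y \<in> L
           then g y * complex_of_real (enn2real (h y) powr (1 / p)) * push_fun N P S (rep U) y
           else 0)))"

definition spatial_partial_isometry :: "real \<Rightarrow> 'a measure \<Rightarrow> 'a lp_op \<Rightarrow> bool" where
  "spatial_partial_isometry p M s \<longleftrightarrow>
     (\<exists>K L S g. spatial_system M K L S g \<and> s = spatial_op p M K L S g)"

definition is_reverse :: "real \<Rightarrow> 'a measure \<Rightarrow> 'a lp_op \<Rightarrow> 'a lp_op \<Rightarrow> bool" where
  "is_reverse p M s t \<longleftrightarrow>
     (\<exists>K L S g. spatial_system M K L S g \<and> s = spatial_op p M K L S g \<and>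
        (let N = restrict_space M K; P = restrict_space M L; R = set_iso_inv N P S
         in t = spatial_op p M L K R (\<lambda>x. inverse (push_fun P N R g x))))"

definition spatial_representation ::
  "real \<Rightarrow> 'a measure \<Rightarrow> nat \<Rightarrow> ((leavitt_gen list \<Rightarrow> complex) set \<Rightarrow> 'a lp_op) \<Rightarrow> bool" where
  "spatial_representation p M d \<rho> \<longleftrightarrow>
     \<rho> \<in> algebra_hom (leavitt d) (Bop p M) \<and>
     (\<forall>j\<in>{1..d}. spatial_partial_isometry p M (\<rho> (leavitt_s d j)) \<and>
                  spatial_partial_isometry p M (\<rho> (leavitt_t d j)) \<and>
                  is_reverse p M (\<rho> (leavitt_s d j)) (\<rho> (leavitt_t d j)))"

definition Lp_Cuntz ::
  "real \<Rightarrow> 'a measure \<Rightarrow> nat \<Rightarrow> ((leavitt_gen list \<Rightarrow> complex) set \<Rightarrow> 'a lp_op) \<Rightarrow> 'a lp_op set" where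
  "Lp_Cuntz p M d \<rho> = op_closure p M (\<rho> ` carrier (leavitt d))"


section \<open>Matrix norms and \<open>p\<close>-nuclearity\<close>

definition idx :: "nat \<Rightarrow> nat measure" where
  "idx n = count_space {1..n}"

definition Mp :: "real \<Rightarrow> nat \<Rightarrow> nat lp_op set" where
  "Mp p n = carrier (Bop p (idx n))"

text \<open>The operator \<open>\<Sum>\<^sub>i\<^sub>,\<^sub>j e\<^sub>i\<^sub>,\<^sub>j \<otimes> a\<^sub>i\<^sub>,\<^sub>j\<close> on \<open>L\<^sup>p({1,\<dots>,n} \<times> X)\<close>: the \<open>i\<close>-th section of the
  image of \<open>\<xi>\<close> is \<open>\<Sum>\<^sub>j a\<^sub>i\<^sub>,\<^sub>j (\<xi>(j,\<cdot>))\<close>.\<close>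

definition matrix_op ::
  "real \<Rightarrow> nat \<Rightarrow> 'a measure \<Rightarrow> (nat \<Rightarrow> nat \<Rightarrow> 'a lp_op) \<Rightarrow> (nat \<times> 'a) lp_op" where
  "matrix_op p n M a =
     (\<lambda>U\<in>Lp p (idx n \<Otimes>\<^sub>M M). ae_class (idx n \<Otimes>\<^sub>M M)
        (\<lambda>(i, x). \<Sum>j=1..n. rep (a i j (ae_class M (\<lambda>y. rep U (j, y)))) x))"

text \<open>The last clause is \<open>\<parallel>id \<otimes> \<phi>\<parallel> \<le> 1\<close> for every matrix size \<open>n\<close>.\<close>

definition p_completely_contractive ::
  "real \<Rightarrow> 'a measure \<Rightarrow> 'a lp_op set \<Rightarrow> 'b measure \<Rightarrow> 'b lp_op set \<Rightarrow> ('a lp_op \<Rightarrow> 'b lp_op) \<Rightarrow> bool"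
  where
  "p_completely_contractive p M A N B \<phi> \<longleftrightarrow>
     \<phi> \<in> A \<rightarrow> B \<and>
     (\<forall>a\<in>A. \<forall>b\<in>A. \<phi> (a \<oplus>\<^bsub>Bop p M\<^esub> b) = \<phi> a \<oplus>\<^bsub>Bop p N\<^esub> \<phi> b) \<and>
     (\<forall>c. \<forall>a\<in>A. \<phi> (c \<odot>\<^bsub>Bop p M\<^esub> a) = c \<odot>\<^bsub>Bop p N\<^esub> \<phi> a) \<and>
     (\<forall>n\<ge>1. \<forall>a. (\<forall>i\<in>{1..n}. \<forall>j\<in>{1..n}. a i j \<in> A) \<longrightarrow>
        op_norm p (idx n \<Otimes>\<^sub>M N) (matrix_op p n N (\<lambda>i j. \<phi> (a i j)))
          \<le> op_norm p (idx n \<Otimes>\<^sub>M M) (matrix_op p n M a))"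

definition p_nuclear :: "real \<Rightarrow> 'a measure \<Rightarrow> 'a lp_op set \<Rightarrow> bool" where
  "p_nuclear p M A \<longleftrightarrow>
     (\<forall>F \<epsilon>. finite F \<and> F \<subseteq> A \<and> \<epsilon> > 0 \<longrightarrow>
        (\<exists>n\<ge>1. \<exists>\<phi> \<psi>.
           p_completely_contractive p M A (idx n) (Mp p n) \<phi> \<and>
           p_completely_contractive p (idx n) (Mp p n) M A \<psi> \<and>
           (\<forall>a\<in>F. op_norm p M (\<psi> (\<phi> a) \<ominus>\<^bsub>Bop p M\<^esub> a) < \<epsilon>)))"

end

theory Submission
  imports Defs
begin

text \<open>Write \<open>s\<^sub>\<mu>\<close>, \<open>t\<^sub>\<mu>\<close> for the operators of a word \<open>\<mu>\<close>, so that the algebra is the closed span of the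
  products \<open>s\<^sub>\<alpha> t\<^sub>\<beta>\<close>. Let \<open>V\<close> be the set of words of length in \<open>[K, 2K)\<close> and \<open>\<tau> = 1\<dots>12\<close> with \<open>2K\<close>
  ones. For \<open>\<nu> \<in> V\<close> the words \<open>\<nu>\<tau>\<close> are pairwise prefix-incomparable, so for a unit vector \<open>\<xi>\<close> with
  norming functional \<open>\<eta>\<close> the vectors \<open>s\<^bsub>\<nu>\<tau>\<^esub> \<xi>\<close> span an isometric copy of \<open>l\<^sup>p(V)\<close>, and
  \<open>\<phi>(a)\<^sub>\<mu>\<^sub>\<nu> = \<eta>(t\<^bsub>\<mu>\<tau>\<^esub> a s\<^bsub>\<nu>\<tau>\<^esub> \<xi>)\<close> is \<open>p\<close>-completely contractive. So is
  \<open>\<psi>(x) = K\<^sup>-\<^sup>1 \<Sum> x\<^sub>\<mu>\<^sub>\<nu> s\<^sub>\<mu> t\<^sub>\<nu>\<close>, by Hoelder's inequality over the \<open>K\<close> levels. For \<open>K \<ge> |\<alpha>|, |\<beta>|\<close> one finds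
  \<open>\<psi>(\<phi>(s\<^sub>\<alpha> t\<^sub>\<beta>)) = (1 - \<bar>|\<alpha>| - |\<beta>|\<bar> / K) s\<^sub>\<alpha> t\<^sub>\<beta>\<close>, and \<open>K\<close> tends to infinity.\<close>

section \<open>The spaces \<open>L\<^sup>p\<close>\<close>

text \<open>A single level of words cannot carry the approximation: an entry of
  \<open>compress K (st \<alpha> \<beta>)\<close> vanishes unless its two words are \<alpha>\<gamma>
  and \<beta>\<gamma> with a common \<gamma>, so that their lengths differ by |\<alpha>| -
  |\<beta>|. A window of K levels loses only those \<gamma> for which one of the two words leaves
  it, and it starts at K so that its words are at least as long as \<alpha> and \<beta>. The price
  is that words of different levels may be prefixes of one another, with overlapping ranges. In the
  compression the tail separates them and cancels afterwards. The expansion has no tail, because the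
  sum of s_\<gamma> t_\<gamma> over a level has to be the identity; there the overlap is paid for by
  convexity, and the division by K meets this cost exactly. Spatiality enters through one identity,
  \<open>lp_pow_t_sum\<close>. In place of an inner product it makes the s_\<mu> isometric and lets
  p-th powers of norms add over incomparable words. This is why norms are handled as p-th powers,
  with the root taken only at \<open>op_norm\<close>.\<close>

lemma powr_tangent:
  fixes t c p :: real
  assumes "p \<ge> 1" "t \<ge> 0" "c > 0"
  shows "c powr p + p * c powr (p - 1) * (t - c) \<le> t powr p"
\<comment> \<open>The convexity argument takes place on the open half-line \<open>{0<..}\<close>, so
  the endpoint is computed by hand.\<close>
proof (cases "t = 0")
  case True
  have "c powr p = c * c powr (p - 1)"
    using assms by (simp add: powr_diff)
  then have "c powr p + p * c powr (p - 1) * (0 - c) = - (p - 1) * c powr p"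
    by (simp add: algebra_simps)
  also have "\<dots> \<le> 0" using assms by (intro mult_nonpos_nonneg) auto
  finally show ?thesis using True by simp
next
  case False
  have "((\<lambda>x. x powr p) has_real_derivative p * c powr (p - 1)) (at c within {0<..})"
    using assms by (auto intro!: derivative_eq_intros)
  with convex_on_imp_above_tangent[OF powr_convex[OF assms(1)], of c t] assms False
  have "p * c powr (p - 1) * (t - c) \<le> t powr p - c powr p"
    by (simp add: interior_open)
  then show ?thesis by simp
qed

text \<open>Power mean inequality: summed over \<open>I\<close>, the tangent inequality at the mean
  \<open>c\<close> loses its linear part.\<close>

lemma powr_sum_le:
  fixes a :: "'i \<Rightarrow> real"
  assumes "p \<ge> 1" "finite I" "\<And>i. i \<in> I \<Longrightarrow> a i \<ge> 0"
  shows "(\<Sum>i\<in>I. a i) powr p \<le> real (card I) powr (p - 1) * (\<Sum>i\<in>I. a i powr p)"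
proof (cases "(\<Sum>i\<in>I. a i) = 0")
  case True
  then show ?thesis by (simp add: sum_nonneg)
next
  case False
  define n where "n = real (card I)"
  define c where "c = (\<Sum>i\<in>I. a i) / n"
  have s: "(\<Sum>i\<in>I. a i) > 0" using False assms sum_nonneg[of I a] by auto
  with assms have n: "n > 0" by (auto simp: n_def card_gt_0_iff)
  have c: "c > 0" using s n by (simp add: c_def)
  have "n * c powr p = (\<Sum>i\<in>I. c powr p + p * c powr (p - 1) * (a i - c))"
    using n by (simp add: sum.distrib sum_subtractf c_def n_def flip: sum_distrib_left)
  also have "\<dots> \<le> (\<Sum>i\<in>I. a i powr p)"
    by (intro sum_mono powr_tangent assms c)
  finally have "n powr (p - 1) * (n * c powr p) \<le> n powr (p - 1) * (\<Sum>i\<in>I. a i powr p)"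
    by (intro mult_left_mono) auto
  also have "n powr (p - 1) * (n * c powr p) = (n * c) powr p"
    using n c by (simp add: powr_mult powr_diff)
  finally show ?thesis using n by (simp add: c_def n_def)
qed

lemma cmod_sum_powr_le:
  fixes a :: "'i \<Rightarrow> complex"
  assumes "p \<ge> 1" "finite I"
  shows "cmod (\<Sum>i\<in>I. a i) powr p \<le> real (card I) powr (p - 1) * (\<Sum>i\<in>I. cmod (a i) powr p)"
proof -
  have "cmod (\<Sum>i\<in>I. a i) powr p \<le> (\<Sum>i\<in>I. cmod (a i)) powr p"
    using assms by (intro powr_mono2 norm_sum) auto
  also have "\<dots> \<le> real (card I) powr (p - 1) * (\<Sum>i\<in>I. cmod (a i) powr p)"
    by (intro powr_sum_le assms) auto
  finally show ?thesis .
qed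

section \<open>Almost-everywhere classes and p-th powers of their norms\<close>

lemma rep_ae_class:
  assumes "f \<in> borel_measurable M"
  shows "rep (ae_class M f) \<in> borel_measurable M" "AE x in M. rep (ae_class M f) x = f x"
proof -
  have "f \<in> ae_class M f" using assms by (simp add: ae_class_def)
  then have "rep (ae_class M f) \<in> ae_class M f" unfolding rep_def by (rule someI[of "\<lambda>g. g \<in> ae_class M f"])
  then show "rep (ae_class M f) \<in> borel_measurable M" "AE x in M. rep (ae_class M f) x = f x"
    by (auto simp: ae_class_def)
qed

lemma ae_class_cong:
  assumes "AE x in M. f x = g x"
  shows "ae_class M f = ae_class M g"
proof -
  have "(AE x in M. h x = f x) \<longleftrightarrow> (AE x in M. h x = g x)" for h
    using assms by (intro eventually_cong[OF assms]) auto
  then show ?thesis by (auto simp: ae_class_def)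
qed

lemma ae_class_cong_space:
  "(\<And>x. x \<in> space M \<Longrightarrow> f x = g x) \<Longrightarrow> ae_class M f = ae_class M g"
  by (intro ae_class_cong AE_I2)

lemma LpD:
  assumes "U \<in> Lp p M"
  shows "rep U \<in> borel_measurable M" "integrable M (\<lambda>x. cmod (rep U x) powr p)"
    "ae_class M (rep U) = U"
proof -
  obtain f where f: "f \<in> borel_measurable M" "integrable M (\<lambda>x. cmod (f x) powr p)"
    and U: "U = ae_class M f" using assms by (auto simp: Lp_def)
  note r = rep_ae_class[OF f(1), folded U]
  show "rep U \<in> borel_measurable M" by fact
  show "integrable M (\<lambda>x. cmod (rep U x) powr p)"
    using r f by (subst integrable_cong_AE[of _ _ "\<lambda>x. cmod (f x) powr p"]) auto
  show "ae_class M (rep U) = U" unfolding U using r U by (intro ae_class_cong) auto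
qed

lemma Lp_measurable: "U \<in> Lp p M \<Longrightarrow> rep U \<in> borel_measurable M"
  and Lp_integrable: "U \<in> Lp p M \<Longrightarrow> integrable M (\<lambda>x. cmod (rep U x) powr p)"
  and ae_class_rep: "U \<in> Lp p M \<Longrightarrow> ae_class M (rep U) = U"
  by (fact LpD)+

lemma LpI:
  "f \<in> borel_measurable M \<Longrightarrow> integrable M (\<lambda>x. cmod (f x) powr p) \<Longrightarrow> ae_class M f \<in> Lp p M"
  by (auto simp: Lp_def)

lemma Lp_eqI:
  assumes "U \<in> Lp p M" "V \<in> Lp p M" "AE x in M. rep U x = rep V x"
  shows "U = V"
  using LpD(3)[OF assms(1)] LpD(3)[OF assms(2)] ae_class_cong[OF assms(3)] by metis

text \<open>The p-th power of \<open>lp_norm\<close>. It adds over disjoint supports, which the norm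
  itself does not for p > 1.\<close>

definition lp_pow :: "real \<Rightarrow> 'a measure \<Rightarrow> ('a \<Rightarrow> complex) set \<Rightarrow> real" where
  "lp_pow p M U = (\<integral>x. cmod (rep U x) powr p \<partial>M)"

lemma lp_pow_nonneg: "lp_pow p M U \<ge> 0"
  by (simp add: lp_pow_def)

lemma lp_norm_lp_pow: "lp_norm p M U = lp_pow p M U powr (1 / p)"
  by (simp add: lp_norm_def lp_pow_def)

lemma lp_pow_ae_class:
  assumes "f \<in> borel_measurable M"
  shows "lp_pow p M (ae_class M f) = (\<integral>x. cmod (f x) powr p \<partial>M)"
  unfolding lp_pow_def using rep_ae_class[OF assms] assms
  by (intro integral_cong_AE) auto

text \<open>The power mean inequality supplies the dominating function.\<close>

lemma integrable_cmod_powr_sum: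
  assumes "p \<ge> 1" "finite I" "\<And>i. i \<in> I \<Longrightarrow> f i \<in> borel_measurable M"
    and "\<And>i. i \<in> I \<Longrightarrow> integrable M (\<lambda>x. cmod (f i x) powr p)"
  shows "integrable M (\<lambda>x. cmod (\<Sum>i\<in>I. f i x) powr p)"
proof (rule Bochner_Integration.integrable_bound)
  show "integrable M (\<lambda>x. real (card I) powr (p - 1) * (\<Sum>i\<in>I. cmod (f i x) powr p))"
    using assms by auto
  show "(\<lambda>x. cmod (\<Sum>i\<in>I. f i x) powr p) \<in> borel_measurable M"
    using assms by auto
  show "AE x in M. norm (cmod (\<Sum>i\<in>I. f i x) powr p)
      \<le> norm (real (card I) powr (p - 1) * (\<Sum>i\<in>I. cmod (f i x) powr p))"
    using cmod_sum_powr_le[OF assms(1,2)] by (auto simp: abs_mult sum_nonneg)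
qed

lemma rep_lp_add:
  assumes "U \<in> Lp p M" "V \<in> Lp p M"
  shows "AE x in M. rep (lp_add M U V) x = rep U x + rep V x"
  unfolding lp_add_def using assms
  by (intro rep_ae_class borel_measurable_add) (auto intro: Lp_measurable)

lemma rep_lp_scale:
  assumes "U \<in> Lp p M"
  shows "AE x in M. rep (lp_scale M c U) x = c * rep U x"
  unfolding lp_scale_def using assms
  by (intro rep_ae_class borel_measurable_times) (auto intro: Lp_measurable)

lemma rep_lp_zero: "AE x in M. rep (lp_zero M) x = 0"
  unfolding lp_zero_def by (intro rep_ae_class) auto

lemma Lp_zero: "lp_zero M \<in> Lp p M"
  unfolding lp_zero_def by (intro LpI) auto

lemma Lp_scale: "U \<in> Lp p M \<Longrightarrow> lp_scale M c U \<in> Lp p M"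
  unfolding lp_scale_def by (intro LpI borel_measurable_times) (auto intro: Lp_measurable Lp_integrable simp: norm_mult powr_mult)

lemma Lp_add:
  assumes "p \<ge> 1" "U \<in> Lp p M" "V \<in> Lp p M"
  shows "lp_add M U V \<in> Lp p M"
  \<comment> \<open>A sum of two is treated as a sum over the index type
    \<open>bool\<close>.\<close>
  using assms integrable_cmod_powr_sum[OF assms(1), of UNIV "\<lambda>b. if b then rep U else rep V" M]
    Lp_integrable[OF assms(2)] Lp_integrable[OF assms(3)]
    Lp_measurable[OF assms(2)] Lp_measurable[OF assms(3)]
  unfolding lp_add_def
  by (intro LpI borel_measurable_add) (simp_all add: UNIV_bool add.commute split: if_splits)

text \<open>Adding representatives, rather than iterating \<open>lp_add\<close>, reduces every
  change of index set to the same change for complex sums. The link with \<open>lp_add\<close> is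
  \<open>lp_sum_insert\<close>.\<close>

definition lp_sum :: "'a measure \<Rightarrow> 'i set \<Rightarrow> ('i \<Rightarrow> ('a \<Rightarrow> complex) set) \<Rightarrow> ('a \<Rightarrow> complex) set" where
  "lp_sum M I u = ae_class M (\<lambda>x. \<Sum>i\<in>I. rep (u i) x)"

lemma rep_lp_sum:
  assumes "\<And>i. i \<in> I \<Longrightarrow> u i \<in> Lp p M"
  shows "AE x in M. rep (lp_sum M I u) x = (\<Sum>i\<in>I. rep (u i) x)"
  unfolding lp_sum_def using assms by (intro rep_ae_class borel_measurable_sum) (auto intro: Lp_measurable Lp_integrable)

lemma Lp_sum:
  assumes "p \<ge> 1" "finite I" "\<And>i. i \<in> I \<Longrightarrow> u i \<in> Lp p M"
  shows "lp_sum M I u \<in> Lp p M"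
  unfolding lp_sum_def using assms
  by (intro LpI integrable_cmod_powr_sum borel_measurable_sum) (auto intro: Lp_measurable Lp_integrable)

lemma lp_sum_cong: "I = J \<Longrightarrow> (\<And>i. i \<in> J \<Longrightarrow> u i = v i) \<Longrightarrow> lp_sum M I u = lp_sum M J v"
  by (simp add: lp_sum_def)

lemma lp_sum_empty: "lp_sum M {} u = lp_zero M"
  by (simp add: lp_sum_def lp_zero_def)

lemma lp_sum_insert:
  assumes "p \<ge> 1" "finite I" "i \<notin> I" "\<And>j. j \<in> insert i I \<Longrightarrow> u j \<in> Lp p M"
  shows "lp_sum M (insert i I) u = lp_add M (u i) (lp_sum M I u)"
  unfolding lp_sum_def[of M "insert i I"] lp_add_def using assms rep_lp_sum[of I u p M]
  by (intro ae_class_cong) auto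

lemma lp_pow_scale:
  assumes "U \<in> Lp p M"
  shows "lp_pow p M (lp_scale M c U) = cmod c powr p * lp_pow p M U"
  using assms unfolding lp_scale_def lp_pow_def[of _ _ U]
  by (subst lp_pow_ae_class, intro borel_measurable_times) (auto intro: Lp_measurable simp: norm_mult powr_mult)

lemma lp_pow_zero: "lp_pow p M (lp_zero M) = 0"
  by (simp add: lp_zero_def lp_pow_ae_class)

lemma lp_pow_sum_le:
  assumes "p \<ge> 1" "finite I" "\<And>i. i \<in> I \<Longrightarrow> u i \<in> Lp p M"
  shows "lp_pow p M (lp_sum M I u) \<le> real (card I) powr (p - 1) * (\<Sum>i\<in>I. lp_pow p M (u i))"
proof -
  have "lp_pow p M (lp_sum M I u) = (\<integral>x. cmod (\<Sum>i\<in>I. rep (u i) x) powr p \<partial>M)"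
    unfolding lp_sum_def using assms
    by (intro lp_pow_ae_class borel_measurable_sum) (auto intro: Lp_measurable)
  also have "\<dots> \<le> (\<integral>x. real (card I) powr (p - 1) * (\<Sum>i\<in>I. cmod (rep (u i) x) powr p) \<partial>M)"
    using assms
    by (intro integral_mono cmod_sum_powr_le integrable_cmod_powr_sum integrable_mult_right
        Bochner_Integration.integrable_sum) (auto intro: Lp_measurable Lp_integrable)
  also have "\<dots> = real (card I) powr (p - 1) * (\<Sum>i\<in>I. lp_pow p M (u i))"
    using assms by (subst integral_mult_right_zero, subst Bochner_Integration.integral_sum) (auto intro: Lp_measurable Lp_integrable simp: lp_pow_def)
  finally show ?thesis .
qed

lemma lp_sum_pair:
  "lp_sum M UNIV (\<lambda>b. if b then U else V) = lp_add M U V"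
  by (simp add: lp_sum_def lp_add_def UNIV_bool add.commute)

lemma lp_pow_add_le:
  assumes "p \<ge> 1" "U \<in> Lp p M" "V \<in> Lp p M"
  shows "lp_pow p M (lp_add M U V) \<le> 2 powr (p - 1) * (lp_pow p M U + lp_pow p M V)"
  using lp_pow_sum_le[OF assms(1), of UNIV "\<lambda>b. if b then U else V" M] assms
  by (simp add: lp_sum_pair) (simp add: UNIV_bool add.commute)

text \<open>Values outside \<open>Lp p M\<close> are left free, so that compositions and pointwise
  combinations qualify without first being restricted to be extensional.\<close>

definition lp_linear :: "real \<Rightarrow> 'a measure \<Rightarrow> 'b measure \<Rightarrow>
    (('a \<Rightarrow> complex) set \<Rightarrow> ('b \<Rightarrow> complex) set) \<Rightarrow> bool" where
  "lp_linear p M N T \<longleftrightarrow> T \<in> Lp p M \<rightarrow> Lp p N \<and>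
     (\<forall>U\<in>Lp p M. \<forall>V\<in>Lp p M. T (lp_add M U V) = lp_add N (T U) (T V)) \<and>
     (\<forall>c. \<forall>U\<in>Lp p M. T (lp_scale M c U) = lp_scale N c (T U))"

lemma lp_linearD:
  assumes "lp_linear p M N T" "U \<in> Lp p M"
  shows "T U \<in> Lp p N" "V \<in> Lp p M \<Longrightarrow> T (lp_add M U V) = lp_add N (T U) (T V)"
    "T (lp_scale M c U) = lp_scale N c (T U)"
  using assms by (auto simp: lp_linear_def)

lemma lp_scale_0: "lp_scale M 0 U = lp_zero M"
  by (simp add: lp_scale_def lp_zero_def)

lemma lp_linear_zero:
  assumes "lp_linear p M N T"
  shows "T (lp_zero M) = lp_zero N"
  using lp_linearD(3)[OF assms Lp_zero, of 0] by (simp add: lp_scale_0)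

lemma lp_linear_sum:
  assumes "p \<ge> 1" "lp_linear p M N T" "finite I" "\<And>i. i \<in> I \<Longrightarrow> u i \<in> Lp p M"
  shows "T (lp_sum M I u) = lp_sum N I (\<lambda>i. T (u i))"
  using assms(3,4)
proof (induction I)
  case empty
  then show ?case by (simp add: lp_sum_empty lp_linear_zero[OF assms(2)])
next
  case (insert i I)
  have "T (lp_sum M (insert i I) u) = lp_add N (T (u i)) (T (lp_sum M I u))"
    using insert lp_linearD(2)[OF assms(2), of "u i" "lp_sum M I u"]
    by (subst lp_sum_insert[OF assms(1)]) (auto intro!: Lp_sum[OF assms(1)])
  with insert show ?case
    by (subst lp_sum_insert[OF assms(1)]) (auto intro: lp_linearD(1)[OF assms(2)])
qed

lemma lp_linear_comp:
  "lp_linear p M N S \<Longrightarrow> lp_linear p N P T \<Longrightarrow> lp_linear p M P (\<lambda>U. T (S U))"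
  by (auto simp: lp_linear_def Pi_iff)

lemma lp_linear_lp_sum:
  assumes "p \<ge> 1" "finite I" "\<And>i. i \<in> I \<Longrightarrow> lp_linear p M N (T i)"
  shows "lp_linear p M N (\<lambda>U. lp_sum N I (\<lambda>i. T i U))"
  unfolding lp_linear_def
proof (intro conjI funcsetI ballI allI)
  note L = lp_linearD[OF assms(3)]
  fix U V and c assume U: "U \<in> Lp p M"
  have TU: "\<And>i. i \<in> I \<Longrightarrow> T i U \<in> Lp p N" by (rule L(1)[OF _ U])
  show *: "lp_sum N I (\<lambda>i. T i U) \<in> Lp p N"
    by (intro Lp_sum assms TU)
  have "AE x in N. rep (lp_scale N c (T i U)) x = c * rep (T i U) x" if "i \<in> I" for i
    using rep_lp_scale[OF TU[OF that]] .
  then have "AE x in N. \<forall>i\<in>I. rep (lp_scale N c (T i U)) x = c * rep (T i U) x"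
    using assms(2) by (simp add: AE_finite_all)
  moreover have "AE x in N. rep (lp_sum N I (\<lambda>i. T i U)) x = (\<Sum>i\<in>I. rep (T i U) x)"
    by (rule rep_lp_sum[OF TU])
  ultimately have "AE x in N. (\<Sum>i\<in>I. rep (lp_scale N c (T i U)) x)
      = c * rep (lp_sum N I (\<lambda>i. T i U)) x"
    by eventually_elim (simp add: sum_distrib_left)
  then show "lp_sum N I (\<lambda>i. T i (lp_scale M c U)) = lp_scale N c (lp_sum N I (\<lambda>i. T i U))"
    unfolding lp_sum_def[of _ _ "\<lambda>i. T i (lp_scale M c U)"] lp_scale_def[of _ _ "lp_sum _ _ _"]
    using L(3)[OF _ U] by (intro ae_class_cong) simp
  assume V: "V \<in> Lp p M"
  have TV: "\<And>i. i \<in> I \<Longrightarrow> T i V \<in> Lp p N" by (rule L(1)[OF _ V])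
  have "AE x in N. rep (lp_add N (T i U) (T i V)) x = rep (T i U) x + rep (T i V) x" if "i \<in> I" for i
    using rep_lp_add[OF TU[OF that] TV[OF that]] .
  then have "AE x in N. \<forall>i\<in>I. rep (lp_add N (T i U) (T i V)) x = rep (T i U) x + rep (T i V) x"
    using assms(2) by (simp add: AE_finite_all)
  moreover have "AE x in N. rep (lp_sum N I (\<lambda>i. T i U)) x = (\<Sum>i\<in>I. rep (T i U) x)"
    by (rule rep_lp_sum[OF TU])
  moreover have "AE x in N. rep (lp_sum N I (\<lambda>i. T i V)) x = (\<Sum>i\<in>I. rep (T i V) x)"
    by (rule rep_lp_sum[OF TV])
  ultimately have "AE x in N. (\<Sum>i\<in>I. rep (lp_add N (T i U) (T i V)) x)
      = rep (lp_sum N I (\<lambda>i. T i U)) x + rep (lp_sum N I (\<lambda>i. T i V)) x"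
    by eventually_elim (simp add: sum.distrib)
  then show "lp_sum N I (\<lambda>i. T i (lp_add M U V))
      = lp_add N (lp_sum N I (\<lambda>i. T i U)) (lp_sum N I (\<lambda>i. T i V))"
    unfolding lp_sum_def[of _ _ "\<lambda>i. T i (lp_add M U V)"] lp_add_def[of _ "lp_sum _ _ _"]
    using L(2)[OF _ U V] by (intro ae_class_cong) simp
qed

lemma lp_linear_scale:
  assumes "lp_linear p M N T"
  shows "lp_linear p M N (\<lambda>U. lp_scale N c (T U))"
  unfolding lp_linear_def
proof (intro conjI funcsetI ballI allI)
  note L = lp_linearD[OF assms]
  fix U V and e assume U: "U \<in> Lp p M"
  show "lp_scale N c (T U) \<in> Lp p N" using L U by (auto intro: Lp_scale)
  show "lp_scale N c (T (lp_scale M e U)) = lp_scale N e (lp_scale N c (T U))"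
    unfolding L(3)[OF U] lp_scale_def[of _ _ "lp_scale _ _ _"]
    using rep_lp_scale[OF L(1)[OF U], of e] rep_lp_scale[OF L(1)[OF U], of c]
    by (intro ae_class_cong) (auto elim: eventually_elim2)
  assume V: "V \<in> Lp p M"
  show "lp_scale N c (T (lp_add M U V)) = lp_add N (lp_scale N c (T U)) (lp_scale N c (T V))"
    unfolding L(2)[OF U V] lp_scale_def[of _ _ "lp_add _ _ _"] lp_add_def[of _ "lp_scale _ _ _"]
    using rep_lp_add[OF L(1)[OF U] L(1)[OF V]] rep_lp_scale[OF L(1)[OF U], of c]
      rep_lp_scale[OF L(1)[OF V], of c]
  proof (intro ae_class_cong, eventually_elim)
  qed (simp add: algebra_simps)
qed

lemma lp_linear_ident: "lp_linear p M M (\<lambda>U. U)"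
  by (simp add: lp_linear_def)

lemma lp_add_uminus_self:
  assumes "U \<in> Lp p M"
  shows "lp_add M U (lp_scale M (- 1) U) = lp_zero M" "lp_add M (lp_scale M (- 1) U) U = lp_zero M"
  unfolding lp_add_def lp_zero_def using rep_lp_scale[OF assms, of "- 1"]
  by (auto intro!: ae_class_cong elim: eventually_mono)

text \<open>The constant compares p-th powers, so it is the p-th power of a bound for the operator.
  Hence the exponents \<open>p\<close> and \<open>1 / p\<close> wherever it meets
  \<open>op_norm\<close>.\<close>

definition opb :: "real \<Rightarrow> 'a measure \<Rightarrow> 'b measure \<Rightarrow>
    (('a \<Rightarrow> complex) set \<Rightarrow> ('b \<Rightarrow> complex) set) \<Rightarrow> real \<Rightarrow> bool" where
  "opb p M N T c \<longleftrightarrow> 0 \<le> c \<and> (\<forall>U\<in>Lp p M. lp_pow p N (T U) \<le> c * lp_pow p M U)"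

lemma opbD: "opb p M N T c \<Longrightarrow> U \<in> Lp p M \<Longrightarrow> lp_pow p N (T U) \<le> c * lp_pow p M U"
  and opb_nonneg: "opb p M N T c \<Longrightarrow> 0 \<le> c"
  by (auto simp: opb_def)

lemma powr_le_powr_inverse_iff:
  fixes a b c p :: real
  assumes "p \<ge> 1" "a \<ge> 0" "b \<ge> 0" "c \<ge> 0"
  shows "a powr (1 / p) \<le> c * b powr (1 / p) \<longleftrightarrow> a \<le> c powr p * b"
proof -
  have "a powr (1 / p) \<le> c * b powr (1 / p)
      \<longleftrightarrow> (a powr (1 / p)) powr p \<le> (c * b powr (1 / p)) powr p"
    using assms by (smt (verit) powr_less_mono2 powr_mono2 powr_ge_zero mult_nonneg_nonneg)
  also have "\<dots> \<longleftrightarrow> a \<le> c powr p * b"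
    using assms by (simp add: powr_powr powr_mult)
  finally show ?thesis .
qed

lemma lp_norm_le_iff:
  assumes "p \<ge> 1" "c \<ge> 0"
  shows "lp_norm p N V \<le> c * lp_norm p M U \<longleftrightarrow> lp_pow p N V \<le> c powr p * lp_pow p M U"
  unfolding lp_norm_lp_pow by (intro powr_le_powr_inverse_iff assms lp_pow_nonneg)

lemma lp_norm_le_1_iff:
  assumes "p \<ge> 1"
  shows "lp_norm p M U \<le> 1 \<longleftrightarrow> lp_pow p M U \<le> 1"
  using powr_le_powr_inverse_iff[OF assms, of "lp_pow p M U" 1 1]
  by (simp add: lp_pow_nonneg lp_norm_lp_pow)

lemma op_norm_leI:
  assumes "p \<ge> 1" "opb p M M T c"
  shows "op_norm p M T \<le> c powr (1 / p)"
  unfolding op_norm_def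
proof (rule cSUP_least)
  have "lp_zero M \<in> {U \<in> Lp p M. lp_norm p M U \<le> 1}"
    using assms by (simp add: Lp_zero lp_norm_le_1_iff lp_pow_zero)
  then show "{U \<in> Lp p M. lp_norm p M U \<le> 1} \<noteq> {}" by blast
  fix U assume U: "U \<in> {U \<in> Lp p M. lp_norm p M U \<le> 1}"
  have "lp_pow p M (T U) \<le> c * lp_pow p M U" using assms(2) U by (auto intro: opbD)
  also have "\<dots> \<le> c * 1"
    using U assms by (intro mult_left_mono) (auto simp: lp_norm_le_1_iff opb_nonneg)
  finally show "lp_norm p M (T U) \<le> c powr (1 / p)"
    unfolding lp_norm_lp_pow using assms by (intro powr_mono2) (auto simp: lp_pow_nonneg)
qed

text \<open>Linearity of \<open>T\<close> enters only through the homogeneity of the norm of its values; this covers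
  \<^const>\<open>matrix_op\<close>, for which linearity is not needed.\<close>

lemma op_norm_bound:
  assumes "p \<ge> 1" "opb p M M T c"
    and h: "\<And>e U. U \<in> Lp p M \<Longrightarrow> lp_pow p M (T (lp_scale M e U)) = cmod e powr p * lp_pow p M (T U)"
  shows "0 \<le> op_norm p M T" "opb p M M T (op_norm p M T powr p)"
proof -
  let ?B = "{U \<in> Lp p M. lp_norm p M U \<le> 1}"
  have bdd: "bdd_above ((\<lambda>U. lp_norm p M (T U)) ` ?B)"
  proof (rule bdd_aboveI2)
    fix U assume U: "U \<in> ?B"
    have "lp_pow p M (T U) \<le> c * lp_pow p M U" using assms(2) U by (auto intro: opbD)
    also have "\<dots> \<le> c * 1"
      using U assms by (intro mult_left_mono) (auto simp: lp_norm_le_1_iff opb_nonneg)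
    finally show "lp_norm p M (T U) \<le> c powr (1 / p)"
      unfolding lp_norm_lp_pow using assms by (intro powr_mono2) (auto simp: lp_pow_nonneg)
  qed
  have "lp_zero M \<in> ?B"
    using assms by (simp add: Lp_zero lp_norm_le_1_iff lp_pow_zero)
  from cSUP_upper[OF this bdd] have "lp_norm p M (T (lp_zero M)) \<le> op_norm p M T"
    by (simp add: op_norm_def)
  moreover have "0 \<le> lp_norm p M (T (lp_zero M))" by (simp add: lp_norm_lp_pow)
  ultimately show nn: "0 \<le> op_norm p M T" by simp
  show "opb p M M T (op_norm p M T powr p)"
    unfolding opb_def
  proof (intro conjI ballI)
    fix U assume U: "U \<in> Lp p M"
    define a where "a = lp_pow p M U"
    show "lp_pow p M (T U) \<le> op_norm p M T powr p * lp_pow p M U"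
    \<comment> \<open>A vector of norm 0 cannot be normalised; there the given bound
      \<open>c\<close> already forces its image to have norm 0.\<close>
    proof (cases "a = 0")
      case True
      with opbD[OF assms(2) U] show ?thesis by (simp add: a_def)
    next
      case False
      then have a: "a > 0" using lp_pow_nonneg[of p M U] by (simp add: a_def)
      \<comment> \<open>Since \<open>a\<close> is the p-th power of the norm of \<open>U\<close>,
        this factor moves \<open>U\<close> to the unit sphere.\<close>
      define e where "e = complex_of_real (a powr (- (1 / p)))"
      have e: "cmod e powr p = 1 / a"
        using a assms(1) unfolding e_def norm_of_real by (simp add: powr_powr powr_minus_divide powr_divide)
      have "lp_pow p M (lp_scale M e U) = 1" using a U by (simp add: lp_pow_scale e a_def)
      then have "lp_scale M e U \<in> ?B" using U assms(1) by (simp add: Lp_scale lp_norm_le_1_iff)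
      from cSUP_upper[OF this bdd] have "lp_norm p M (T (lp_scale M e U)) \<le> op_norm p M T"
        by (simp add: op_norm_def)
      then have "lp_norm p M (T (lp_scale M e U)) powr p \<le> op_norm p M T powr p"
        using assms(1) by (intro powr_mono2) (auto simp: lp_norm_lp_pow)
      also have "lp_norm p M (T (lp_scale M e U)) powr p = lp_pow p M (T U) / a"
        using assms(1) U a by (simp add: lp_norm_lp_pow powr_powr lp_pow_nonneg h e)
      finally show ?thesis using a by (simp add: a_def field_simps)
    qed
  qed simp
qed

lemma bounded_lp_op_iff:
  assumes "p \<ge> 1"
  shows "bounded_lp_op p M T \<longleftrightarrow>
    T \<in> extensional (Lp p M) \<and> lp_linear p M M T \<and> (\<exists>c. opb p M M T c)"
proof -
  have eq: "(\<exists>C. \<forall>U\<in>Lp p M. lp_norm p M (T U) \<le> C * lp_norm p M U) \<longleftrightarrow> (\<exists>c. opb p M M T c)"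
  proof
    assume "\<exists>C. \<forall>U\<in>Lp p M. lp_norm p M (T U) \<le> C * lp_norm p M U"
    then obtain C where C: "\<And>U. U \<in> Lp p M \<Longrightarrow> lp_norm p M (T U) \<le> C * lp_norm p M U" by blast
    have "lp_norm p M (T U) \<le> \<bar>C\<bar> * lp_norm p M U" if "U \<in> Lp p M" for U
      using C[OF that] by (rule order.trans) (auto intro!: mult_right_mono simp: lp_norm_lp_pow)
    then have "opb p M M T (\<bar>C\<bar> powr p)"
      using assms by (auto simp: opb_def lp_norm_le_iff)
    then show "\<exists>c. opb p M M T c" ..
  next
    assume "\<exists>c. opb p M M T c"
    then obtain c where "opb p M M T c" ..
    then have "\<forall>U\<in>Lp p M. lp_norm p M (T U) \<le> c powr (1 / p) * lp_norm p M U"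
      using assms by (auto simp: opb_def lp_norm_le_iff powr_powr)
    then show "\<exists>C. \<forall>U\<in>Lp p M. lp_norm p M (T U) \<le> C * lp_norm p M U" ..
  qed
  show ?thesis
    unfolding bounded_lp_op_def lp_linear_def PiE_def Int_iff eq
    by (simp only: conj_assoc conj_commute conj_left_commute)
qed

section \<open>The record of bounded operators\<close>

lemma BopD:
  assumes "p \<ge> 1" "T \<in> carrier (Bop p M)"
  shows "T \<in> extensional (Lp p M)" "lp_linear p M M T" "\<exists>c. opb p M M T c"
  using assms by (auto simp: Bop_def bounded_lp_op_iff)

lemma BopI:
  assumes "p \<ge> 1" "T \<in> extensional (Lp p M)" "lp_linear p M M T" "opb p M M T c"
  shows "T \<in> carrier (Bop p M)"
  using assms by (auto simp: Bop_def bounded_lp_op_iff)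

lemma Bop_op_norm:
  assumes "p \<ge> 1" "T \<in> carrier (Bop p M)"
  shows "0 \<le> op_norm p M T" "opb p M M T (op_norm p M T powr p)"
proof -
  obtain c where c: "opb p M M T c" using BopD[OF assms] by blast
  have h: "lp_pow p M (T (lp_scale M e U)) = cmod e powr p * lp_pow p M (T U)" if "U \<in> Lp p M" for e U
    using lp_linearD[OF BopD(2)[OF assms] that] by (simp add: lp_pow_scale)
  show "0 \<le> op_norm p M T" "opb p M M T (op_norm p M T powr p)"
    using op_norm_bound[OF assms(1) c h] by auto
qed

text \<open>Negation in a ring record is a definite description. To evaluate it, the pointwise
  negative must be shown to be an additive inverse and the only one.\<close>

lemma Bop_minus_apply:
  assumes "p \<ge> 1" "S \<in> carrier (Bop p M)" "T \<in> carrier (Bop p M)" "U \<in> Lp p M"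
  shows "(S \<ominus>\<^bsub>Bop p M\<^esub> T) U = lp_add M (S U) (lp_scale M (- 1) (T U))"
proof -
  let ?R = "Bop p M"
  define T' where "T' = (\<lambda>U\<in>Lp p M. lp_scale M (- 1) (T U))"
  note T = lp_linearD[OF BopD(2)[OF assms(1,3)]]
  note add0 = lp_add_uminus_self[OF T(1)]
  obtain c where c: "opb p M M T c" using BopD[OF assms(1,3)] by blast
  have "lp_linear p M M (\<lambda>U. lp_scale M (- 1) (T U))"
    by (intro lp_linear_scale BopD assms)
  then have "lp_linear p M M T'"
    by (simp add: lp_linear_def T'_def Pi_iff Lp_scale Lp_add assms(1))
  moreover have "opb p M M T' c"
    using c T by (auto simp: opb_def T'_def lp_pow_scale)
  ultimately have T': "T' \<in> carrier ?R"
    by (intro BopI[of p T' M c] assms(1)) (auto simp: T'_def)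
  have "\<ominus>\<^bsub>?R\<^esub> T = T'"
    unfolding a_inv_def m_inv_def
  proof (rule the_equality)
    show "T' \<in> carrier (add_monoid ?R) \<and> T \<otimes>\<^bsub>add_monoid ?R\<^esub> T' = \<one>\<^bsub>add_monoid ?R\<^esub> \<and>
        T' \<otimes>\<^bsub>add_monoid ?R\<^esub> T = \<one>\<^bsub>add_monoid ?R\<^esub>"
      using T' add0 by (auto simp: Bop_def T'_def restrict_def fun_eq_iff)
  next
    fix R assume "R \<in> carrier (add_monoid ?R) \<and> T \<otimes>\<^bsub>add_monoid ?R\<^esub> R = \<one>\<^bsub>add_monoid ?R\<^esub> \<and>
        R \<otimes>\<^bsub>add_monoid ?R\<^esub> T = \<one>\<^bsub>add_monoid ?R\<^esub>"
    then have R: "R \<in> carrier ?R"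
      and eq: "(\<lambda>U\<in>Lp p M. lp_add M (T U) (R U)) = (\<lambda>U\<in>Lp p M. lp_zero M)"
      by (auto simp: Bop_def)
    show "R = T'"
    proof (rule extensionalityI[OF BopD(1)[OF assms(1) R] BopD(1)[OF assms(1) T']])
      fix U assume U: "U \<in> Lp p M"
      note RU = lp_linearD(1)[OF BopD(2)[OF assms(1) R] U]
      have "lp_add M (T U) (R U) = lp_zero M" using fun_cong[OF eq, of U] U by simp
      then have "AE x in M. rep (T U) x + rep (R U) x = 0"
        using rep_lp_add[OF T(1)[OF U] RU] rep_lp_zero[of M] by (auto elim: eventually_elim2)
      with rep_lp_scale[OF T(1)[OF U], of "- 1"]
      have "AE x in M. rep (R U) x = rep (lp_scale M (- 1) (T U)) x"
        by eventually_elim (auto simp: add_eq_0_iff)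
      then have "R U = lp_scale M (- 1) (T U)"
        using T(1)[OF U] RU by (intro Lp_eqI) (auto intro: Lp_scale)
      then show "R U = T' U" using U by (simp add: T'_def)
    qed
  qed
  then show ?thesis using assms(4) by (simp add: a_minus_def) (simp add: Bop_def T'_def)
qed

section \<open>Norms of spatial operators\<close>

text \<open>Turns identities modulo null sets into almost-everywhere statements, which combine
  countably often and by pointwise logic.\<close>

lemma eq_mod_null_iff_AE:
  assumes "A \<in> sets M" "B \<in> sets M"
  shows "eq_mod_null M A B \<longleftrightarrow> (AE x in M. x \<in> A \<longleftrightarrow> x \<in> B)"
proof -
  have "sym_diff A B \<in> sets M" using assms by auto
  moreover have "sym_diff A B = {x\<in>space M. \<not> (x \<in> A \<longleftrightarrow> x \<in> B)}"
    using assms sets.sets_into_space by blast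
  ultimately show ?thesis
    using AE_iff_null[of M "\<lambda>x. x \<in> A \<longleftrightarrow> x \<in> B"] by (simp add: eq_mod_null_def)
qed

locale measure_algebra_iso =
  fixes N :: "'a measure" and P :: "'b measure" and S :: "'a set \<Rightarrow> 'b set"
  assumes iso: "set_iso N P S"
begin

lemma S_sets [measurable]: "A \<in> sets N \<Longrightarrow> S A \<in> sets P"
  using iso by (auto simp: set_iso_def)

lemma S_cong:
  assumes "A \<in> sets N" "B \<in> sets N"
  shows "(AE y in P. y \<in> S A \<longleftrightarrow> y \<in> S B) \<longleftrightarrow> (AE x in N. x \<in> A \<longleftrightarrow> x \<in> B)"
proof -
  have "eq_mod_null N A B \<longleftrightarrow> eq_mod_null P (S A) (S B)"
    using iso assms by (auto simp: set_iso_def)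
  then show ?thesis using assms by (simp add: eq_mod_null_iff_AE S_sets)
qed

lemma S_Compl:
  assumes "A \<in> sets N"
  shows "AE y in P. y \<in> S (space N - A) \<longleftrightarrow> y \<notin> S A"
proof -
  have "eq_mod_null P (S (space N - A)) (space P - S A)"
    using iso assms by (auto simp: set_iso_def)
  then have "AE y in P. y \<in> S (space N - A) \<longleftrightarrow> y \<in> space P - S A"
    using assms S_sets[of "space N - A"] S_sets[OF assms] by (subst (asm) eq_mod_null_iff_AE) auto
  then show ?thesis using AE_space by eventually_elim auto
qed

text \<open>Any countable index type is reached through the surjection \<open>from_nat\<close>, as
  repetitions do not change a union. Booleans and rationals serve as indices below.\<close>

lemma S_UN:
  fixes A :: "'i::countable \<Rightarrow> 'a set"
  assumes "\<And>i. A i \<in> sets N"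
  shows "AE y in P. y \<in> S (\<Union>i. A i) \<longleftrightarrow> (\<exists>i. y \<in> S (A i))"
proof -
  let ?A = "\<lambda>n. A (from_nat n)"
  have r: "range ?A \<subseteq> sets N" using assms by auto
  have "eq_mod_null P (S (\<Union>n. ?A n)) (\<Union>n. S (?A n))"
    using iso r unfolding set_iso_def by blast
  moreover have "S (\<Union>n. ?A n) \<in> sets P" "(\<Union>n. S (?A n)) \<in> sets P"
    using assms by (auto intro!: S_sets sets.countable_UN)
  ultimately have "AE y in P. y \<in> S (\<Union>n. ?A n) \<longleftrightarrow> y \<in> (\<Union>n. S (?A n))"
    by (subst (asm) eq_mod_null_iff_AE) auto
  moreover have "(\<Union>n. ?A n) = (\<Union>i. A i)"
    by (metis surj_from_nat image_image)
  moreover have "(\<exists>n. y \<in> S (?A n)) \<longleftrightarrow> (\<exists>i. y \<in> S (A i))" for y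
    by (metis from_nat_to_nat)
  ultimately show ?thesis by simp
qed

lemma S_Un:
  assumes "A \<in> sets N" "B \<in> sets N"
  shows "AE y in P. y \<in> S (A \<union> B) \<longleftrightarrow> y \<in> S A \<or> y \<in> S B"
  using S_UN[of "\<lambda>b. if b then A else B"] assms
  by (simp add: UNIV_bool Un_commute ex_bool_eq disj_commute)

text \<open>Up to null sets \<open>S {}\<close> is contained in \<open>S (space N)\<close> by
  \<open>S_Un\<close> and disjoint from it by \<open>S_Compl\<close>.\<close>

lemma S_empty: "AE y in P. y \<notin> S {}"
  using S_Un[of "{}" "space N"] S_Compl[of "{}"] by (auto elim: eventually_elim2)

lemma S_Int:
  assumes "A \<in> sets N" "B \<in> sets N"
  shows "AE y in P. y \<in> S (A \<inter> B) \<longleftrightarrow> y \<in> S A \<and> y \<in> S B"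
proof -
  have eq: "A \<inter> B = space N - ((space N - A) \<union> (space N - B))"
    using assms sets.sets_into_space by blast
  have "AE y in P. y \<in> S (A \<inter> B) \<longleftrightarrow> y \<notin> S ((space N - A) \<union> (space N - B))"
    unfolding eq using assms by (intro S_Compl) auto
  moreover have "AE y in P. y \<in> S ((space N - A) \<union> (space N - B)) \<longleftrightarrow>
      y \<in> S (space N - A) \<or> y \<in> S (space N - B)"
    using assms by (intro S_Un) auto
  ultimately show ?thesis using S_Compl[OF assms(1)] S_Compl[OF assms(2)]
    by eventually_elim auto
qed

lemma set_iso_inv:
  assumes "B \<in> sets P"
  shows "set_iso_inv N P S B \<in> sets N" "AE y in P. y \<in> S (set_iso_inv N P S B) \<longleftrightarrow> y \<in> B"
proof -
  have "\<exists>A. A \<in> sets N \<and> eq_mod_null P (S A) B"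
    using iso assms by (auto simp: set_iso_def)
  then have *: "set_iso_inv N P S B \<in> sets N \<and> eq_mod_null P (S (set_iso_inv N P S B)) B"
    unfolding set_iso_inv_def by (rule someI_ex)
  then show "set_iso_inv N P S B \<in> sets N" by simp
  then show "AE y in P. y \<in> S (set_iso_inv N P S B) \<longleftrightarrow> y \<in> B"
    using * eq_mod_null_iff_AE[OF S_sets[OF conjunct1[OF *]] assms] by simp
qed

text \<open>Makes the choice inside \<open>set_iso_inv\<close> harmless: preimages are determined up
  to null sets because \<open>S\<close> is injective up to null sets.\<close>

lemma set_iso_inv_eq:
  assumes "B \<in> sets P" "A \<in> sets N" "AE y in P. y \<in> S A \<longleftrightarrow> y \<in> B"
  shows "AE x in N. x \<in> set_iso_inv N P S B \<longleftrightarrow> x \<in> A"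
proof -
  have "AE y in P. y \<in> S (set_iso_inv N P S B) \<longleftrightarrow> y \<in> S A"
    using set_iso_inv(2)[OF assms(1)] assms(3) by eventually_elim auto
  then show ?thesis using S_cong[OF set_iso_inv(1)[OF assms(1)] assms(2)] by simp
qed

lemma sets_push_measure [simp, measurable_cong]: "sets (push_measure N P S) = sets P"
  and space_push_measure [simp]: "space (push_measure N P S) = space P"
  by (simp_all add: push_measure_def)

lemma emeasure_push_measure:
  assumes "B \<in> sets P"
  shows "emeasure (push_measure N P S) B = emeasure N (set_iso_inv N P S B)"
  unfolding push_measure_def
proof (rule emeasure_measure_of_sigma)
  let ?I = "set_iso_inv N P S"
  show "sigma_algebra (space P) (sets P)" by (rule sets.sigma_algebra_axioms)
  have "AE x in N. x \<in> ?I {} \<longleftrightarrow> x \<in> {}"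
    using S_empty by (intro set_iso_inv_eq) auto
  then have "emeasure N (?I {}) = emeasure N {}"
    by (intro emeasure_eq_AE) (auto intro: set_iso_inv)
  then show "positive (sets P) (\<lambda>B. emeasure N (?I B))" by (simp add: positive_def)
  show "countably_additive (sets P) (\<lambda>B. emeasure N (?I B))"
  proof (rule countably_additiveI)
    fix B :: "nat \<Rightarrow> 'b set"
    assume B: "range B \<subseteq> sets P" "disjoint_family B"
    define C where "C n = ?I (B n)" for n
    have BP: "B n \<in> sets P" for n using B by auto
    have C: "C n \<in> sets N" for n by (simp add: C_def set_iso_inv BP)
    have SC: "AE y in P. y \<in> S (C n) \<longleftrightarrow> y \<in> B n" for n
      unfolding C_def by (intro set_iso_inv BP)
    \<comment> \<open>Preimages of disjoint sets are disjoint only up to null sets. Additivity is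
      therefore proved for \<open>disjointed C\<close>, which agrees with \<open>C\<close> almost
      everywhere.\<close>
    have "AE x in N. x \<in> C i \<inter> C j \<longleftrightarrow> x \<in> {}" if "i \<noteq> j" for i j
    proof (subst S_cong[symmetric])
      show "AE y in P. (y \<in> S (C i \<inter> C j)) = (y \<in> S {})"
        using S_Int[OF C C, of i j] SC[of i] SC[of j] S_empty
      proof eventually_elim
        case (elim y)
        then show ?case using B(2) that by (auto simp: disjoint_family_on_def)
      qed
    qed (use C in auto)
    then have "AE x in N. \<forall>i j. i \<noteq> j \<longrightarrow> x \<notin> C i \<inter> C j"
      unfolding AE_all_countable by auto
    then have D: "AE x in N. \<forall>n. x \<in> disjointed C n \<longleftrightarrow> x \<in> C n"
          proof eventually_elim
      case (elim x)
      have "x \<in> C n \<Longrightarrow> i < n \<Longrightarrow> x \<notin> C i" for i n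
        using elim[rule_format, of i n] by auto
      then show ?case unfolding disjointed_def by auto
    qed
    have dj: "disjointed C n \<in> sets N" for n
      using C sets.range_disjointed_sets[of C N] by auto
    have "(\<Sum>n. emeasure N (?I (B n))) = (\<Sum>n. emeasure N (disjointed C n))"
      using D C dj unfolding C_def[symmetric]
      by (intro suminf_cong emeasure_eq_AE) (auto elim: eventually_mono)
    also have "\<dots> = emeasure N (\<Union>n. disjointed C n)"
      using dj by (intro suminf_emeasure disjoint_family_disjointed) auto
    also have "\<dots> = emeasure N (\<Union>n. C n)" by (simp add: UN_disjointed_eq)
    also have "\<dots> = emeasure N (?I (\<Union>n. B n))"
    proof (rule emeasure_eq_AE[symmetric])
      have "AE y in P. \<forall>n. y \<in> S (C n) \<longleftrightarrow> y \<in> B n"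
        using SC unfolding AE_all_countable by auto
      then have "AE y in P. y \<in> S (\<Union>n. C n) \<longleftrightarrow> y \<in> (\<Union>n. B n)"
        using S_UN[of C, OF C] by eventually_elim auto
      then show "AE x in N. (x \<in> ?I (\<Union>n. B n)) = (x \<in> (\<Union>n. C n))"
        using C BP by (intro set_iso_inv_eq) auto
    qed (use C BP set_iso_inv in auto)
    finally show "(\<Sum>n. emeasure N (?I (B n))) = emeasure N (?I (\<Union>n. B n))" .
  qed
qed (use assms in auto)

lemma emeasure_push_measure_eq:
  assumes "B \<in> sets P" "A \<in> sets N" "AE y in P. y \<in> S A \<longleftrightarrow> y \<in> B"
  shows "emeasure (push_measure N P S) B = emeasure N A"
  unfolding emeasure_push_measure[OF assms(1)]
  by (intro emeasure_eq_AE set_iso_inv_eq assms set_iso_inv)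

text \<open>A null set of \<open>P\<close> has the empty set as a preimage. This is what makes the
  derivative in \<open>spatial_op\<close> a density of the pushed measure.\<close>

lemma absolutely_continuous_push_measure: "absolutely_continuous P (push_measure N P S)"
  unfolding absolutely_continuous_def
proof
  fix B assume B: "B \<in> null_sets P"
  then have "AE y in P. y \<notin> B" by (rule AE_not_in)
  with S_empty have "AE y in P. y \<in> S {} \<longleftrightarrow> y \<in> B" by eventually_elim auto
  from emeasure_push_measure_eq[OF _ _ this] B
  show "B \<in> null_sets (push_measure N P S)" by (auto simp: null_sets_def)
qed

text \<open>Ensures that the Radon-Nikodym derivative is finite almost everywhere, as is needed
  before \<open>enn2real\<close> is applied to it.\<close>

lemma sigma_finite_push_measure:
  assumes "sigma_finite_measure N"
  shows "sigma_finite_measure (push_measure N P S)"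
proof -
  interpret sigma_finite_measure N by fact
  obtain A :: "nat \<Rightarrow> 'a set" where A: "range A \<subseteq> sets N" "(\<Union>i. A i) = space N"
    "\<And>i. emeasure N (A i) \<noteq> \<infinity>" using sigma_finite by blast
  \<comment> \<open>The images of the \<open>A i\<close> cover \<open>space P\<close> only up to a
    null set; \<open>Z\<close> is the remainder and completes the cover.\<close>
  define Z where "Z = space P - (\<Union>i. S (A i))"
  have AN: "A i \<in> sets N" for i using A by auto
  have "AE y in P. y \<in> S (space N)"
    using S_Compl[of "{}"] S_empty by auto
  then have "AE y in P. \<exists>i. y \<in> S (A i)"
    using S_UN[of A, OF AN] unfolding A by eventually_elim auto
  then have "AE y in P. y \<in> S {} \<longleftrightarrow> y \<in> Z"
    using S_empty by eventually_elim (auto simp: Z_def)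
  then have Z: "emeasure (push_measure N P S) Z = 0"
    using AN by (subst emeasure_push_measure_eq[of Z "{}"]) (auto simp: Z_def)
  have SA: "emeasure (push_measure N P S) (S (A i)) \<noteq> \<infinity>" for i
    using A(3)[of i] AN by (subst emeasure_push_measure_eq[of _ "A i"]) auto
  show ?thesis
  proof
    have "S (A i) \<subseteq> space P" for i using AN by (intro sets.sets_into_space) auto
    then show "\<exists>A. countable A \<and> A \<subseteq> sets (push_measure N P S) \<and>
        \<Union> A = space (push_measure N P S) \<and> (\<forall>a\<in>A. emeasure (push_measure N P S) a \<noteq> \<infinity>)"
      using SA Z AN by (intro exI[of _ "insert Z (range (\<lambda>i. S (A i)))"]) (auto simp: Z_def)
  qed
qed

text \<open>The sets \<open>S {f \<le> q}\<close>, \<open>q\<close> rational, play the role of the sublevel sets of the push-forward,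
  which is recovered from them as an infimum wherever they behave monotonically.\<close>

lemma ex_push_real:
  fixes f :: "'a \<Rightarrow> real"
  assumes [measurable]: "f \<in> borel_measurable N"
  shows "\<exists>g\<in>borel_measurable P. \<forall>r. AE y in P. y \<in> S {x \<in> space N. f x < r} \<longleftrightarrow> g y < r"
proof -
  define F where "F q = {x \<in> space N. f x \<le> of_rat q}" for q
  define D where "D q = S (F q)" for q
  have F [measurable]: "F q \<in> sets N" for q unfolding F_def by measurable
  have D [measurable]: "D q \<in> sets P" for q unfolding D_def by (intro S_sets F)
  define G where "G y \<longleftrightarrow> (\<forall>q q'. q \<le> q' \<longrightarrow> y \<in> D q \<longrightarrow> y \<in> D q') \<and>
    (\<exists>q. y \<in> D q) \<and> (\<exists>q. y \<notin> D q)" for y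
  define g where "g y = (if G y then Inf {real_of_rat q | q. y \<in> D q} else 0)" for y
  \<comment> \<open>An infimum lies below \<open>r\<close> iff some member does. So strict sublevel
    sets of \<open>g\<close> are countable unions of the sets \<open>D q\<close>, and measurability
    can be read off.\<close>
  have g_less: "g y < r \<longleftrightarrow> (if G y then \<exists>q. real_of_rat q < r \<and> y \<in> D q else 0 < r)" for y r
  proof (cases "G y")
    case True
    then obtain q0 where q0: "y \<notin> D q0" by (auto simp: G_def)
    have "bdd_below {real_of_rat q | q. y \<in> D q}"
    proof (rule bdd_belowI)
      fix x assume "x \<in> {real_of_rat q | q. y \<in> D q}"
      then obtain q where q: "x = real_of_rat q" "y \<in> D q" by blast
      have "q \<le> q0 \<longrightarrow> y \<in> D q \<longrightarrow> y \<in> D q0" using True unfolding G_def by blast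
      then have "q0 \<le> q" using q q0 by linarith
      then show "real_of_rat q0 \<le> x" by (simp add: q of_rat_less_eq)
    qed
    moreover have "{real_of_rat q | q. y \<in> D q} \<noteq> {}" using True by (auto simp: G_def)
    ultimately show ?thesis using True by (auto simp: g_def cInf_less_iff)
  qed (simp add: g_def)
  have "g \<in> borel_measurable P"
    unfolding borel_measurable_iff_less g_less G_def by measurable
  moreover have "AE y in P. y \<in> S {x \<in> space N. f x < r} \<longleftrightarrow> g y < r" for r
  proof -
    have mono: "AE y in P. q \<le> q' \<longrightarrow> y \<in> D q \<longrightarrow> y \<in> D q'" for q q'
    proof (cases "q \<le> q'")
      case True
      then have "F q \<inter> F q' = F q"
        by (auto simp: F_def of_rat_less_eq intro: order.trans)
      then show ?thesis using S_Int[OF F F, of q q'] by (auto simp: D_def elim: eventually_mono)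
    qed auto
    have "\<exists>q. f x \<le> real_of_rat q" for x
      using of_rat_dense[of "f x" "f x + 1"] by (auto intro: less_imp_le)
    then have "(\<Union>q. F q) = space N" by (auto simp: F_def)
    then have ex1: "AE y in P. \<exists>q. y \<in> D q"
      using S_UN[of F] S_Compl[of "{}"] S_empty by (auto simp: D_def elim: eventually_elim2)
    have "(\<Union>q. space N - F q) = space N"
    proof -
      have "\<exists>q. \<not> f x \<le> real_of_rat q" for x
        using of_rat_dense[of "f x - 1" "f x"] by (auto simp: not_le)
      then show ?thesis by (auto simp: F_def)
    qed
    then have "AE y in P. \<exists>q. y \<in> S (space N - F q)"
      using S_UN[of "\<lambda>q. space N - F q"] S_Compl[of "{}"] S_empty by (auto elim: eventually_elim2)
    moreover have "AE y in P. \<forall>q. y \<in> S (space N - F q) \<longleftrightarrow> y \<notin> D q"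
      unfolding AE_all_countable D_def by (intro allI S_Compl F)
    ultimately have ex2: "AE y in P. \<exists>q. y \<notin> D q" by eventually_elim auto
    have "AE y in P. \<forall>q q'. q \<le> q' \<longrightarrow> y \<in> D q \<longrightarrow> y \<in> D q'"
      unfolding AE_all_countable using mono by blast
    with ex1 ex2 have G: "AE y in P. G y" unfolding G_def by eventually_elim auto
    \<comment> \<open>The set where f < r is the union of the \<open>F q\<close> over rational q <
      r. Other indices contribute the empty set, so that \<open>S_UN\<close> applies over all
      rationals.\<close>
    define E where "E q = (if real_of_rat q < r then F q else {})" for q
    have "(\<Union>q. E q) = {x \<in> space N. f x < r}"
      using of_rat_dense[of _ r] by (auto simp: E_def F_def split: if_splits) (metis less_eq_real_def)
    then have "AE y in P. y \<in> S {x \<in> space N. f x < r} \<longleftrightarrow> (\<exists>q. y \<in> S (E q))"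
      using S_UN[of E] by (simp add: E_def)
    with G S_empty show ?thesis
    proof eventually_elim
      case (elim y)
      then show ?case by (auto simp: g_less E_def D_def split: if_splits)
    qed
  qed
  ultimately show ?thesis by blast
qed

text \<open>Real and imaginary parts are pushed forward separately. This settles the half-planes
  parallel to the axes, and induction over the \<sigma>-algebra they generate gives all Borel
  sets.\<close>

lemma ex_push_fun:
  assumes [measurable]: "\<xi> \<in> borel_measurable N"
  shows "\<exists>\<eta>. is_push_fun N P S \<xi> \<eta>"
proof -
  obtain g1 where g1: "g1 \<in> borel_measurable P"
    "\<And>r. AE y in P. y \<in> S {x \<in> space N. Re (\<xi> x) < r} \<longleftrightarrow> g1 y < r"
    using ex_push_real[of "\<lambda>x. Re (\<xi> x)"] by auto
  obtain g2 where g2: "g2 \<in> borel_measurable P"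
    "\<And>r. AE y in P. y \<in> S {x \<in> space N. Im (\<xi> x) < r} \<longleftrightarrow> g2 y < r"
    using ex_push_real[of "\<lambda>x. Im (\<xi> x)"] by auto
  define \<eta> where "\<eta> y = Complex (g1 y) (g2 y)" for y
  have \<eta> [measurable]: "\<eta> \<in> borel_measurable P"
    unfolding borel_measurable_complex_iff using g1(1) g2(1) by (simp add: \<eta>_def)
  have ae: "AE y in P. y \<in> S (\<xi> -` E \<inter> space N) \<longleftrightarrow> \<eta> y \<in> E" if "E \<in> sets borel" for E
  proof -
    let ?G = "(\<lambda>(a, i). {x::complex. x \<bullet> i < a}) ` (UNIV \<times> Basis)"
    have pre: "\<xi> -` E \<inter> space N \<in> sets N" if "E \<in> sigma_sets UNIV ?G" for E
      using that by (intro measurable_sets[OF assms])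
        (simp add: borel_eq_halfspace_less[where 'a=complex])
    have "E \<in> sigma_sets UNIV ?G"
      using that by (simp add: borel_eq_halfspace_less[where 'a=complex])
    then show ?thesis
    proof induction
      case (Basic E)
      then have "\<exists>a. E = {x. Re x < a} \<or> E = {x. Im x < a}"
        by (auto simp: Basis_complex_def inner_complex_def)
      then obtain a where "E = {x. Re x < a} \<or> E = {x. Im x < a}" ..
      moreover have "\<xi> -` {x. Re x < a} \<inter> space N = {x \<in> space N. Re (\<xi> x) < a}"
        "\<xi> -` {x. Im x < a} \<inter> space N = {x \<in> space N. Im (\<xi> x) < a}" by auto
      ultimately show ?case using g1(2)[of a] g2(2)[of a] by (auto simp: \<eta>_def)
    next
      case Empty
      then show ?case using S_empty by simp
    next
      case (Compl E)
      have "\<xi> -` (UNIV - E) \<inter> space N = space N - (\<xi> -` E \<inter> space N)" by auto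
      with S_Compl[OF pre[OF Compl.hyps]] Compl.IH show ?case
        by (auto elim: eventually_elim2)
    next
      case (Union E)
      have "AE y in P. \<forall>i. y \<in> S (\<xi> -` E i \<inter> space N) \<longleftrightarrow> \<eta> y \<in> E i"
        unfolding AE_all_countable using Union.IH by blast
      moreover have "\<xi> -` (\<Union>i. E i) \<inter> space N = (\<Union>i. \<xi> -` E i \<inter> space N)" by auto
      ultimately show ?case
        using S_UN[of "\<lambda>i. \<xi> -` E i \<inter> space N", OF pre[OF Union.hyps]]
        by (auto elim: eventually_elim2)
    qed
  qed
  have "eq_mod_null P (S (\<xi> -` E \<inter> space N)) (\<eta> -` E \<inter> space P)" if E: "E \<in> sets borel" for E
  proof (subst eq_mod_null_iff_AE)
    show "AE x in P. (x \<in> S (\<xi> -` E \<inter> space N)) = (x \<in> \<eta> -` E \<inter> space P)"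
      using ae[OF E] AE_space by eventually_elim auto
  qed (use measurable_sets[OF assms E] measurable_sets[OF \<eta> E] S_sets in auto)
  with \<eta> show ?thesis unfolding is_push_fun_def by blast
qed

text \<open>Level sets correspond under \<open>S\<close>, and \<open>push_measure\<close> gives
  corresponding sets equal measure. Equality of distributions is the form of this that integrals can
  use.\<close>

lemma push_fun:
  assumes "\<xi> \<in> borel_measurable N"
  shows "push_fun N P S \<xi> \<in> borel_measurable P"
    and "distr (push_measure N P S) borel (push_fun N P S \<xi>) = distr N borel \<xi>"
proof -
  let ?\<eta> = "push_fun N P S \<xi>"
  have *: "is_push_fun N P S \<xi> ?\<eta>"
    unfolding push_fun_def by (rule someI_ex[OF ex_push_fun[OF assms]])
  then show \<eta>: "?\<eta> \<in> borel_measurable P" by (simp add: is_push_fun_def)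
  then have \<eta>': "?\<eta> \<in> borel_measurable (push_measure N P S)" by measurable
  show "distr (push_measure N P S) borel ?\<eta> = distr N borel \<xi>"
  proof (rule measure_eqI)
    fix E assume "E \<in> sets (distr (push_measure N P S) borel ?\<eta>)"
    then have E: "E \<in> sets borel" by simp
    have s: "\<xi> -` E \<inter> space N \<in> sets N" "?\<eta> -` E \<inter> space P \<in> sets P"
      using measurable_sets[OF assms E] measurable_sets[OF \<eta> E] by auto
    have "eq_mod_null P (S (\<xi> -` E \<inter> space N)) (?\<eta> -` E \<inter> space P)"
      using * E by (simp add: is_push_fun_def)
    then have "emeasure (push_measure N P S) (?\<eta> -` E \<inter> space P) = emeasure N (\<xi> -` E \<inter> space N)"
      using s by (intro emeasure_push_measure_eq) (simp_all add: eq_mod_null_iff_AE S_sets)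
    then show "emeasure (distr (push_measure N P S) borel ?\<eta>) E = emeasure (distr N borel \<xi>) E"
      using \<eta>' assms E by (simp add: emeasure_distr)
  qed simp
qed

text \<open>Change of variables: the density turns an integral over \<open>P\<close> into one over
  the pushed measure, and equality of distributions carries that back to \<open>N\<close>.\<close>

lemma nn_integral_push_fun:
  assumes "sigma_finite_measure N" "sigma_finite_measure P" "\<xi> \<in> borel_measurable N"
    and [measurable]: "F \<in> borel_measurable borel"
  shows "(\<integral>\<^sup>+y. RN_deriv P (push_measure N P S) y * F (push_fun N P S \<xi> y) \<partial>P) = (\<integral>\<^sup>+x. F (\<xi> x) \<partial>N)"
proof -
  interpret P: sigma_finite_measure P by fact
  note [measurable] = push_fun(1)[OF assms(3)] assms(3)
  have "(\<integral>\<^sup>+y. RN_deriv P (push_measure N P S) y * F (push_fun N P S \<xi> y) \<partial>P)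
      = (\<integral>\<^sup>+y. F (push_fun N P S \<xi> y) \<partial>push_measure N P S)"
    by (intro P.RN_deriv_nn_integral[symmetric] absolutely_continuous_push_measure) auto
  also have "\<dots> = (\<integral>\<^sup>+z. F z \<partial>distr (push_measure N P S) borel (push_fun N P S \<xi>))"
    by (subst nn_integral_distr) auto
  also have "\<dots> = (\<integral>\<^sup>+x. F (\<xi> x) \<partial>N)"
    unfolding push_fun(2)[OF assms(3)] by (subst nn_integral_distr) auto
  finally show ?thesis .
qed

end

text \<open>After taking p-th powers the factor with exponent 1/p becomes exactly the density of the
  change of variables, and the unimodular \<open>g\<close> disappears. Thus a spatial operator
  preserves the norm on \<open>K\<close> and kills what lives off \<open>K\<close>.\<close>

lemma lp_pow_spatial_op:
  assumes "p \<ge> 1" "sigma_finite_measure M" "spatial_system M K L S g" "U \<in> Lp p M"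
  shows "lp_pow p M (spatial_op p M K L S g U) = (\<integral>x. indicator K x * cmod (rep U x) powr p \<partial>M)"
proof -
  define N where "N = restrict_space M K"
  define P where "P = restrict_space M L"
  define h where "h = RN_deriv P (push_measure N P S)"
  define \<eta> where "\<eta> = push_fun N P S (rep U)"
  define f where "f = (\<lambda>y. if y \<in> L
           then g y * complex_of_real (enn2real (h y) powr (1 / p)) * \<eta> y else 0)"
  have K[measurable]: "K \<in> sets M" and L[measurable]: "L \<in> sets M"
    and g [measurable]: "g \<in> borel_measurable P" and g1: "AE y in P. cmod (g y) = 1"
    using assms(3) unfolding spatial_system_def P_def by auto
  interpret measure_algebra_iso N P S
    using assms(3) by (simp add: measure_algebra_iso_def spatial_system_def P_def N_def)
  have sN: "sigma_finite_measure N" and sP: "sigma_finite_measure P"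
    unfolding N_def P_def using assms(2) by (auto intro: sigma_finite_measure_restrict_space)
  interpret P: sigma_finite_measure P by fact
  note U [measurable] = Lp_measurable[OF assms(4)]
  have UN: "rep U \<in> borel_measurable N"
    unfolding N_def using U by (rule measurable_restrict_space1)
  have \<eta> [measurable]: "\<eta> \<in> borel_measurable P" unfolding \<eta>_def by (rule push_fun(1)[OF UN])
  have h [measurable]: "h \<in> borel_measurable P" unfolding h_def by measurable
  \<comment> \<open>\<open>enn2real\<close> sends infinity to 0, so the density is recovered from
    \<open>h\<close> only where it is finite.\<close>
  have hfin: "AE y in P. h y \<noteq> \<infinity>" unfolding h_def
    by (intro P.RN_deriv_finite sigma_finite_push_measure sN absolutely_continuous_push_measure) simp
  have "(\<lambda>y. g y * complex_of_real (enn2real (h y) powr (1 / p)) * \<eta> y) \<in> borel_measurable P"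
    by measurable
  then have "(\<lambda>y. indicator L y *\<^sub>R (g y * complex_of_real (enn2real (h y) powr (1 / p)) * \<eta> y)) \<in> borel_measurable M"
    unfolding P_def by (subst (asm) borel_measurable_restrict_space_iff) auto
  moreover have "(\<lambda>y. indicator L y *\<^sub>R (g y * complex_of_real (enn2real (h y) powr (1 / p)) * \<eta> y)) = f"
    by (auto simp: f_def fun_eq_iff)
  ultimately have f [measurable]: "f \<in> borel_measurable M" by simp
  \<comment> \<open>Nonnegative integrals avoid questions of integrability; the Bochner integral
    returns at the end.\<close>
  have "(\<integral>\<^sup>+y. ennreal (cmod (f y) powr p) \<partial>M) = (\<integral>\<^sup>+y. ennreal (cmod (f y) powr p) * indicator L y \<partial>M)"
    by (intro nn_integral_cong) (auto simp: f_def)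
  also have "\<dots> = (\<integral>\<^sup>+y. ennreal (cmod (f y) powr p) \<partial>P)"
    unfolding P_def by (subst nn_integral_restrict_space) auto
  also have "\<dots> = (\<integral>\<^sup>+y. h y * ennreal (cmod (\<eta> y) powr p) \<partial>P)"
  proof (rule nn_integral_cong_AE)
    show "AE y in P. ennreal (cmod (f y) powr p) = h y * ennreal (cmod (\<eta> y) powr p)"
      using hfin g1 AE_space
    proof eventually_elim
      case (elim y)
      then have "y \<in> L" by (simp add: P_def space_restrict_space)
      then have "cmod (f y) powr p = enn2real (h y) * cmod (\<eta> y) powr p"
        using elim assms(1) by (simp add: f_def norm_mult powr_mult powr_powr)
      then show ?case using elim by (simp add: ennreal_mult ennreal_enn2real less_top)
    qed
  qed
  also have "\<dots> = (\<integral>\<^sup>+x. ennreal (cmod (rep U x) powr p) \<partial>N)"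
    unfolding h_def \<eta>_def using sN sP UN
    by (intro nn_integral_push_fun[where F = "\<lambda>z. ennreal (cmod z powr p)"]) auto
  also have "\<dots> = (\<integral>\<^sup>+x. ennreal (indicator K x * cmod (rep U x) powr p) \<partial>M)"
    unfolding N_def by (subst nn_integral_restrict_space) (auto intro!: nn_integral_cong simp: indicator_def)
  finally have eq: "(\<integral>\<^sup>+y. ennreal (cmod (f y) powr p) \<partial>M)
      = (\<integral>\<^sup>+x. ennreal (indicator K x * cmod (rep U x) powr p) \<partial>M)" .
  have "spatial_op p M K L S g U = ae_class M f"
    using assms(4) unfolding f_def h_def \<eta>_def N_def P_def by (simp add: spatial_op_def Let_def)
  then have "lp_pow p M (spatial_op p M K L S g U) = (\<integral>y. cmod (f y) powr p \<partial>M)"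
    by (simp add: lp_pow_ae_class)
  also have "\<dots> = (\<integral>x. indicator K x * cmod (rep U x) powr p \<partial>M)"
    by (subst (1 2) integral_eq_nn_integral) (auto simp: eq)
  finally show ?thesis .
qed

section \<open>The Leavitt algebra\<close>

lemma free_algebra_mult_closed:
  assumes "f \<in> carrier (free_algebra G)" "g \<in> carrier (free_algebra G)"
  shows "f \<otimes>\<^bsub>free_algebra G\<^esub> g \<in> carrier (free_algebra G)"
proof -
  let ?h = "f \<otimes>\<^bsub>free_algebra G\<^esub> g"
  have fin: "finite {w. f w \<noteq> 0}" "finite {w. g w \<noteq> 0}"
    and G: "{w. f w \<noteq> 0} \<subseteq> lists G" "{w. g w \<noteq> 0} \<subseteq> lists G"
    using assms by (auto simp: free_algebra_def)
  \<comment> \<open>A word in the support of the product is a concatenation of words from the two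
    supports. This yields both the finiteness and the alphabet.\<close>
  have sub: "{w. ?h w \<noteq> 0} \<subseteq> (\<lambda>(u, v). u @ v) ` ({w. f w \<noteq> 0} \<times> {w. g w \<noteq> 0})"
  proof
    fix w assume "w \<in> {w. ?h w \<noteq> 0}"
    then have "(\<Sum>i\<le>length w. f (take i w) * g (drop i w)) \<noteq> 0" by (simp add: free_algebra_def)
    then obtain i where "f (take i w) * g (drop i w) \<noteq> 0" by (meson sum.neutral)
    then have "(take i w, drop i w) \<in> {w. f w \<noteq> 0} \<times> {w. g w \<noteq> 0}" by auto
    moreover have "w = (\<lambda>(u, v). u @ v) (take i w, drop i w)" by simp
    ultimately show "w \<in> (\<lambda>(u, v). u @ v) ` ({w. f w \<noteq> 0} \<times> {w. g w \<noteq> 0})"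
      by (rule rev_image_eqI)
  qed
  have "finite {w. ?h w \<noteq> 0}"
    using fin by (intro finite_subset[OF sub] finite_imageI finite_cartesian_product)
  moreover have "{w. ?h w \<noteq> 0} \<subseteq> lists G"
  proof
    fix w assume "w \<in> {w. ?h w \<noteq> 0}"
    with sub obtain u v where "w = u @ v" "f u \<noteq> 0" "g v \<noteq> 0" by auto
    then show "w \<in> lists G" using G by (auto simp: append_in_lists_conv)
  qed
  ultimately show ?thesis by (simp add: free_algebra_def)
qed

text \<open>Both sides sum over the ways to cut \<open>w\<close> into three pieces. One side records
  the ends of the second and the first piece, the other the end of the first and the length of the
  second.\<close>

lemma free_algebra_mult_assoc:
  "(f \<otimes>\<^bsub>free_algebra G\<^esub> g) \<otimes>\<^bsub>free_algebra G\<^esub> h = f \<otimes>\<^bsub>free_algebra G\<^esub> (g \<otimes>\<^bsub>free_algebra G\<^esub> h)"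
proof
  fix w :: "'a list"
  let ?n = "length w"
  have "((f \<otimes>\<^bsub>free_algebra G\<^esub> g) \<otimes>\<^bsub>free_algebra G\<^esub> h) w
      = (\<Sum>i\<le>?n. \<Sum>k\<le>i. f (take k w) * g (drop k (take i w)) * h (drop i w))"
    by (auto simp: free_algebra_def sum_distrib_right min_absorb1 min_absorb2 intro!: sum.cong)
  also have "\<dots> = (\<Sum>(i, k)\<in>(SIGMA i:{..?n}. {..i}). f (take k w) * g (drop k (take i w)) * h (drop i w))"
    by (simp add: sum.Sigma)
  also have "\<dots> = (\<Sum>(k, m)\<in>(SIGMA k:{..?n}. {..?n - k}).
      f (take k w) * (g (take m (drop k w)) * h (drop m (drop k w))))"
    by (rule sum.reindex_bij_witness[of _ "\<lambda>(k, m). (k + m, k)" "\<lambda>(i, k). (k, i - k)"])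
      (auto simp: drop_take mult.assoc)
  also have "\<dots> = (\<Sum>k\<le>?n. \<Sum>m\<le>?n - k. f (take k w) * (g (take m (drop k w)) * h (drop m (drop k w))))"
    by (simp add: sum.Sigma)
  also have "\<dots> = (f \<otimes>\<^bsub>free_algebra G\<^esub> (g \<otimes>\<^bsub>free_algebra G\<^esub> h)) w"
    by (auto simp: free_algebra_def sum_distrib_left intro!: sum.cong)
  finally show "((f \<otimes>\<^bsub>free_algebra G\<^esub> g) \<otimes>\<^bsub>free_algebra G\<^esub> h) w
      = (f \<otimes>\<^bsub>free_algebra G\<^esub> (g \<otimes>\<^bsub>free_algebra G\<^esub> h)) w" .
qed

lemma free_algebra_add_closed:
  assumes "f \<in> carrier (free_algebra G)" "g \<in> carrier (free_algebra G)"
  shows "f \<oplus>\<^bsub>free_algebra G\<^esub> g \<in> carrier (free_algebra G)"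
proof -
  have fin: "finite {w. f w \<noteq> 0}" "finite {w. g w \<noteq> 0}"
    and G: "{w. f w \<noteq> 0} \<subseteq> lists G" "{w. g w \<noteq> 0} \<subseteq> lists G"
    using assms by (auto simp: free_algebra_def)
  have "{w. f w + g w \<noteq> 0} \<subseteq> {w. f w \<noteq> 0} \<union> {w. g w \<noteq> 0}" by auto
  with finite_subset[OF this] fin G show ?thesis by (auto simp: free_algebra_def)
qed

lemma free_algebra_smult_closed:
  assumes "f \<in> carrier (free_algebra G)"
  shows "c \<odot>\<^bsub>free_algebra G\<^esub> f \<in> carrier (free_algebra G)"
proof -
  have "{w. c * f w \<noteq> 0} \<subseteq> {w. f w \<noteq> 0}" by auto
  with assms finite_subset[OF this] show ?thesis by (auto simp: free_algebra_def)
qed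

lemma ring_free_algebra: "ring (free_algebra G)"
proof (rule ringI)
  show "abelian_group (free_algebra G)"
  proof (rule abelian_groupI)
    fix f assume f: "f \<in> carrier (free_algebra G)"
    have "(\<lambda>w. - f w) \<oplus>\<^bsub>free_algebra G\<^esub> f = \<zero>\<^bsub>free_algebra G\<^esub>"
      by (simp add: free_algebra_def)
    moreover have "(\<lambda>w. - f w) \<in> carrier (free_algebra G)"
      using f by (simp add: free_algebra_def)
    ultimately show "\<exists>g\<in>carrier (free_algebra G). g \<oplus>\<^bsub>free_algebra G\<^esub> f = \<zero>\<^bsub>free_algebra G\<^esub>" by blast
  qed (erule (1) free_algebra_add_closed, auto simp: free_algebra_def)
  show "monoid (free_algebra G)"
  proof (rule monoidI)
    fix f :: "'a list \<Rightarrow> complex"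
    show "\<one>\<^bsub>free_algebra G\<^esub> \<otimes>\<^bsub>free_algebra G\<^esub> f = f"
    proof
      fix w :: "'a list"
      have "(\<one>\<^bsub>free_algebra G\<^esub> \<otimes>\<^bsub>free_algebra G\<^esub> f) w = (\<Sum>i\<le>length w. if i = 0 then f w else 0)"
        unfolding free_algebra_def monoid.simps ring.simps by (rule sum.cong) auto
      then show "(\<one>\<^bsub>free_algebra G\<^esub> \<otimes>\<^bsub>free_algebra G\<^esub> f) w = f w" by simp
    qed
    show "f \<otimes>\<^bsub>free_algebra G\<^esub> \<one>\<^bsub>free_algebra G\<^esub> = f"
    proof
      fix w :: "'a list"
      have "(f \<otimes>\<^bsub>free_algebra G\<^esub> \<one>\<^bsub>free_algebra G\<^esub>) w = (\<Sum>i\<le>length w. if i = length w then f w else 0)"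
        unfolding free_algebra_def monoid.simps ring.simps by (rule sum.cong) auto
      then show "(f \<otimes>\<^bsub>free_algebra G\<^esub> \<one>\<^bsub>free_algebra G\<^esub>) w = f w" by simp
    qed
  qed (auto intro: free_algebra_mult_closed free_algebra_mult_assoc, auto simp: free_algebra_def)
  fix f g h :: "'a list \<Rightarrow> complex"
  show "(f \<oplus>\<^bsub>free_algebra G\<^esub> g) \<otimes>\<^bsub>free_algebra G\<^esub> h
      = f \<otimes>\<^bsub>free_algebra G\<^esub> h \<oplus>\<^bsub>free_algebra G\<^esub> g \<otimes>\<^bsub>free_algebra G\<^esub> h"
    by (simp add: free_algebra_def sum.distrib algebra_simps)
  show "h \<otimes>\<^bsub>free_algebra G\<^esub> (f \<oplus>\<^bsub>free_algebra G\<^esub> g)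
      = h \<otimes>\<^bsub>free_algebra G\<^esub> f \<oplus>\<^bsub>free_algebra G\<^esub> h \<otimes>\<^bsub>free_algebra G\<^esub> g"
    by (simp add: free_algebra_def sum.distrib algebra_simps)
qed

lemma word_in_free_algebra: "w \<in> lists G \<Longrightarrow> word w \<in> carrier (free_algebra G)"
  by (auto simp: free_algebra_def word_def)

lemma word_mult: "word u \<otimes>\<^bsub>free_algebra G\<^esub> word v = word (u @ v)"
proof
  fix w :: "'a list"
  have "(word u \<otimes>\<^bsub>free_algebra G\<^esub> word v) w
      = (\<Sum>i\<le>length w. if i = length u then (if w = u @ v then 1 else 0) else 0)"
    unfolding free_algebra_def monoid.simps ring.simps
  proof (rule sum.cong)
    fix i assume "i \<in> {..length w}"
    then show "word u (take i w) * word v (drop i w) = (if i = length u then (if w = u @ v then 1 else 0) else 0)"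
    proof (cases "i = length u")
      case True
      have "w = u @ v \<longleftrightarrow> take i w = u \<and> drop i w = v"
        using True by (metis append_eq_conv_conj append_take_drop_id)
      then show ?thesis using True by (simp add: word_def)
    next
      case False
      then have "take i w \<noteq> u" using \<open>i \<in> {..length w}\<close> by auto
      then show ?thesis using False by (simp add: word_def)
    qed
  qed simp
  also have "\<dots> = word (u @ v) w" by (simp add: word_def)
  finally show "(word u \<otimes>\<^bsub>free_algebra G\<^esub> word v) w = word (u @ v) w" .
qed

section \<open>The quotient by the Leavitt relations\<close>

abbreviation leavitt_gens :: "nat \<Rightarrow> leavitt_gen set" where
  "leavitt_gens d \<equiv> S_gen ` {1..d} \<union> T_gen ` {1..d}"

text \<open>The quotient map; \<open>leavitt_s\<close> and \<open>leavitt_t\<close> are its values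
  at words of one letter.\<close>

definition leavitt_coset :: "nat \<Rightarrow> (leavitt_gen list \<Rightarrow> complex) \<Rightarrow> (leavitt_gen list \<Rightarrow> complex) set" where
  "leavitt_coset d f = leavitt_ideal d +>\<^bsub>leavitt_free d\<^esub> f"

context
  fixes d :: nat
begin

lemma ring_leavitt_free: "ring (leavitt_free d)"
  by (simp add: leavitt_free_def ring_free_algebra)

lemma word_in_leavitt_free: "w \<in> lists (leavitt_gens d) \<Longrightarrow> word w \<in> carrier (leavitt_free d)"
  unfolding leavitt_free_def by (rule word_in_free_algebra)

lemma leavitt_free_simps:
  "f \<oplus>\<^bsub>leavitt_free d\<^esub> g = (\<lambda>w. f w + g w)" "\<zero>\<^bsub>leavitt_free d\<^esub> = (\<lambda>w. 0)" "c \<odot>\<^bsub>leavitt_free d\<^esub> f = (\<lambda>w. c * f w)" "\<one>\<^bsub>leavitt_free d\<^esub> = word []"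
  by (simp_all add: leavitt_free_def free_algebra_def word_def)

lemma leavitt_free_sum_closed:
  assumes "finite J" "\<And>j. j \<in> J \<Longrightarrow> f j \<in> carrier (leavitt_free d)"
  shows "(\<lambda>w. \<Sum>j\<in>J. f j w) \<in> carrier (leavitt_free d)"
  using assms
proof (induction J)
  case empty
  interpret ring "leavitt_free d" by (rule ring_leavitt_free)
  show ?case using zero_closed by (simp add: leavitt_free_simps)
next
  case (insert j J)
  interpret ring "leavitt_free d" by (rule ring_leavitt_free)
  from insert have "f j \<oplus>\<^bsub>leavitt_free d\<^esub> (\<lambda>w. \<Sum>j\<in>J. f j w) \<in> carrier (leavitt_free d)" by (intro a_closed) auto
  with insert show ?case by (simp add: leavitt_free_simps)
qed

lemma leavitt_free_diff_closed:
  assumes "f \<in> carrier (leavitt_free d)" "g \<in> carrier (leavitt_free d)"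
  shows "(\<lambda>w. f w - g w) \<in> carrier (leavitt_free d)"
  using free_algebra_add_closed[of f "leavitt_gens d" "\<lambda>w. - g w"] assms
  by (simp add: leavitt_free_def) (simp add: free_algebra_def)

lemma relators_subset: "leavitt_relators d \<subseteq> carrier (leavitt_free d)"
  unfolding leavitt_relators_def
  by (auto intro!: leavitt_free_diff_closed leavitt_free_sum_closed word_in_leavitt_free)

lemma ideal_leavitt: "ideal (leavitt_ideal d) (leavitt_free d)"
  unfolding leavitt_ideal_def by (rule ring.genideal_ideal[OF ring_leavitt_free relators_subset])

lemma relators_in_ideal: "leavitt_relators d \<subseteq> leavitt_ideal d"
  unfolding leavitt_ideal_def by (rule ring.genideal_self[OF ring_leavitt_free relators_subset])

lemma leavitt_coset_eqI:
  assumes "f \<in> carrier (leavitt_free d)" "g \<in> carrier (leavitt_free d)" "(\<lambda>w. f w - g w) \<in> leavitt_ideal d"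
  shows "leavitt_coset d f = leavitt_coset d g"
proof -
  interpret ideal "leavitt_ideal d" "leavitt_free d" by (rule ideal_leavitt)
  have "(\<lambda>w. f w - g w) \<oplus>\<^bsub>leavitt_free d\<^esub> g \<in> leavitt_ideal d +>\<^bsub>leavitt_free d\<^esub> g"
    using assms(3) unfolding a_r_coset_def' by blast
  then have "f \<in> leavitt_ideal d +>\<^bsub>leavitt_free d\<^esub> g" by (simp add: leavitt_free_simps)
  then show ?thesis unfolding leavitt_coset_def
    using a_repr_independence[OF _ assms(2)] by (metis a_subgroup)
qed

lemma carrier_leavitt: "carrier (leavitt d) = leavitt_coset d ` carrier (leavitt_free d)"
  by (auto simp: leavitt_def ring.defs module.defs FactRing_def A_RCOSETS_def' leavitt_coset_def)

lemma leavitt_mult: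
  assumes "f \<in> carrier (leavitt_free d)" "g \<in> carrier (leavitt_free d)"
  shows "leavitt_coset d f \<otimes>\<^bsub>leavitt d\<^esub> leavitt_coset d g = leavitt_coset d (f \<otimes>\<^bsub>leavitt_free d\<^esub> g)"
  using ideal.rcoset_mult_add[OF ideal_leavitt assms]
  by (simp add: leavitt_def ring.defs module.defs FactRing_def leavitt_coset_def)

lemma leavitt_add:
  assumes "f \<in> carrier (leavitt_free d)" "g \<in> carrier (leavitt_free d)"
  shows "leavitt_coset d f \<oplus>\<^bsub>leavitt d\<^esub> leavitt_coset d g = leavitt_coset d (\<lambda>w. f w + g w)"
proof -
  interpret ideal "leavitt_ideal d" "leavitt_free d" by (rule ideal_leavitt)
  show ?thesis using a_rcos_sum[OF assms]
    by (simp add: leavitt_def ring.defs module.defs FactRing_def leavitt_coset_def leavitt_free_simps)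
qed

lemma leavitt_one: "\<one>\<^bsub>leavitt d\<^esub> = leavitt_coset d (word [])"
  by (simp add: leavitt_def ring.defs module.defs FactRing_def leavitt_coset_def leavitt_free_simps)

text \<open>An ideal of a ring is not a subspace by definition. It is closed under scalars because
  scaling by \<open>c\<close> is multiplication by \<open>c\<close> times the unit, and therefore
  all cosets in the defining union coincide.\<close>

lemma leavitt_smult:
  assumes "f \<in> carrier (leavitt_free d)"
  shows "c \<odot>\<^bsub>leavitt d\<^esub> leavitt_coset d f = leavitt_coset d (\<lambda>w. c * f w)"
proof -
  interpret ideal "leavitt_ideal d" "leavitt_free d" by (rule ideal_leavitt)
  have cR: "g \<in> carrier (leavitt_free d) \<Longrightarrow> (\<lambda>w. c * g w) \<in> carrier (leavitt_free d)" for g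
    using free_algebra_smult_closed[of g _ c] by (simp add: leavitt_free_def) (simp add: free_algebra_def)
  have eq: "leavitt_coset d (\<lambda>w. c * g w) = leavitt_coset d (\<lambda>w. c * f w)"
    if gf: "g \<in> leavitt_coset d f" for g
  proof -
    obtain i where i: "i \<in> leavitt_ideal d" "g = (\<lambda>w. i w + f w)"
      using gf unfolding leavitt_coset_def a_r_coset_def' by (auto simp: leavitt_free_simps)
    have iR: "i \<in> carrier (leavitt_free d)" using i(1) by (rule a_Hcarr)
    have gR: "g \<in> carrier (leavitt_free d)" using a_closed[OF iR assms] i by (simp add: leavitt_free_simps)
    have oR: "(\<lambda>w. c * word [] w) \<in> carrier (leavitt_free d)"
      by (rule cR[OF word_in_leavitt_free]) simp
    have "(\<lambda>w. c * word [] w) \<otimes>\<^bsub>leavitt_free d\<^esub> i = (\<lambda>w. c * (\<one>\<^bsub>leavitt_free d\<^esub> \<otimes>\<^bsub>leavitt_free d\<^esub> i) w)"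
      by (simp add: leavitt_free_simps) (simp add: leavitt_free_def free_algebra_def sum_distrib_left mult.assoc)
    also have "\<one>\<^bsub>leavitt_free d\<^esub> \<otimes>\<^bsub>leavitt_free d\<^esub> i = i" using iR by (rule l_one)
    finally have "(\<lambda>w. c * i w) \<in> leavitt_ideal d" using I_l_closed[OF i(1) oR] by simp
    moreover have "(\<lambda>w. c * g w - c * f w) = (\<lambda>w. c * i w)" by (simp add: i algebra_simps)
    ultimately show ?thesis using cR gR assms by (intro leavitt_coset_eqI) auto
  qed
  have "f \<in> leavitt_coset d f"
    unfolding leavitt_coset_def using a_rcos_self[OF assms] by simp
  moreover have "c \<odot>\<^bsub>leavitt d\<^esub> leavitt_coset d f = (\<Union>g\<in>leavitt_coset d f. leavitt_coset d (\<lambda>w. c * g w))"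
    by (simp add: leavitt_def ring.defs module.defs FactRing_def leavitt_coset_def leavitt_free_simps)
  moreover have "(\<Union>g\<in>leavitt_coset d f. leavitt_coset d (\<lambda>w. c * g w))
      = (\<Union>g\<in>leavitt_coset d f. leavitt_coset d (\<lambda>w. c * f w))"
    by (intro SUP_cong refl eq)
  ultimately show ?thesis by (metis UN_constant empty_iff)
qed

text \<open>Elements are finite combinations of words: the induction removes one word from the
  support of a representative.\<close>

lemma leavitt_induct [consumes 1, case_names zero add]:
  assumes "X \<in> carrier (leavitt d)"
    and zero: "Q (leavitt_coset d (\<lambda>w. 0))"
    and add: "\<And>c w X. \<lbrakk>w \<in> lists (leavitt_gens d); X \<in> carrier (leavitt d); Q X\<rbrakk> \<Longrightarrow>
      Q ((c \<odot>\<^bsub>leavitt d\<^esub> leavitt_coset d (word w)) \<oplus>\<^bsub>leavitt d\<^esub> X)"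
  shows "Q X"
proof -
  interpret ring "leavitt_free d" by (rule ring_leavitt_free)
  have *: "Q (leavitt_coset d f)" if "finite A" "f \<in> carrier (leavitt_free d)" "{w. f w \<noteq> 0} = A" for A f
    using that
  proof (induction A arbitrary: f)
    case empty
    then have "f = (\<lambda>w. 0)" by auto
    then show ?case using zero by simp
  next
    case (insert v A)
    define g where "g w = (if w = v then 0 else f w)" for w
    have v: "v \<in> lists (leavitt_gens d)"
      using insert.prems by (auto simp: leavitt_free_def free_algebra_def)
    have "{w. g w \<noteq> 0} = A" using insert by (auto simp: g_def)
    moreover have g: "g \<in> carrier (leavitt_free d)"
      using insert \<open>{w. g w \<noteq> 0} = A\<close> by (auto simp: leavitt_free_def free_algebra_def)
    ultimately have "Q (leavitt_coset d g)" by (rule insert.IH[rotated])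
    with g v add have "Q ((f v \<odot>\<^bsub>leavitt d\<^esub> leavitt_coset d (word v)) \<oplus>\<^bsub>leavitt d\<^esub> leavitt_coset d g)"
      by (auto simp: carrier_leavitt)
    also have "(f v \<odot>\<^bsub>leavitt d\<^esub> leavitt_coset d (word v)) \<oplus>\<^bsub>leavitt d\<^esub> leavitt_coset d g
        = leavitt_coset d f"
    proof -
      have cv: "(\<lambda>w. f v * word v w) \<in> carrier (leavitt_free d)"
        using free_algebra_smult_closed[OF word_in_free_algebra[OF v], of "f v"]
        by (simp add: leavitt_free_def) (simp add: free_algebra_def)
      have "(\<lambda>w. f v * word v w + g w) = f" by (auto simp: g_def word_def)
      then show ?thesis using leavitt_add[OF cv g] leavitt_smult[OF word_in_leavitt_free[OF v]] by simp
    qed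
    finally show ?case .
  qed
  obtain f where "f \<in> carrier (leavitt_free d)" "X = leavitt_coset d f" using assms(1) by (auto simp: carrier_leavitt)
  moreover have "finite {w. f w \<noteq> 0}"
    using \<open>f \<in> carrier (leavitt_free d)\<close> by (auto simp: leavitt_free_def free_algebra_def)
  ultimately show ?thesis using * by simp
qed

lemma leavitt_word_append:
  assumes "u \<in> lists (leavitt_gens d)" "v \<in> lists (leavitt_gens d)"
  shows "leavitt_coset d (word u) \<otimes>\<^bsub>leavitt d\<^esub> leavitt_coset d (word v) = leavitt_coset d (word (u @ v))"
proof -
  have "word u \<otimes>\<^bsub>leavitt_free d\<^esub> word v = word (u @ v)" unfolding leavitt_free_def by (rule word_mult)
  then show ?thesis using leavitt_mult[OF word_in_leavitt_free[OF assms(1)] word_in_leavitt_free[OF assms(2)]]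
    by simp
qed

lemma leavitt_ts:
  assumes "j \<in> {1..d}" "k \<in> {1..d}"
  shows "leavitt_coset d (word [T_gen j, S_gen k]) = leavitt_coset d (if j = k then word [] else (\<lambda>w. 0))"
proof (rule leavitt_coset_eqI)
  interpret ring "leavitt_free d" by (rule ring_leavitt_free)
  show "word [T_gen j, S_gen k] \<in> carrier (leavitt_free d)" using assms by (intro word_in_leavitt_free) auto
  show "(if j = k then word [] else (\<lambda>w. 0)) \<in> carrier (leavitt_free d)"
    using word_in_leavitt_free[of "[]"] zero_closed by (auto simp: leavitt_free_simps)
  show "(\<lambda>w. word [T_gen j, S_gen k] w - (if j = k then word [] else (\<lambda>w. 0)) w) \<in> leavitt_ideal d"
    using assms by (intro subsetD[OF relators_in_ideal]) (auto simp: leavitt_relators_def)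
qed

lemma leavitt_st_sum:
  "leavitt_coset d (\<lambda>w. \<Sum>j=1..d. word [S_gen j, T_gen j] w) = leavitt_coset d (word [])"
proof (rule leavitt_coset_eqI)
  show "(\<lambda>w. \<Sum>j=1..d. word [S_gen j, T_gen j] w) \<in> carrier (leavitt_free d)"
    by (intro leavitt_free_sum_closed word_in_leavitt_free) auto
  show "word [] \<in> carrier (leavitt_free d)" by (intro word_in_leavitt_free) auto
  show "(\<lambda>w. (\<Sum>j=1..d. word [S_gen j, T_gen j] w) - word [] w) \<in> leavitt_ideal d"
    by (intro subsetD[OF relators_in_ideal]) (auto simp: leavitt_relators_def)
qed

end

section \<open>Words in a Cuntz family\<close>

lemma lp_sum_Sigma:
  assumes "p \<ge> 1" "finite I" "\<And>i. i \<in> I \<Longrightarrow> finite (J i)"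
    and "\<And>i j. i \<in> I \<Longrightarrow> j \<in> J i \<Longrightarrow> u i j \<in> Lp p M"
  shows "lp_sum M I (\<lambda>i. lp_sum M (J i) (u i)) = lp_sum M (Sigma I J) (\<lambda>(i, j). u i j)"
proof -
  have "AE x in M. rep (lp_sum M (J i) (u i)) x = (\<Sum>j\<in>J i. rep (u i j) x)" if "i \<in> I" for i
    using assms(4)[OF that] by (intro rep_lp_sum[where p = p])
  then have "AE x in M. \<forall>i\<in>I. rep (lp_sum M (J i) (u i)) x = (\<Sum>j\<in>J i. rep (u i j) x)"
    using assms(2) by (simp add: AE_finite_all)
  then have "AE x in M. (\<Sum>i\<in>I. rep (lp_sum M (J i) (u i)) x)
      = (\<Sum>ij\<in>Sigma I J. rep (case ij of (i, j) \<Rightarrow> u i j) x)"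
    by eventually_elim (simp add: sum.Sigma assms(2,3) case_prod_unfold)
  then show ?thesis unfolding lp_sum_def[of M I] lp_sum_def[of M "Sigma I J"] by (rule ae_class_cong)
qed

lemma lp_sum_reindex:
  assumes "bij_betw h I J"
  shows "lp_sum M I (\<lambda>i. u (h i)) = lp_sum M J u"
  unfolding lp_sum_def by (intro ae_class_cong AE_I2 sum.reindex_bij_betw assms)

lemma lp_sum_reindex_image:
  assumes "inj_on h I"
  shows "lp_sum M (h ` I) u = lp_sum M I (\<lambda>i. u (h i))"
  using lp_sum_reindex[OF inj_on_imp_bij_betw[OF assms], of M u] by simp

lemma lp_sum_neutral:
  assumes "finite I" "J \<subseteq> I" "\<And>i. i \<in> I - J \<Longrightarrow> u i = lp_zero M"
  shows "lp_sum M I u = lp_sum M J u"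
  unfolding lp_sum_def
proof (rule ae_class_cong)
  show "AE x in M. (\<Sum>i\<in>I. rep (u i) x) = (\<Sum>i\<in>J. rep (u i) x)"
    using rep_lp_zero[of M]
  proof eventually_elim
    case (elim x)
    with assms show ?case by (intro sum.mono_neutral_right) auto
  qed
qed

lemma lp_sum_singleton:
  assumes "u k \<in> Lp p M"
  shows "lp_sum M {k} u = u k"
  unfolding lp_sum_def using assms by (simp add: ae_class_rep)

lemma lp_sum_const:
  assumes "U \<in> Lp p M"
  shows "lp_sum M I (\<lambda>_. U) = lp_scale M (of_nat (card I)) U"
  unfolding lp_sum_def lp_scale_def by simp

lemma lp_scale_scale:
  assumes "U \<in> Lp p M"
  shows "lp_scale M b (lp_scale M c U) = lp_scale M (b * c) U"
  unfolding lp_scale_def[of M b] lp_scale_def[of M "b * c"]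
  using rep_lp_scale[OF assms, of c] by (intro ae_class_cong) (auto elim: eventually_mono)

lemma lp_scale_1: "U \<in> Lp p M \<Longrightarrow> lp_scale M 1 U = U"
  unfolding lp_scale_def by (simp add: ae_class_rep)

lemma lp_scale_zero: "lp_scale M c (lp_zero M) = lp_zero M"
  unfolding lp_scale_def lp_zero_def[of M] using rep_lp_zero[of M]
  by (intro ae_class_cong) (auto simp: lp_zero_def elim: eventually_mono)

lemma lp_scale_sum:
  assumes "p \<ge> 1" "finite I" "\<And>i. i \<in> I \<Longrightarrow> u i \<in> Lp p M"
  shows "lp_scale M c (lp_sum M I u) = lp_sum M I (\<lambda>i. lp_scale M c (u i))"
  by (rule lp_linear_sum[OF assms(1) lp_linear_scale[OF lp_linear_ident] assms(2,3)])

text \<open>The relations of the Leavitt algebra as operator identities, together with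
  \<open>lp_pow_t_sum\<close>, the trace that spatiality leaves. The bound on \<open>d\<close>
  provides the letter 2 that ends \<open>tail\<close>.\<close>

locale cuntz_family =
  fixes p :: real and M :: "'a measure" and d :: nat and s t :: "nat \<Rightarrow> 'a lp_op"
  assumes p: "p \<ge> 1" and d: "d \<ge> 2"
    and s_linear: "j \<in> {1..d} \<Longrightarrow> lp_linear p M M (s j)"
    and t_linear: "j \<in> {1..d} \<Longrightarrow> lp_linear p M M (t j)"
    and t_s: "j \<in> {1..d} \<Longrightarrow> k \<in> {1..d} \<Longrightarrow> U \<in> Lp p M \<Longrightarrow>
      t j (s k U) = (if j = k then U else lp_zero M)"
    and s_t_sum: "U \<in> Lp p M \<Longrightarrow> lp_sum M {1..d} (\<lambda>j. s j (t j U)) = U"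
    and lp_pow_t_sum: "U \<in> Lp p M \<Longrightarrow> lp_pow p M U = (\<Sum>j=1..d. lp_pow p M (t j U))"
begin

definition words :: "nat list set" where "words = lists {1..d}"

lemma words_simps [simp]: "[] \<in> words" "j # w \<in> words \<longleftrightarrow> j \<in> {1..d} \<and> w \<in> words"
  "u @ v \<in> words \<longleftrightarrow> u \<in> words \<and> v \<in> words"
  by (auto simp: words_def)

definition W :: "nat \<Rightarrow> nat list set" where "W m = {w \<in> words. length w = m}"

definition sw :: "nat list \<Rightarrow> 'a lp_op" where "sw w = foldr s w"

text \<open>With \<open>fold\<close> the first letter acts first. The order is thus opposite to that
  in \<open>sw\<close>, which makes \<open>tw w\<close> a left inverse of
  \<open>sw w\<close>.\<close>

definition tw :: "nat list \<Rightarrow> 'a lp_op" where "tw w = fold t w"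

lemma sw_simps [simp]: "sw [] U = U" "sw (j # w) U = s j (sw w U)" "sw (u @ v) U = sw u (sw v U)"
  by (simp_all add: sw_def)

lemma tw_simps [simp]: "tw [] U = U" "tw (j # w) U = tw w (t j U)" "tw (u @ v) U = tw v (tw u U)"
  by (simp_all add: tw_def)

lemma sw_linear: "w \<in> words \<Longrightarrow> lp_linear p M M (sw w)"
proof (induction w)
  case Nil
  then show ?case using lp_linear_ident by (simp add: sw_def id_def)
next
  case (Cons j w)
  then have "lp_linear p M M (\<lambda>U. s j (sw w U))" by (intro lp_linear_comp[OF _ s_linear]) auto
  then show ?case by (simp add: sw_def comp_def)
qed

lemma tw_linear: "w \<in> words \<Longrightarrow> lp_linear p M M (tw w)"
proof (induction w)
  case Nil
  then show ?case using lp_linear_ident by (simp add: tw_def id_def)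
next
  case (Cons j w)
  then have "lp_linear p M M (\<lambda>U. tw w (t j U))" by (intro lp_linear_comp[OF t_linear]) auto
  then show ?case by (simp add: tw_def comp_def)
qed

lemma sw_in: "w \<in> words \<Longrightarrow> U \<in> Lp p M \<Longrightarrow> sw w U \<in> Lp p M"
  and tw_in: "w \<in> words \<Longrightarrow> U \<in> Lp p M \<Longrightarrow> tw w U \<in> Lp p M"
  using lp_linearD(1)[OF sw_linear] lp_linearD(1)[OF tw_linear] by auto

lemma finite_W: "finite (W m)"
  unfolding W_def using finite_lists_length_eq[of "{1..d}" m] by (simp add: lists_eq_set words_def)

lemma W_words: "w \<in> W m \<Longrightarrow> w \<in> words" by (simp add: W_def)

lemma tw_sw: "w \<in> words \<Longrightarrow> U \<in> Lp p M \<Longrightarrow> tw w (sw w U) = U"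
  by (induction w) (auto simp: t_s sw_in)

text \<open>Common initial letters cancel in pairs; at the first letter where the words differ,
  \<open>t_s\<close> gives zero.\<close>

lemma tw_sw_incomparable:
  assumes "u \<in> words" "v \<in> words" "U \<in> Lp p M" "\<nexists>w. v = u @ w" "\<nexists>w. u = v @ w"
  shows "tw u (sw v U) = lp_zero M"
  using assms
proof (induction u arbitrary: v)
  case Nil
  then show ?case by auto
next
  case (Cons j u)
  from Cons.prems obtain k v' where v: "v = k # v'" by (cases v) auto
  with Cons.prems have mem: "j \<in> {1..d}" "k \<in> {1..d}" "u \<in> words" "v' \<in> words" by auto
  show ?case
  proof (cases "j = k")
    case True
    with Cons v mem show ?thesis by (simp add: t_s sw_in)
  next
    case False
    with mem v Cons.prems(3) show ?thesis
      by (simp add: t_s sw_in lp_linear_zero[OF tw_linear])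
  qed
qed

lemma sum_W_Suc: "(\<Sum>w\<in>W (Suc m). f w) = (\<Sum>j=1..d. \<Sum>w\<in>W m. f (j # w))"
proof -
  have "(\<Sum>w\<in>W (Suc m). f w) = (\<Sum>(j, w)\<in>{1..d} \<times> W m. f (j # w))"
    by (rule sum.reindex_bij_witness[of _ "\<lambda>(j, w). j # w" "\<lambda>w. (hd w, tl w)"])
      (auto simp: W_def length_Suc_conv)
  then show ?thesis by (simp add: sum.cartesian_product)
qed

lemma lp_pow_tw_sum: "U \<in> Lp p M \<Longrightarrow> lp_pow p M U = (\<Sum>w\<in>W m. lp_pow p M (tw w U))"
proof (induction m arbitrary: U)
  case 0
  have "W 0 = {[]}" by (auto simp: W_def)
  then show ?case by simp
next
  case (Suc m)
  have "lp_pow p M U = (\<Sum>j=1..d. lp_pow p M (t j U))" by (intro lp_pow_t_sum Suc.prems)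
  also have "\<dots> = (\<Sum>j=1..d. \<Sum>w\<in>W m. lp_pow p M (tw w (t j U)))"
    by (intro sum.cong refl Suc.IH lp_linearD(1)[OF t_linear] Suc.prems)
  finally show ?case by (simp add: sum_W_Suc)
qed

lemma sw_tw_sum: "U \<in> Lp p M \<Longrightarrow> lp_sum M (W m) (\<lambda>w. sw w (tw w U)) = U"
proof (induction m arbitrary: U)
  case 0
  have "W 0 = {[]}" by (auto simp: W_def)
  with 0 show ?case using lp_sum_singleton[of "\<lambda>w. sw w (tw w U)" "[]"] by simp
next
  case (Suc m)
  have tU: "t j U \<in> Lp p M" if "j \<in> {1..d}" for j
    using lp_linearD(1)[OF t_linear[OF that] Suc.prems] .
  have "bij_betw (\<lambda>(j, w). j # w) ({1..d} \<times> W m) (W (Suc m))"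
    by (rule bij_betw_byWitness[of _ "\<lambda>w. (hd w, tl w)"]) (auto simp: W_def length_Suc_conv)
  from lp_sum_reindex[OF this, of M "\<lambda>w. sw w (tw w U)", symmetric]
  have "lp_sum M (W (Suc m)) (\<lambda>w. sw w (tw w U))
      = lp_sum M ({1..d} \<times> W m) (\<lambda>(j, w). s j (sw w (tw w (t j U))))"
    by (simp add: case_prod_unfold)
  also have "\<dots> = lp_sum M {1..d} (\<lambda>j. lp_sum M (W m) (\<lambda>w. s j (sw w (tw w (t j U)))))"
    using tU by (intro lp_sum_Sigma[OF p, symmetric] lp_linearD(1)[OF s_linear] sw_in tw_in)
      (auto simp: finite_W W_words)
  also have "\<dots> = lp_sum M {1..d} (\<lambda>j. s j (lp_sum M (W m) (\<lambda>w. sw w (tw w (t j U)))))"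
    using tU by (intro lp_sum_cong refl lp_linear_sum[OF p s_linear, symmetric] finite_W sw_in tw_in)
      (auto simp: W_def)
  also have "\<dots> = lp_sum M {1..d} (\<lambda>j. s j (t j U))"
    by (intro lp_sum_cong refl) (simp add: Suc.IH tU)
  also have "\<dots> = U" by (rule s_t_sum[OF Suc.prems])
  finally show ?case .
qed

text \<open>For such \<open>Z\<close> the ranges of the isometries \<open>sw z\<close>, \<open>z \<in> Z\<close>, have disjoint supports.\<close>

definition antichain :: "nat list set \<Rightarrow> bool" where
  "antichain Z \<longleftrightarrow> finite Z \<and> Z \<subseteq> words \<and> (\<forall>u w. u \<in> Z \<longrightarrow> u @ w \<in> Z \<longrightarrow> w = [])"

lemma antichain_comparable:
  assumes "antichain Z" "u \<in> Z" "v \<in> Z" "u @ x = v @ y"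
  shows "u = v"
proof -
  obtain w where "u = v @ w \<or> u @ w = v"
    using assms(4) by (metis append_eq_append_conv2)
  with assms show ?thesis unfolding antichain_def by (metis append_Nil2)
qed

text \<open>When \<open>m\<close> bounds all lengths in \<open>Z\<close>, these are the words of
  length \<open>m\<close> with a prefix in \<open>Z\<close>. Refining an antichain to one level
  makes \<open>lp_pow_tw_sum\<close> applicable.\<close>

definition extensions :: "nat list set \<Rightarrow> nat \<Rightarrow> nat list set" where
  "extensions Z m = (\<lambda>(z, w). z @ w) ` (SIGMA z:Z. W (m - length z))"

lemma sum_extensions:
  assumes "antichain Z"
  shows "(\<Sum>w\<in>extensions Z m. f w) = (\<Sum>z\<in>Z. \<Sum>w\<in>W (m - length z). f (z @ w))"
proof -
  have "inj_on (\<lambda>(z, w). z @ w) (SIGMA z:Z. W (m - length z))"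
    using antichain_comparable[OF assms] by (auto simp: inj_on_def)
  then have "(\<Sum>w\<in>extensions Z m. f w) = (\<Sum>(z, w)\<in>(SIGMA z:Z. W (m - length z)). f (z @ w))"
    unfolding extensions_def by (subst sum.reindex) (auto simp: case_prod_unfold)
  then show ?thesis using assms by (simp add: sum.Sigma finite_W antichain_def)
qed

lemma extensions_subset:
  assumes "antichain Z" "\<And>z. z \<in> Z \<Longrightarrow> length z \<le> m"
  shows "extensions Z m \<subseteq> W m"
  using assms by (auto simp: extensions_def W_def antichain_def)

lemma antichain_length_bound:
  assumes "antichain Z"
  obtains m where "\<And>z. z \<in> Z \<Longrightarrow> length z \<le> m"
proof -
  have "length z \<le> Max (length ` Z)" if "z \<in> Z" for z
    using assms that by (intro Max_ge) (auto simp: antichain_def)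
  then show thesis by (rule that)
qed

text \<open>Each term is split further down to a common level \<open>m\<close>; the result is part
  of the full decomposition of \<open>U\<close> at that level.\<close>

lemma antichain_tw_le:
  assumes "antichain Z" "U \<in> Lp p M"
  shows "(\<Sum>z\<in>Z. lp_pow p M (tw z U)) \<le> lp_pow p M U"
proof -
  obtain m where m: "\<And>z. z \<in> Z \<Longrightarrow> length z \<le> m" using antichain_length_bound[OF assms(1)] by blast
  have "(\<Sum>z\<in>Z. lp_pow p M (tw z U)) = (\<Sum>z\<in>Z. \<Sum>w\<in>W (m - length z). lp_pow p M (tw w (tw z U)))"
    using assms by (intro sum.cong refl lp_pow_tw_sum tw_in) (auto simp: antichain_def)
  also have "\<dots> = (\<Sum>w\<in>extensions Z m. lp_pow p M (tw w U))"
    by (simp add: sum_extensions[OF assms(1)])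
  also have "\<dots> \<le> (\<Sum>w\<in>W m. lp_pow p M (tw w U))"
    using extensions_subset[OF assms(1) m] by (intro sum_mono2 finite_W lp_pow_nonneg)
  also have "\<dots> = lp_pow p M U" by (rule lp_pow_tw_sum[OF assms(2), symmetric])
  finally show ?thesis .
qed

text \<open>The norm of the sum is measured by the operators \<open>tw w\<close> with
  \<open>w\<close> at a common level \<open>m\<close>. If \<open>w\<close> extends some
  \<open>z\<close> in \<open>Z\<close>, only the summand of this \<open>z\<close> survives;
  otherwise none does.\<close>

lemma antichain_sw_sum:
  assumes "antichain Z" "\<And>z. z \<in> Z \<Longrightarrow> \<zeta> z \<in> Lp p M"
  shows "lp_pow p M (lp_sum M Z (\<lambda>z. sw z (\<zeta> z))) = (\<Sum>z\<in>Z. lp_pow p M (\<zeta> z))"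
proof -
  obtain m where m: "\<And>z. z \<in> Z \<Longrightarrow> length z \<le> m" using antichain_length_bound[OF assms(1)] by blast
  have Z: "finite Z" "Z \<subseteq> words" using assms by (auto simp: antichain_def)
  define U where "U = lp_sum M Z (\<lambda>z. sw z (\<zeta> z))"
  have sZ: "sw z (\<zeta> z) \<in> Lp p M" if "z \<in> Z" for z using that Z assms by (intro sw_in) auto
  have U: "U \<in> Lp p M" unfolding U_def by (intro Lp_sum p Z sZ)
  have tU: "tw w U = lp_sum M Z (\<lambda>z. tw w (sw z (\<zeta> z)))" if "w \<in> words" for w
    unfolding U_def by (rule lp_linear_sum[OF p tw_linear[OF that] Z(1) sZ])
  have in_ext: "w \<in> extensions Z m" if "w \<in> W m" "z \<in> Z" "w = z @ v" for w z v
    using that m unfolding extensions_def by (force simp: W_def)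
  have out: "tw w U = lp_zero M" if w: "w \<in> W m - extensions Z m" for w
  proof -
    have "tw w (sw z (\<zeta> z)) = lp_zero M" if z: "z \<in> Z" for z
    proof (rule tw_sw_incomparable)
      show *: "\<nexists>v. w = z @ v" using in_ext[OF _ z] w by auto
      show "\<nexists>v. z = w @ v"
      proof
        assume "\<exists>v. z = w @ v"
        then obtain v where v: "z = w @ v" ..
        with m[OF z] w have "v = []" by (auto simp: W_def)
        with v * show False by auto
      qed
    qed (use w z Z assms in \<open>auto simp: W_def\<close>)
    then have "tw w U = lp_sum M {} (\<lambda>z. tw w (sw z (\<zeta> z)))"
      unfolding tU[OF W_words[OF DiffD1[OF w]]] by (intro lp_sum_neutral Z(1)) auto
    then show ?thesis by (simp add: lp_sum_empty)
  qed
  have inn: "tw (z @ v) U = tw v (\<zeta> z)" if z: "z \<in> Z" and v: "v \<in> words" for z v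
  proof -
    have zv: "z @ v \<in> words" using z v Z by auto
    have "tw (z @ v) (sw y (\<zeta> y)) = lp_zero M" if y: "y \<in> Z - {z}" for y
    proof (rule tw_sw_incomparable)
      show "\<nexists>w. y = (z @ v) @ w" using antichain_comparable[OF assms(1) _ z, of y "[]"] y by auto
      show "\<nexists>w. z @ v = y @ w" using antichain_comparable[OF assms(1) z, of y] y by auto
    qed (use zv y Z assms in auto)
    then have "tw (z @ v) U = lp_sum M {z} (\<lambda>y. tw (z @ v) (sw y (\<zeta> y)))"
      using z Z(1) by (subst tU[OF zv]) (intro lp_sum_neutral, auto)
    also have "\<dots> = tw (z @ v) (sw z (\<zeta> z))"
      using lp_sum_singleton[of "\<lambda>y. tw (z @ v) (sw y (\<zeta> y))" z p M] tw_in[OF zv sZ[OF z]] by simp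
    also have "\<dots> = tw v (\<zeta> z)" using z Z assms by (simp add: tw_sw subset_iff)
    finally show ?thesis .
  qed
  have "lp_pow p M U = (\<Sum>w\<in>W m. lp_pow p M (tw w U))" by (rule lp_pow_tw_sum[OF U])
  also have "\<dots> = (\<Sum>w\<in>extensions Z m. lp_pow p M (tw w U))"
    using extensions_subset[OF assms(1) m] out
    by (intro sum.mono_neutral_right finite_W) (auto simp: lp_pow_zero)
  also have "\<dots> = (\<Sum>z\<in>Z. \<Sum>w\<in>W (m - length z). lp_pow p M (tw w (\<zeta> z)))"
    unfolding sum_extensions[OF assms(1)]
  proof (intro sum.cong refl)
    fix z w assume "z \<in> Z" "w \<in> W (m - length z)"
    then show "lp_pow p M (tw (z @ w) U) = lp_pow p M (tw w (\<zeta> z))"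
      by (subst inn) (auto simp: W_def)
  qed
  also have "\<dots> = (\<Sum>z\<in>Z. lp_pow p M (\<zeta> z))"
    using assms by (intro sum.cong refl lp_pow_tw_sum[symmetric]) auto
  finally show ?thesis by (simp add: U_def)
qed

lemma antichain_W: "antichain (W m)"
  unfolding antichain_def using finite_W by (auto simp: W_def)

lemma lp_pow_sw:
  assumes "w \<in> words" "U \<in> Lp p M"
  shows "lp_pow p M (sw w U) = lp_pow p M U"
proof -
  have "antichain {w}" using assms by (simp add: antichain_def)
  from antichain_sw_sum[OF this, of "\<lambda>_. U"] assms show ?thesis
    using lp_sum_singleton[of "\<lambda>z. sw z U" w p M] sw_in by simp
qed

lemma lp_pow_tw_le:
  assumes "w \<in> words" "U \<in> Lp p M"
  shows "lp_pow p M (tw w U) \<le> lp_pow p M U"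
proof -
  have "antichain {w}" using assms by (simp add: antichain_def)
  from antichain_tw_le[OF this assms(2)] show ?thesis by simp
qed

end

section \<open>Matrix norms\<close>

lemma space_idx [simp]: "space (idx n) = {1..n}"
  and sets_idx [simp]: "sets (idx n) = Pow {1..n}"
  by (simp_all add: idx_def)

lemma borel_measurable_idx [simp]: "f \<in> borel_measurable (idx n)"
  by (simp add: idx_def)

lemma AE_idx: "(AE k in idx n. P k) \<longleftrightarrow> (\<forall>k\<in>{1..n}. P k)"
  unfolding idx_def by (rule AE_count_space)

lemma sigma_finite_idx: "sigma_finite_measure (idx n)"
  unfolding idx_def by (intro sigma_finite_measure_count_space_finite) simp

lemma integral_idx: "(\<integral>k. f k \<partial>idx n) = (\<Sum>k=1..n. f k :: real)"
  by (simp add: idx_def lebesgue_integral_count_space_finite)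

lemma integrable_idx [simp]: "integrable (idx n) (f :: nat \<Rightarrow> real)"
  by (simp add: idx_def integrable_count_space)

lemma ae_class_idx_in_Lp: "ae_class (idx n) f \<in> Lp p (idx n)"
  by (intro LpI) auto

text \<open>Counting measure has no nonempty null set, so a class has one value at each index and
  can be treated as a vector.\<close>

lemma rep_ae_class_idx: "k \<in> {1..n} \<Longrightarrow> rep (ae_class (idx n) f) k = f k"
  using rep_ae_class(2)[of f "idx n"] unfolding AE_idx by simp

lemma ae_class_idx_cong: "(\<And>k. k \<in> {1..n} \<Longrightarrow> f k = g k) \<Longrightarrow> ae_class (idx n) f = ae_class (idx n) g"
  by (intro ae_class_cong_space) simp

lemma lp_pow_idx: "lp_pow p (idx n) U = (\<Sum>k=1..n. cmod (rep U k) powr p)"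
  by (simp add: lp_pow_def integral_idx)

definition delta :: "nat \<Rightarrow> nat \<Rightarrow> (nat \<Rightarrow> complex) set" where
  "delta n l = ae_class (idx n) (\<lambda>k. if k = l then 1 else 0)"

definition entry :: "nat \<Rightarrow> nat lp_op \<Rightarrow> nat \<Rightarrow> nat \<Rightarrow> complex" where
  "entry n x k l = rep (x (delta n l)) k"

lemma delta_in_Lp: "delta n l \<in> Lp p (idx n)"
  unfolding delta_def by (rule ae_class_idx_in_Lp)

lemma lp_sum_delta:
  assumes "v \<in> Lp p (idx n)"
  shows "lp_sum (idx n) {1..n} (\<lambda>l. lp_scale (idx n) (rep v l) (delta n l)) = v"
proof -
  have "ae_class (idx n) (\<lambda>k. \<Sum>l=1..n. rep (lp_scale (idx n) (rep v l) (delta n l)) k) = ae_class (idx n) (rep v)"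
  proof (rule ae_class_idx_cong)
    fix k assume k: "k \<in> {1..n}"
    then have "(\<Sum>l=1..n. rep (lp_scale (idx n) (rep v l) (delta n l)) k) = (\<Sum>l=1..n. if k = l then rep v l else 0)"
      unfolding lp_scale_def delta_def by (intro sum.cong refl) (simp add: rep_ae_class_idx)
    then show "(\<Sum>l=1..n. rep (lp_scale (idx n) (rep v l) (delta n l)) k) = rep v k"
      using k by simp
  qed
  then show ?thesis using ae_class_rep[OF assms] by (simp add: lp_sum_def)
qed

lemma rep_matrix_apply:
  assumes "p \<ge> 1" "lp_linear p (idx n) (idx n) x" "v \<in> Lp p (idx n)" "k \<in> {1..n}"
  shows "rep (x v) k = (\<Sum>l=1..n. entry n x k l * rep v l)"
proof -
  have "x v = x (lp_sum (idx n) {1..n} (\<lambda>l. lp_scale (idx n) (rep v l) (delta n l)))"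
    using lp_sum_delta[OF assms(3)] by simp
  also have "\<dots> = lp_sum (idx n) {1..n} (\<lambda>l. x (lp_scale (idx n) (rep v l) (delta n l)))"
    by (intro lp_linear_sum[OF assms(1,2)] Lp_scale delta_in_Lp) simp
  also have "\<dots> = lp_sum (idx n) {1..n} (\<lambda>l. lp_scale (idx n) (rep v l) (x (delta n l)))"
    by (intro lp_sum_cong refl lp_linearD(3)[OF assms(2)] delta_in_Lp)
  finally have "rep (x v) k = (\<Sum>l=1..n. rep (lp_scale (idx n) (rep v l) (x (delta n l))) k)"
    using assms(4) by (simp add: lp_sum_def rep_ae_class_idx)
  also have "\<dots> = (\<Sum>l=1..n. entry n x k l * rep v l)"
    using assms(4) by (intro sum.cong refl) (simp add: lp_scale_def rep_ae_class_idx entry_def)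
  finally show ?thesis .
qed

text \<open>The bound for \<open>matrix_op\<close>, again in p-th powers, expressed through tuples
  of classes on \<open>M\<close> instead of classes on the product space.\<close>

definition mat_bound :: "real \<Rightarrow> nat \<Rightarrow> 'a measure \<Rightarrow> (nat \<Rightarrow> nat \<Rightarrow> 'a lp_op) \<Rightarrow> real \<Rightarrow> bool" where
  "mat_bound p m M a c \<longleftrightarrow> 0 \<le> c \<and> (\<forall>u. (\<forall>j\<in>{1..m}. u j \<in> Lp p M) \<longrightarrow>
     (\<Sum>i=1..m. lp_pow p M (lp_sum M {1..m} (\<lambda>j. a i j (u j)))) \<le> c * (\<Sum>j=1..m. lp_pow p M (u j)))"

lemma mat_boundD:
  assumes "mat_bound p m M a c" "\<And>j. j \<in> {1..m} \<Longrightarrow> u j \<in> Lp p M"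
  shows "(\<Sum>i=1..m. lp_pow p M (lp_sum M {1..m} (\<lambda>j. a i j (u j)))) \<le> c * (\<Sum>j=1..m. lp_pow p M (u j))"
  using assms by (auto simp: mat_bound_def)

text \<open>Stated for arbitrary numbers \<open>v j l\<close>, so that the values of functions at a
  point of another measure space can be inserted.\<close>

lemma mat_bound_idx:
  assumes "p \<ge> 1" "mat_bound p m (idx n) x c"
    and "\<And>i j. i \<in> {1..m} \<Longrightarrow> j \<in> {1..m} \<Longrightarrow> lp_linear p (idx n) (idx n) (x i j)"
  shows "(\<Sum>i=1..m. \<Sum>k=1..n. cmod (\<Sum>j=1..m. \<Sum>l=1..n. entry n (x i j) k l * v j l) powr p)
    \<le> c * (\<Sum>j=1..m. \<Sum>l=1..n. cmod (v j l) powr p)"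
proof -
  define u where "u j = ae_class (idx n) (v j)" for j
  have u: "u j \<in> Lp p (idx n)" for j unfolding u_def by (rule ae_class_idx_in_Lp)
  have ru: "rep (u j) l = v j l" if "l \<in> {1..n}" for j l
    using that unfolding u_def by (rule rep_ae_class_idx)
  have "rep (lp_sum (idx n) {1..m} (\<lambda>j. x i j (u j))) k = (\<Sum>j=1..m. \<Sum>l=1..n. entry n (x i j) k l * v j l)"
    if "i \<in> {1..m}" "k \<in> {1..n}" for i k
  proof -
    have "rep (lp_sum (idx n) {1..m} (\<lambda>j. x i j (u j))) k = (\<Sum>j=1..m. rep (x i j (u j)) k)"
      using that by (simp add: lp_sum_def rep_ae_class_idx)
    also have "\<dots> = (\<Sum>j=1..m. \<Sum>l=1..n. entry n (x i j) k l * rep (u j) l)"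
      using that by (intro sum.cong refl rep_matrix_apply[OF assms(1) assms(3)] u)
    also have "\<dots> = (\<Sum>j=1..m. \<Sum>l=1..n. entry n (x i j) k l * v j l)"
      by (intro sum.cong refl) (simp add: ru)
    finally show ?thesis .
  qed
  then show ?thesis using mat_boundD[OF assms(2), of u] u by (simp add: lp_pow_idx ru)
qed

definition section_class :: "'a measure \<Rightarrow> (nat \<times> 'a \<Rightarrow> complex) set \<Rightarrow> nat \<Rightarrow> ('a \<Rightarrow> complex) set" where
  "section_class M U j = ae_class M (\<lambda>y. rep U (j, y))"

context
  fixes M :: "'a measure" and m :: nat
  assumes sf: "sigma_finite_measure M"
begin

lemma pair_sigma_finite_idx: "pair_sigma_finite (idx m) M"
  unfolding pair_sigma_finite_def using sf sigma_finite_idx by blast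

lemma AE_idx_pair: "AE z in idx m \<Otimes>\<^sub>M M. P z \<Longrightarrow> j \<in> {1..m} \<Longrightarrow> AE y in M. P (j, y)"
  using pair_sigma_finite.AE_pair[OF pair_sigma_finite_idx, of P] by (simp add: AE_idx)

lemma borel_measurable_idx_pair:
  "(\<And>j. j \<in> {1..m} \<Longrightarrow> (\<lambda>y. f (j, y)) \<in> borel_measurable M) \<Longrightarrow> f \<in> borel_measurable (idx m \<Otimes>\<^sub>M M)"
  unfolding idx_def by (rule measurable_pair_measure_countable1) auto

lemma integrable_idx_pair:
  fixes f :: "nat \<times> 'a \<Rightarrow> real"
  assumes "\<And>j. j \<in> {1..m} \<Longrightarrow> integrable M (\<lambda>y. f (j, y))"
  shows "integrable (idx m \<Otimes>\<^sub>M M) f"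
  using assms
  by (intro pair_sigma_finite.Fubini_integrable[OF pair_sigma_finite_idx] borel_measurable_idx_pair)
    (auto simp: AE_idx)

lemma integral_idx_pair:
  fixes f :: "nat \<times> 'a \<Rightarrow> real"
  assumes "\<And>j. j \<in> {1..m} \<Longrightarrow> integrable M (\<lambda>y. f (j, y))"
  shows "(\<integral>z. f z \<partial>(idx m \<Otimes>\<^sub>M M)) = (\<Sum>j=1..m. \<integral>y. f (j, y) \<partial>M)"
  using pair_sigma_finite.integral_fst'[OF pair_sigma_finite_idx integrable_idx_pair[OF assms]]
  by (simp add: integral_idx)

lemma section_class_in_Lp:
  assumes "U \<in> Lp p (idx m \<Otimes>\<^sub>M M)" "j \<in> {1..m}"
  shows "section_class M U j \<in> Lp p M" "integrable M (\<lambda>y. cmod (rep U (j, y)) powr p)"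
    "(\<lambda>y. rep U (j, y)) \<in> borel_measurable M"
proof -
  show meas: "(\<lambda>y. rep U (j, y)) \<in> borel_measurable M"
    using measurable_Pair2[OF Lp_measurable[OF assms(1)], of j] assms(2) by simp
  show int: "integrable M (\<lambda>y. cmod (rep U (j, y)) powr p)"
    using pair_sigma_finite.AE_integrable_fst'[OF pair_sigma_finite_idx Lp_integrable[OF assms(1)]] assms(2)
    by (simp add: AE_idx)
  show "section_class M U j \<in> Lp p M" unfolding section_class_def using meas int by (rule LpI)
qed

lemma lp_pow_section_class:
  assumes "U \<in> Lp p (idx m \<Otimes>\<^sub>M M)"
  shows "lp_pow p (idx m \<Otimes>\<^sub>M M) U = (\<Sum>j=1..m. lp_pow p M (section_class M U j))"
proof -
  have "lp_pow p (idx m \<Otimes>\<^sub>M M) U = (\<Sum>j=1..m. \<integral>y. cmod (rep U (j, y)) powr p \<partial>M)"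
    unfolding lp_pow_def by (intro integral_idx_pair section_class_in_Lp assms)
  also have "\<dots> = (\<Sum>j=1..m. lp_pow p M (section_class M U j))"
    unfolding section_class_def
    by (intro sum.cong refl lp_pow_ae_class[symmetric] section_class_in_Lp(3)[OF assms])
  finally show ?thesis .
qed

text \<open>Every tuple arises as the sections of a class on the product, so
  \<open>mat_bound\<close> and the norm of \<open>matrix_op\<close> range over the same
  vectors.\<close>

lemma tuple_class:
  assumes "\<And>j. j \<in> {1..m} \<Longrightarrow> u j \<in> Lp p M"
  shows "ae_class (idx m \<Otimes>\<^sub>M M) (\<lambda>(j, y). rep (u j) y) \<in> Lp p (idx m \<Otimes>\<^sub>M M)"
    and "j \<in> {1..m} \<Longrightarrow> section_class M (ae_class (idx m \<Otimes>\<^sub>M M) (\<lambda>(j, y). rep (u j) y)) j = u j"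
proof -
  let ?f = "\<lambda>(j, y). rep (u j) y"
  have meas: "?f \<in> borel_measurable (idx m \<Otimes>\<^sub>M M)"
    using assms by (intro borel_measurable_idx_pair) (auto intro: Lp_measurable)
  show "ae_class (idx m \<Otimes>\<^sub>M M) ?f \<in> Lp p (idx m \<Otimes>\<^sub>M M)"
    using meas assms by (intro LpI integrable_idx_pair) (auto intro: Lp_integrable)
  assume j: "j \<in> {1..m}"
  have "AE y in M. rep (ae_class (idx m \<Otimes>\<^sub>M M) ?f) (j, y) = rep (u j) y"
    using AE_idx_pair[OF rep_ae_class(2)[OF meas] j] by simp
  then show "section_class M (ae_class (idx m \<Otimes>\<^sub>M M) ?f) j = u j"
    unfolding section_class_def using ae_class_rep[OF assms[OF j]] ae_class_cong by metis
qed

lemma lp_pow_matrix_op: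
  assumes "p \<ge> 1" "U \<in> Lp p (idx m \<Otimes>\<^sub>M M)"
    and lin: "\<And>i j. i \<in> {1..m} \<Longrightarrow> j \<in> {1..m} \<Longrightarrow> lp_linear p M M (a i j)"
  shows "lp_pow p (idx m \<Otimes>\<^sub>M M) (matrix_op p m M a U)
    = (\<Sum>i=1..m. lp_pow p M (lp_sum M {1..m} (\<lambda>j. a i j (section_class M U j))))"
proof -
  define u where "u i = lp_sum M {1..m} (\<lambda>j. a i j (section_class M U j))" for i
  define V where "V = ae_class (idx m \<Otimes>\<^sub>M M) (\<lambda>(i, x). \<Sum>j=1..m. rep (a i j (section_class M U j)) x)"
  have aU: "a i j (section_class M U j) \<in> Lp p M" if "i \<in> {1..m}" "j \<in> {1..m}" for i j
    using lp_linearD(1)[OF lin[OF that] section_class_in_Lp(1)[OF assms(2) that(2)]] .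
  have meas: "(\<lambda>(i, x). \<Sum>j=1..m. rep (a i j (section_class M U j)) x) \<in> borel_measurable (idx m \<Otimes>\<^sub>M M)"
    using Lp_measurable[OF aU] by (intro borel_measurable_idx_pair) (auto intro!: borel_measurable_sum)
  have int: "integrable M (\<lambda>x. cmod (\<Sum>j=1..m. rep (a i j (section_class M U j)) x) powr p)" if "i \<in> {1..m}" for i
    using aU[OF that] assms(1) by (intro integrable_cmod_powr_sum) (auto intro: Lp_measurable Lp_integrable)
  have V: "V \<in> Lp p (idx m \<Otimes>\<^sub>M M)"
    unfolding V_def using int by (intro LpI meas integrable_idx_pair) auto
  have "section_class M V i = u i" if "i \<in> {1..m}" for i
    using AE_idx_pair[OF rep_ae_class(2)[OF meas] that]
    unfolding V_def section_class_def[of M "ae_class _ _"] u_def lp_sum_def by (intro ae_class_cong) auto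
  moreover have "matrix_op p m M a U = V"
    using assms(2) by (simp add: matrix_op_def V_def section_class_def)
  ultimately show ?thesis using lp_pow_section_class[OF V] by (simp add: u_def)
qed

lemma mat_bound_iff_opb:
  assumes "p \<ge> 1"
    and lin: "\<And>i j. i \<in> {1..m} \<Longrightarrow> j \<in> {1..m} \<Longrightarrow> lp_linear p M M (a i j)"
  shows "mat_bound p m M a c \<longleftrightarrow> opb p (idx m \<Otimes>\<^sub>M M) (idx m \<Otimes>\<^sub>M M) (matrix_op p m M a) c"
proof
  assume *: "mat_bound p m M a c"
  then have "lp_pow p (idx m \<Otimes>\<^sub>M M) (matrix_op p m M a U) \<le> c * lp_pow p (idx m \<Otimes>\<^sub>M M) U"
    if U: "U \<in> Lp p (idx m \<Otimes>\<^sub>M M)" and "mat_bound p m M a c" for U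
    using mat_boundD[OF that(2), of "section_class M U"] section_class_in_Lp(1)[OF U]
      lp_pow_matrix_op[OF assms(1) U, of a] lin
    by (simp add: lp_pow_section_class[OF U])
  then show "opb p (idx m \<Otimes>\<^sub>M M) (idx m \<Otimes>\<^sub>M M) (matrix_op p m M a) c"
    using * by (auto simp: opb_def mat_bound_def)
next
  assume *: "opb p (idx m \<Otimes>\<^sub>M M) (idx m \<Otimes>\<^sub>M M) (matrix_op p m M a) c"
  show "mat_bound p m M a c"
    unfolding mat_bound_def
  proof (intro conjI allI impI)
    show "0 \<le> c" using * by (rule opb_nonneg)
    fix u :: "nat \<Rightarrow> ('a \<Rightarrow> complex) set" assume u: "\<forall>j\<in>{1..m}. u j \<in> Lp p M"
    define U where "U = ae_class (idx m \<Otimes>\<^sub>M M) (\<lambda>(j, y). rep (u j) y)"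
    have U: "U \<in> Lp p (idx m \<Otimes>\<^sub>M M)" unfolding U_def using u by (intro tuple_class) auto
    have sec: "section_class M U j = u j" if "j \<in> {1..m}" for j
      unfolding U_def using u that by (intro tuple_class) auto
    have "(\<Sum>i=1..m. lp_pow p M (lp_sum M {1..m} (\<lambda>j. a i j (section_class M U j))))
        \<le> c * (\<Sum>j=1..m. lp_pow p M (section_class M U j))"
      using opbD[OF * U] lp_pow_matrix_op[OF assms(1) U, of a] lin by (simp add: lp_pow_section_class[OF U])
    moreover have "lp_sum M {1..m} (\<lambda>j. a i j (section_class M U j)) = lp_sum M {1..m} (\<lambda>j. a i j (u j))" for i
      by (intro lp_sum_cong refl) (simp add: sec)
    ultimately show "(\<Sum>i=1..m. lp_pow p M (lp_sum M {1..m} (\<lambda>j. a i j (u j))))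
        \<le> c * (\<Sum>j=1..m. lp_pow p M (u j))"
      by (simp add: sec)
  qed
qed

text \<open>A crude bound, whose purpose is to make the supremum defining \<open>op_norm\<close> one
  over a bounded set; only then does its value say anything.\<close>

lemma ex_mat_bound:
  assumes "p \<ge> 1"
    and a: "\<And>i j. i \<in> {1..m} \<Longrightarrow> j \<in> {1..m} \<Longrightarrow> a i j \<in> carrier (Bop p M)"
  shows "\<exists>c. mat_bound p m M a c"
proof -
  have "\<forall>i j. \<exists>c. i \<in> {1..m} \<longrightarrow> j \<in> {1..m} \<longrightarrow> opb p M M (a i j) c"
    using BopD(3)[OF assms(1) a] by blast
  then obtain c where c: "\<And>i j. i \<in> {1..m} \<Longrightarrow> j \<in> {1..m} \<Longrightarrow> opb p M M (a i j) (c i j)" by metis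
  define C where "C = (\<Sum>i=1..m. \<Sum>j=1..m. c i j)"
  have c0: "0 \<le> c i j" if "i \<in> {1..m}" "j \<in> {1..m}" for i j using opb_nonneg[OF c[OF that]] .
  have cC: "c i j \<le> C" if ij: "i \<in> {1..m}" "j \<in> {1..m}" for i j
  proof -
    have "c i j \<le> (\<Sum>j=1..m. c i j)" using ij c0 by (intro member_le_sum) auto
    also have "\<dots> \<le> C" unfolding C_def using ij c0 by (intro member_le_sum[of i] sum_nonneg) auto
    finally show ?thesis .
  qed
  have C0: "0 \<le> C" unfolding C_def by (intro sum_nonneg c0)
  have "mat_bound p m M a (real m * (real m powr (p - 1) * C))"
    unfolding mat_bound_def
  proof (intro conjI allI impI)
    show "0 \<le> real m * (real m powr (p - 1) * C)" using C0 by simp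
    fix u :: "nat \<Rightarrow> ('a \<Rightarrow> complex) set" assume u: "\<forall>j\<in>{1..m}. u j \<in> Lp p M"
    have "lp_pow p M (lp_sum M {1..m} (\<lambda>j. a i j (u j))) \<le> real m powr (p - 1) * C * (\<Sum>j=1..m. lp_pow p M (u j))"
      if i: "i \<in> {1..m}" for i
    proof -
      have "a i j (u j) \<in> Lp p M" if "j \<in> {1..m}" for j
        using lp_linearD(1)[OF BopD(2)[OF assms(1) a[OF i that]]] u that by blast
      then have "lp_pow p M (lp_sum M {1..m} (\<lambda>j. a i j (u j)))
          \<le> real m powr (p - 1) * (\<Sum>j=1..m. lp_pow p M (a i j (u j)))"
        using lp_pow_sum_le[OF assms(1), of "{1..m}" "\<lambda>j. a i j (u j)" M] by simp
      also have "(\<Sum>j=1..m. lp_pow p M (a i j (u j))) \<le> (\<Sum>j=1..m. C * lp_pow p M (u j))"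
      proof (rule sum_mono)
        fix j assume j: "j \<in> {1..m}"
        have "lp_pow p M (a i j (u j)) \<le> c i j * lp_pow p M (u j)"
          using u j by (intro opbD[OF c[OF i j]]) auto
        also have "\<dots> \<le> C * lp_pow p M (u j)"
          by (intro mult_right_mono cC i j lp_pow_nonneg)
        finally show "lp_pow p M (a i j (u j)) \<le> C * lp_pow p M (u j)" .
      qed
      finally show ?thesis by (simp add: sum_distrib_left mult.assoc mult_left_mono)
    qed
    then have "(\<Sum>i=1..m. lp_pow p M (lp_sum M {1..m} (\<lambda>j. a i j (u j))))
        \<le> (\<Sum>i=1..m. real m powr (p - 1) * C * (\<Sum>j=1..m. lp_pow p M (u j)))"
      by (rule sum_mono)
    then show "(\<Sum>i=1..m. lp_pow p M (lp_sum M {1..m} (\<lambda>j. a i j (u j))))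
        \<le> real m * (real m powr (p - 1) * C) * (\<Sum>j=1..m. lp_pow p M (u j))"
      by (simp add: mult.assoc)
  qed
  then show ?thesis ..
qed

lemma op_norm_matrix_op:
  assumes "p \<ge> 1"
    and a: "\<And>i j. i \<in> {1..m} \<Longrightarrow> j \<in> {1..m} \<Longrightarrow> a i j \<in> carrier (Bop p M)"
  shows "0 \<le> op_norm p (idx m \<Otimes>\<^sub>M M) (matrix_op p m M a)"
    and "mat_bound p m M a (op_norm p (idx m \<Otimes>\<^sub>M M) (matrix_op p m M a) powr p)"
proof -
  have lin: "lp_linear p M M (a i j)" if "i \<in> {1..m}" "j \<in> {1..m}" for i j
    using BopD(2)[OF assms(1) a[OF that]] .
  obtain c where "mat_bound p m M a c" using ex_mat_bound[OF assms(1), of a] a by blast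
  then have c: "opb p (idx m \<Otimes>\<^sub>M M) (idx m \<Otimes>\<^sub>M M) (matrix_op p m M a) c"
    using mat_bound_iff_opb[OF assms(1), of a] lin by blast
  \<comment> \<open>The homogeneity demanded by \<open>op_norm_bound\<close>: scalars pass through
    sections, entries and sums in turn.\<close>
  have h: "lp_pow p (idx m \<Otimes>\<^sub>M M) (matrix_op p m M a (lp_scale (idx m \<Otimes>\<^sub>M M) e U))
      = cmod e powr p * lp_pow p (idx m \<Otimes>\<^sub>M M) (matrix_op p m M a U)"
    if U: "U \<in> Lp p (idx m \<Otimes>\<^sub>M M)" for e U
  proof -
    have sec: "section_class M (lp_scale (idx m \<Otimes>\<^sub>M M) e U) j = lp_scale M e (section_class M U j)"
      if j: "j \<in> {1..m}" for j
      unfolding section_class_def[of M "lp_scale _ _ _"] lp_scale_def[of M]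
      using AE_idx_pair[OF rep_lp_scale[OF U, of e] j]
        rep_ae_class(2)[OF section_class_in_Lp(3)[OF U j]]
      by (intro ae_class_cong) (auto simp: section_class_def elim: eventually_elim2)
    have aU: "a i j (section_class M U j) \<in> Lp p M" if "i \<in> {1..m}" "j \<in> {1..m}" for i j
      using lp_linearD(1)[OF lin[OF that] section_class_in_Lp(1)[OF U that(2)]] .
    have "lp_sum M {1..m} (\<lambda>j. a i j (section_class M (lp_scale (idx m \<Otimes>\<^sub>M M) e U) j))
        = lp_scale M e (lp_sum M {1..m} (\<lambda>j. a i j (section_class M U j)))" if i: "i \<in> {1..m}" for i
    proof -
      have "lp_sum M {1..m} (\<lambda>j. a i j (section_class M (lp_scale (idx m \<Otimes>\<^sub>M M) e U) j))
          = lp_sum M {1..m} (\<lambda>j. lp_scale M e (a i j (section_class M U j)))"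
        using section_class_in_Lp(1)[OF U]
        by (intro lp_sum_cong refl) (simp add: sec lp_linearD(3)[OF lin[OF i]])
      then show ?thesis using lp_scale_sum[OF assms(1), of "{1..m}" "\<lambda>j. a i j (section_class M U j)" M e] aU[OF i]
        by simp
    qed
    moreover have "lp_pow p (idx m \<Otimes>\<^sub>M M) (matrix_op p m M a V)
        = (\<Sum>i=1..m. lp_pow p M (lp_sum M {1..m} (\<lambda>j. a i j (section_class M V j))))"
      if "V \<in> Lp p (idx m \<Otimes>\<^sub>M M)" for V
      using lp_pow_matrix_op[OF assms(1) that, of a] lin by blast
    moreover have "lp_pow p M (lp_scale M e (lp_sum M {1..m} (\<lambda>j. a i j (section_class M U j))))
        = cmod e powr p * lp_pow p M (lp_sum M {1..m} (\<lambda>j. a i j (section_class M U j)))"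
      if "i \<in> {1..m}" for i
      using aU that by (intro lp_pow_scale Lp_sum assms(1)) auto
    ultimately show ?thesis by (simp add: U Lp_scale sum_distrib_left)
  qed
  show "0 \<le> op_norm p (idx m \<Otimes>\<^sub>M M) (matrix_op p m M a)"
    by (rule op_norm_bound(1)[OF assms(1) c h])
  show "mat_bound p m M a (op_norm p (idx m \<Otimes>\<^sub>M M) (matrix_op p m M a) powr p)"
    using mat_bound_iff_opb[OF assms(1), of a] lin op_norm_bound(2)[OF assms(1) c h] by blast
qed

end

text \<open>It suffices that every bound of a matrix is inherited by its image: the p-th power of
  the norm of the matrix is itself such a bound.\<close>

lemma p_completely_contractiveI:
  assumes "p \<ge> 1" "sigma_finite_measure M" "sigma_finite_measure N"
    and "A \<subseteq> carrier (Bop p M)" "B \<subseteq> carrier (Bop p N)" "\<phi> \<in> A \<rightarrow> B"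
    and "\<And>a b. a \<in> A \<Longrightarrow> b \<in> A \<Longrightarrow> \<phi> (a \<oplus>\<^bsub>Bop p M\<^esub> b) = \<phi> a \<oplus>\<^bsub>Bop p N\<^esub> \<phi> b"
    and "\<And>c a. a \<in> A \<Longrightarrow> \<phi> (c \<odot>\<^bsub>Bop p M\<^esub> a) = c \<odot>\<^bsub>Bop p N\<^esub> \<phi> a"
    and bound: "\<And>m a c. \<lbrakk>\<And>i j. i \<in> {1..m} \<Longrightarrow> j \<in> {1..m} \<Longrightarrow> a i j \<in> A; mat_bound p m M a c\<rbrakk>
      \<Longrightarrow> mat_bound p m N (\<lambda>i j. \<phi> (a i j)) c"
  shows "p_completely_contractive p M A N B \<phi>"
  unfolding p_completely_contractive_def
proof (intro conjI allI ballI impI)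
  fix m :: nat and a assume "\<forall>i\<in>{1..m}. \<forall>j\<in>{1..m}. a i j \<in> A"
  then have a: "\<And>i j. i \<in> {1..m} \<Longrightarrow> j \<in> {1..m} \<Longrightarrow> a i j \<in> A" by blast
  let ?c = "op_norm p (idx m \<Otimes>\<^sub>M M) (matrix_op p m M a)"
  have aB: "a i j \<in> carrier (Bop p M)" if "i \<in> {1..m}" "j \<in> {1..m}" for i j
    using a[OF that] assms(4) by blast
  have lin: "lp_linear p N N (\<phi> (a i j))" if "i \<in> {1..m}" "j \<in> {1..m}" for i j
    using a[OF that] assms(5,6) by (intro BopD(2)[OF assms(1)]) auto
  have "mat_bound p m N (\<lambda>i j. \<phi> (a i j)) (?c powr p)"
    by (intro bound a op_norm_matrix_op(2)[OF assms(2,1) aB])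
  then have "op_norm p (idx m \<Otimes>\<^sub>M N) (matrix_op p m N (\<lambda>i j. \<phi> (a i j))) \<le> (?c powr p) powr (1 / p)"
    using mat_bound_iff_opb[OF assms(3,1), of m "\<lambda>i j. \<phi> (a i j)"] lin
    by (intro op_norm_leI assms(1)) blast
  also have "\<dots> = ?c"
    using assms(1) op_norm_matrix_op(1)[OF assms(2,1) aB] by (simp add: powr_powr)
  finally show "op_norm p (idx m \<Otimes>\<^sub>M N) (matrix_op p m N (\<lambda>i j. \<phi> (a i j))) \<le> ?c" .
qed (use assms in auto)

section \<open>Compression and expansion\<close>

definition lp_functional :: "real \<Rightarrow> 'a measure \<Rightarrow> (('a \<Rightarrow> complex) set \<Rightarrow> complex) \<Rightarrow> bool" where
  "lp_functional p M \<eta> \<longleftrightarrow>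
     (\<forall>U\<in>Lp p M. \<forall>V\<in>Lp p M. \<eta> (lp_add M U V) = \<eta> U + \<eta> V) \<and>
     (\<forall>c. \<forall>U\<in>Lp p M. \<eta> (lp_scale M c U) = c * \<eta> U) \<and>
     (\<forall>U\<in>Lp p M. cmod (\<eta> U) powr p \<le> lp_pow p M U)"

text \<open>A normalised indicator of a set \<open>B\<close> of finite positive measure serves as
  the vector and a multiple of integration over \<open>B\<close> as the functional. Its
  contractivity is then Jensen's inequality on \<open>B\<close>.\<close>

lemma ex_norming_pair:
  assumes p: "p \<ge> 1" and "sigma_finite_measure M" "Lp p M \<noteq> {lp_zero M}"
  shows "\<exists>\<xi> \<eta>. \<xi> \<in> Lp p M \<and> lp_pow p M \<xi> = 1 \<and> \<eta> \<xi> = 1 \<and> lp_functional p M \<eta>"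
proof -
  interpret sigma_finite_measure M by fact
  obtain U0 where U0: "U0 \<in> Lp p M" "U0 \<noteq> lp_zero M" using assms(3) Lp_zero[of M p] by blast
  obtain A :: "nat \<Rightarrow> 'a set" where A: "range A \<subseteq> sets M" "(\<Union>i. A i) = space M"
    "\<And>i. emeasure M (A i) \<noteq> \<infinity>" using sigma_finite by blast
  have "\<exists>i. emeasure M (A i) \<noteq> 0"
  proof (rule ccontr)
    assume "\<not> (\<exists>i. emeasure M (A i) \<noteq> 0)"
    then have "A i \<in> null_sets M" for i using A by auto
    then have "(\<Union>i. A i) \<in> null_sets M" by auto
    then have "AE x in M. x \<notin> space M" using A(2) AE_not_in by metis
    then have "AE x in M. rep U0 x = rep (lp_zero M) x" using AE_space by eventually_elim auto
    with U0 Lp_eqI[OF U0(1) Lp_zero] show False by blast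
  qed
  then obtain B where B [measurable]: "B \<in> sets M" and B0: "emeasure M B \<noteq> 0" and Bf: "emeasure M B \<noteq> \<infinity>"
    using A by blast
  define b where "b = measure M B"
  have b: "b > 0" unfolding b_def using B0 Bf by (simp add: measure_def enn2real_positive_iff less_top zero_less_iff_neq_zero)
  have intB: "integrable M (\<lambda>x. indicat_real B x)" using Bf by (simp add: less_top)
  have IB: "(\<integral>x. indicat_real B x \<partial>M) = b" by (simp add: b_def)
  define f where "f = (\<lambda>x. indicator B x * complex_of_real (b powr (- 1 / p)))"
  define \<xi> where "\<xi> = ae_class M f"
  \<comment> \<open>The exponent is forced by \<eta> \<xi> = 1, as the integral of \<xi> over
    \<open>B\<close> is b times \<open>b powr (- 1 / p)\<close>.\<close>
  define \<eta> where "\<eta> U = of_real (b powr (1 / p - 1)) * (\<integral>x. indicator B x * rep U x \<partial>M)" for U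
  have f [measurable]: "f \<in> borel_measurable M" unfolding f_def by measurable
  have "cmod (complex_of_real (b powr (- 1 / p))) powr p = 1 / b"
    unfolding norm_of_real using b p by (simp add: powr_powr powr_minus_divide powr_divide)
  then have fp: "cmod (f x) powr p = indicat_real B x * (1 / b)" for x
    unfolding f_def norm_mult by (simp add: indicator_def)
  have \<xi>: "\<xi> \<in> Lp p M" unfolding \<xi>_def using intB by (intro LpI f) (simp add: fp)
  have "lp_pow p M \<xi> = 1" unfolding \<xi>_def using b by (simp add: lp_pow_ae_class fp b_def)
  moreover have "\<eta> \<xi> = 1"
  proof -
    have "(\<integral>x. indicator B x * rep \<xi> x \<partial>M) = (\<integral>x. indicator B x * f x \<partial>M)"
      using rep_ae_class[OF f] Lp_measurable[OF \<xi>] unfolding \<xi>_def by (intro integral_cong_AE) auto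
    also have "\<dots> = (\<integral>x. complex_of_real (indicat_real B x * b powr (- 1 / p)) \<partial>M)"
      by (intro Bochner_Integration.integral_cong) (auto simp: f_def indicator_def)
    also have "\<dots> = complex_of_real (b * b powr (- 1 / p))"
      by (subst integral_complex_of_real) (simp add: b_def)
    finally have "\<eta> \<xi> = complex_of_real (b powr (1 / p - 1) * (b * b powr (- 1 / p)))"
      by (simp add: \<eta>_def)
    also have "b powr (1 / p - 1) * (b * b powr (- 1 / p)) = 1"
      using b by (simp add: powr_diff powr_minus_divide)
    finally show ?thesis by simp
  qed
  moreover have int: "integrable M (\<lambda>x. indicator B x * rep U x)" if U: "U \<in> Lp p M" for U
  proof (rule Bochner_Integration.integrable_bound)
    show "integrable M (\<lambda>x. indicat_real B x + cmod (rep U x) powr p)"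
      using intB Lp_integrable[OF U] by auto
    show "(\<lambda>x. indicator B x * rep U x) \<in> borel_measurable M"
      using Lp_measurable[OF U] by measurable
    \<comment> \<open>On a set of finite measure the constant 1 is integrable, so this estimate
      makes \<open>rep U\<close> integrable over \<open>B\<close>.\<close>
    have "r \<le> 1 + r powr p" if "r \<ge> 0" for r :: real
      using powr_mono[of 1 p r] p that by (cases "r \<ge> 1") (auto simp: add_increasing2)
    then show "AE x in M. norm (indicator B x * rep U x) \<le> norm (indicat_real B x + cmod (rep U x) powr p)"
      by (auto simp: indicator_def)
  qed
  moreover have "lp_functional p M \<eta>"
    unfolding lp_functional_def
  proof (intro conjI ballI allI)
    fix U c assume U: "U \<in> Lp p M"
    note [measurable] = Lp_measurable[OF U] Lp_measurable[OF Lp_scale[OF U]]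
    have "(\<integral>x. indicator B x * rep (lp_scale M c U) x \<partial>M) = (\<integral>x. c * (indicator B x * rep U x) \<partial>M)"
      using rep_lp_scale[OF U, of c]
      by (intro integral_cong_AE) (auto simp: algebra_simps)
    then show "\<eta> (lp_scale M c U) = c * \<eta> U" by (simp add: \<eta>_def)
    show "cmod (\<eta> U) powr p \<le> lp_pow p M U"
    proof -
      define g where "g = (\<lambda>x. indicat_real B x * cmod (rep U x))"
      \<comment> \<open>The mean of |U| over \<open>B\<close>. Integrated over \<open>B\<close>, the
        tangent inequality at \<open>c\<close> has no linear part left.\<close>
      define c where "c = (\<integral>x. g x \<partial>M) / b"
      have ng: "norm (indicator B x * rep U x) = g x" for x
        by (cases "x \<in> B") (auto simp: g_def)
      have intg: "integrable M g"
        using integrable_norm[OF int[OF U]] unfolding ng .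
      have c0: "c \<ge> 0" using b by (auto simp: c_def g_def intro!: divide_nonneg_pos integral_nonneg)
      have bc: "b * c powr p \<le> lp_pow p M U"
      proof (cases "c = 0")
        case True
        then show ?thesis by (simp add: lp_pow_nonneg)
      next
        case False
        with c0 have c: "c > 0" by simp
        have "b * c powr p = (\<integral>x. c powr p * indicat_real B x + p * c powr (p - 1) * (g x - c * indicat_real B x) \<partial>M)"
          using intg intB b by (simp add: c_def flip: b_def)
        also have "\<dots> \<le> (\<integral>x. cmod (rep U x) powr p \<partial>M)"
        proof (rule integral_mono)
          fix x
          show "c powr p * indicat_real B x + p * c powr (p - 1) * (g x - c * indicat_real B x) \<le> cmod (rep U x) powr p"
            using powr_tangent[OF p _ c, of "cmod (rep U x)"] by (simp add: g_def indicator_def)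
        qed (use intg intB Lp_integrable[OF U] in auto)
        finally show ?thesis by (simp add: lp_pow_def)
      qed
      have "cmod (\<integral>x. indicator B x * rep U x \<partial>M) \<le> (\<integral>x. norm (indicator B x * rep U x) \<partial>M)"
        by (rule integral_norm_bound)
      also have "\<dots> = b * c"
        unfolding ng using b by (simp add: c_def)
      finally have "cmod (\<eta> U) \<le> b powr (1 / p - 1) * (b * c)"
        by (simp add: \<eta>_def norm_mult mult_left_mono)
      also have "\<dots> = b powr (1 / p) * c" using b by (simp add: powr_diff)
      finally have "cmod (\<eta> U) powr p \<le> (b powr (1 / p) * c) powr p"
        using p by (intro powr_mono2) auto
      also have "\<dots> = b * c powr p" using b c0 p by (simp add: powr_mult powr_powr)
      also note bc
      finally show ?thesis .
    qed
    fix V assume V: "V \<in> Lp p M"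
    note [measurable] = Lp_measurable[OF V] Lp_measurable[OF Lp_add[OF p U V]]
    have "(\<integral>x. indicator B x * rep (lp_add M U V) x \<partial>M)
        = (\<integral>x. indicator B x * rep U x + indicator B x * rep V x \<partial>M)"
      using rep_lp_add[OF U V] by (intro integral_cong_AE) (auto simp: algebra_simps)
    then show "\<eta> (lp_add M U V) = \<eta> U + \<eta> V"
      using int[OF U] int[OF V] by (simp add: \<eta>_def algebra_simps)
  qed
  ultimately show ?thesis using \<xi> by blast
qed

lemma lp_functionalD:
  assumes "lp_functional p M \<eta>" "U \<in> Lp p M"
  shows "V \<in> Lp p M \<Longrightarrow> \<eta> (lp_add M U V) = \<eta> U + \<eta> V" "\<eta> (lp_scale M c U) = c * \<eta> U"
    "cmod (\<eta> U) powr p \<le> lp_pow p M U"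
  using assms by (auto simp: lp_functional_def)

lemma lp_functional_zero: "lp_functional p M \<eta> \<Longrightarrow> \<eta> (lp_zero M) = 0"
  using lp_functionalD(2)[of p M \<eta> "lp_zero M" 0] by (simp add: Lp_zero lp_scale_0)

lemma lp_linear_restrict:
  assumes "p \<ge> 1" "lp_linear p M N T"
  shows "lp_linear p M N (\<lambda>U\<in>Lp p M. T U)"
  using assms by (simp add: lp_linear_def Pi_iff Lp_scale Lp_add)

lemma opb_restrict: "opb p M N (\<lambda>U\<in>Lp p M. T U) c \<longleftrightarrow> opb p M N T c"
  by (simp add: opb_def)

lemma lp_scale_add_left:
  assumes "U \<in> Lp p M"
  shows "lp_scale M (a + b) U = lp_add M (lp_scale M a U) (lp_scale M b U)"
  unfolding lp_scale_def[of M "a + b"] lp_add_def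
  using rep_lp_scale[OF assms, of a] rep_lp_scale[OF assms, of b]
  by (intro ae_class_cong) (auto simp: algebra_simps elim: eventually_elim2)

lemma rep_idx_add: "k \<in> {1..n} \<Longrightarrow> rep (lp_add (idx n) u v) k = rep u k + rep v k"
  by (simp add: lp_add_def rep_ae_class_idx)

lemma rep_idx_scale: "k \<in> {1..n} \<Longrightarrow> rep (lp_scale (idx n) c v) k = c * rep v k"
  by (simp add: lp_scale_def rep_ae_class_idx)

lemma lp_linear_coordinate:
  assumes "U \<in> Lp p M" "k \<in> {1..n}"
  shows "lp_linear p (idx n) M (\<lambda>v. lp_scale M (rep v k) U)"
  unfolding lp_linear_def using assms
  by (auto intro: Lp_scale simp: rep_idx_add rep_idx_scale lp_scale_add_left lp_scale_scale)

locale cuntz_normed = cuntz_family p M d s t for p M d s t +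
  fixes \<xi> :: "('a \<Rightarrow> complex) set" and \<eta> :: "('a \<Rightarrow> complex) set \<Rightarrow> complex"
  assumes \<xi>: "\<xi> \<in> Lp p M" and lp_pow_\<xi>: "lp_pow p M \<xi> = 1"
    and \<eta>: "lp_functional p M \<eta>" and \<eta>_\<xi>: "\<eta> \<xi> = 1"
begin

lemma antichain_sw_sum_index:
  assumes "inj_on h I" "antichain (h ` I)" "\<And>i. i \<in> I \<Longrightarrow> \<zeta> i \<in> Lp p M"
  shows "lp_pow p M (lp_sum M I (\<lambda>i. sw (h i) (\<zeta> i))) = (\<Sum>i\<in>I. lp_pow p M (\<zeta> i))"
proof -
  let ?g = "the_inv_into I h"
  have g: "?g (h i) = i" if "i \<in> I" for i using the_inv_into_f_f[OF assms(1) that] .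
  have "lp_sum M I (\<lambda>i. sw (h i) (\<zeta> i)) = lp_sum M I (\<lambda>i. sw (h i) (\<zeta> (?g (h i))))"
    by (intro lp_sum_cong refl) (simp add: g)
  also have "\<dots> = lp_sum M (h ` I) (\<lambda>z. sw z (\<zeta> (?g z)))"
    by (rule lp_sum_reindex_image[OF assms(1), symmetric])
  finally have "lp_pow p M (lp_sum M I (\<lambda>i. sw (h i) (\<zeta> i))) = (\<Sum>z\<in>h ` I. lp_pow p M (\<zeta> (?g z)))"
    using assms(3) by (simp add: antichain_sw_sum[OF assms(2)] image_iff g)
      (subst antichain_sw_sum[OF assms(2)], auto simp: g)
  also have "\<dots> = (\<Sum>i\<in>I. lp_pow p M (\<zeta> i))"
    using assms(1) by (simp add: sum.reindex g)
  finally show ?thesis .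
qed

lemma antichain_subset: "antichain Z \<Longrightarrow> Y \<subseteq> Z \<Longrightarrow> antichain Y"
  unfolding antichain_def by (meson finite_subset subset_iff)

definition V :: "nat \<Rightarrow> nat list set" where "V K = (\<Union>l\<in>{K..<2 * K}. W l)"

text \<open>An unbordered word: no word of the form \<open>\<sigma>\<tau>\<close> with \<open>0 < |\<sigma>| \<le> 2K\<close> has \<open>\<tau> = 1\<dots>12\<close> as a prefix.
  Appending it makes words of different levels incomparable.\<close>

definition tail :: "nat \<Rightarrow> nat list" where "tail K = replicate (2 * K) 1 @ [2]"

definition level_dim :: "nat \<Rightarrow> nat" where "level_dim K = card (V K)"

text \<open>Matrices in \<open>Mp\<close> are indexed by numbers, so the words of \<open>V K\<close>
  are numbered by some fixed bijection.\<close>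

definition enum :: "nat \<Rightarrow> nat \<Rightarrow> nat list" where
  "enum K = (SOME h. bij_betw h {1..level_dim K} (V K))"

lemma finite_V: "finite (V K)" by (simp add: V_def finite_W)

lemma V_words: "V K \<subseteq> words" by (auto simp: V_def W_def)

lemma V_iff: "w \<in> V K \<longleftrightarrow> w \<in> words \<and> K \<le> length w \<and> length w < 2 * K"
  by (auto simp: V_def W_def)

lemma enum_bij: "bij_betw (enum K) {1..level_dim K} (V K)"
  unfolding enum_def level_dim_def by (rule someI_ex[OF ex_bij_betw_nat_finite_1[OF finite_V]])

lemma enum_V: "i \<in> {1..level_dim K} \<Longrightarrow> enum K i \<in> V K"
  using enum_bij bij_betwE by blast

lemma enum_words: "i \<in> {1..level_dim K} \<Longrightarrow> enum K i \<in> words"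
  using enum_V V_words by blast

lemma enum_inj: "inj_on (enum K) {1..level_dim K}"
  using enum_bij by (rule bij_betw_imp_inj_on)

lemma tail_words: "tail K \<in> words"
  using d by (auto simp: tail_def words_def)

lemma level_dim_pos: "K > 0 \<Longrightarrow> level_dim K \<ge> 1"
proof -
  assume "K > 0"
  then have "replicate K 1 \<in> V K" using d by (auto simp: V_iff words_def)
  then show ?thesis using finite_V[of K] by (simp add: level_dim_def Suc_le_eq card_gt_0_iff) blast
qed

text \<open>At position |u| + 2K the left side has the final 2 of its tail. If 0 < |w| \<le> 2K, the
  right side has there one of the ones of the tail after \<open>v\<close>.\<close>

lemma tail_clash:
  assumes "u @ tail K @ w = v @ tail K" "length w \<le> 2 * K"
  shows "w = []"
proof (rule ccontr)
  assume "w \<noteq> []"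
  have len: "length v = length u + length w" using arg_cong[OF assms(1), of length] by simp
  have "(u @ tail K @ w) ! (length u + 2 * K) = 2"
    by (simp add: nth_append tail_def)
  moreover have "(v @ tail K) ! (length u + 2 * K) = 1"
  proof -
    have "2 * K - length w < 2 * K" using \<open>w \<noteq> []\<close> assms(2) by (cases w) auto
    then show ?thesis using assms(2) len by (simp add: nth_append tail_def)
  qed
  ultimately show False using assms(1) by simp
qed

text \<open>Length differences up to 2K must be allowed, because \<alpha>\<gamma> may leave the
  window although \<beta>\<gamma> lies in it: its length stays below 3K, that of a word in
  \<open>V K\<close> is at least K. This is what the 2K ones in \<open>tail\<close> are for.\<close>

lemma tw_sw_tail:
  assumes "u \<in> words" "v \<in> words" "length v \<le> length u + 2 * K" "length u \<le> length v + 2 * K" "U \<in> Lp p M"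
  shows "tw (u @ tail K) (sw (v @ tail K) U) = (if u = v then U else lp_zero M)"
proof (cases "u = v")
  case True
  then show ?thesis using assms tail_words tw_sw[of "u @ tail K"] by simp
next
  case False
  have "tw (u @ tail K) (sw (v @ tail K) U) = lp_zero M"
  proof (rule tw_sw_incomparable)
    show "\<nexists>w. v @ tail K = (u @ tail K) @ w"
    proof
      assume "\<exists>w. v @ tail K = (u @ tail K) @ w"
      then obtain w where w: "u @ tail K @ w = v @ tail K" by auto
      have "length w \<le> 2 * K" using arg_cong[OF w, of length] assms by simp
      with tail_clash[OF w] w False show False by simp
    qed
    show "\<nexists>w. u @ tail K = (v @ tail K) @ w"
    proof
      assume "\<exists>w. u @ tail K = (v @ tail K) @ w"
      then obtain w where w: "v @ tail K @ w = u @ tail K" by auto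
      have "length w \<le> 2 * K" using arg_cong[OF w, of length] assms by simp
      with tail_clash[OF w] w False show False by simp
    qed
  qed (use assms tail_words in auto)
  with False show ?thesis by simp
qed

lemma antichain_tails: "antichain ((\<lambda>i. enum K i @ tail K) ` {1..level_dim K})"
  unfolding antichain_def
proof (intro conjI allI impI)
  fix u w assume "u \<in> (\<lambda>i. enum K i @ tail K) ` {1..level_dim K}" "u @ w \<in> (\<lambda>i. enum K i @ tail K) ` {1..level_dim K}"
  then obtain i j where ij: "i \<in> {1..level_dim K}" "j \<in> {1..level_dim K}"
    and eq: "enum K i @ tail K @ w = enum K j @ tail K" by auto
  have "length w \<le> 2 * K"
    using arg_cong[OF eq, of length] enum_V[OF ij(1)] enum_V[OF ij(2)] by (simp add: V_iff)
  with tail_clash[OF eq] show "w = []" by simp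
qed (use enum_words tail_words in auto)

lemma inj_tails: "inj_on (\<lambda>i. enum K i @ tail K) {1..level_dim K}"
  by (rule inj_onI, rule inj_onD[OF enum_inj]) auto

definition emb :: "nat \<Rightarrow> (nat \<Rightarrow> complex) set \<Rightarrow> ('a \<Rightarrow> complex) set" where
  "emb K v = lp_sum M {1..level_dim K} (\<lambda>i. lp_scale M (rep v i) (sw (enum K i @ tail K) \<xi>))"

text \<open>Takes the place of the adjoint of \<open>emb\<close> in the Hilbert space case: \<eta>
  reads off the coefficient along each of the embedded basis vectors.\<close>

definition coord :: "nat \<Rightarrow> ('a \<Rightarrow> complex) set \<Rightarrow> (nat \<Rightarrow> complex) set" where
  "coord K U = ae_class (idx (level_dim K)) (\<lambda>i. \<eta> (tw (enum K i @ tail K) U))"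

lemma tail_sw_in: "i \<in> {1..level_dim K} \<Longrightarrow> U \<in> Lp p M \<Longrightarrow> sw (enum K i @ tail K) U \<in> Lp p M"
  and tail_tw_in: "i \<in> {1..level_dim K} \<Longrightarrow> U \<in> Lp p M \<Longrightarrow> tw (enum K i @ tail K) U \<in> Lp p M"
  using enum_words tail_words by (auto intro!: sw_in tw_in)

lemma emb_linear: "lp_linear p (idx (level_dim K)) M (emb K)"
  unfolding emb_def by (intro lp_linear_lp_sum p lp_linear_coordinate tail_sw_in \<xi>) auto

lemma lp_pow_emb: "lp_pow p M (emb K v) = lp_pow p (idx (level_dim K)) v"
proof -
  have "emb K v = lp_sum M {1..level_dim K} (\<lambda>i. sw (enum K i @ tail K) (lp_scale M (rep v i) \<xi>))"
    unfolding emb_def using enum_words tail_words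
    by (intro lp_sum_cong refl lp_linearD(3)[OF sw_linear, symmetric] \<xi>) auto
  then have "lp_pow p M (emb K v) = (\<Sum>i=1..level_dim K. lp_pow p M (lp_scale M (rep v i) \<xi>))"
    by (simp only: antichain_sw_sum_index[OF inj_tails antichain_tails Lp_scale[OF \<xi>]])
  then show ?thesis by (simp add: lp_pow_scale \<xi> lp_pow_\<xi> lp_pow_idx)
qed

lemma coord_linear: "lp_linear p M (idx (level_dim K)) (coord K)"
proof -
  have tl: "lp_linear p M M (tw (enum K i @ tail K))" if "i \<in> {1..level_dim K}" for i
    using enum_words[OF that] tail_words by (intro tw_linear) auto
  show ?thesis
    unfolding lp_linear_def
  proof (intro conjI funcsetI ballI allI)
    fix U V c assume U: "U \<in> Lp p M"
    show "coord K U \<in> Lp p (idx (level_dim K))" unfolding coord_def by (rule ae_class_idx_in_Lp)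
    show "coord K (lp_scale M c U) = lp_scale (idx (level_dim K)) c (coord K U)"
      unfolding lp_scale_def[of "idx (level_dim K)"] coord_def[of K "lp_scale M c U"]
      using lp_linearD(3)[OF tl U] lp_functionalD(2)[OF \<eta> tail_tw_in[OF _ U]]
      by (intro ae_class_idx_cong) (simp add: coord_def rep_ae_class_idx)
    assume V: "V \<in> Lp p M"
    show "coord K (lp_add M U V) = lp_add (idx (level_dim K)) (coord K U) (coord K V)"
      unfolding lp_add_def[of "idx (level_dim K)"] coord_def[of K "lp_add M U V"]
      using lp_linearD(2)[OF tl U V] lp_functionalD(1)[OF \<eta> tail_tw_in[OF _ U] tail_tw_in[OF _ V]]
      by (intro ae_class_idx_cong) (simp add: coord_def rep_ae_class_idx)
  qed
qed

lemma lp_pow_coord: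
  assumes "U \<in> Lp p M"
  shows "lp_pow p (idx (level_dim K)) (coord K U) \<le> lp_pow p M U"
proof -
  have "lp_pow p (idx (level_dim K)) (coord K U) = (\<Sum>i=1..level_dim K. cmod (\<eta> (tw (enum K i @ tail K) U)) powr p)"
    unfolding lp_pow_idx coord_def by (intro sum.cong refl) (simp add: rep_ae_class_idx)
  also have "\<dots> \<le> (\<Sum>i=1..level_dim K. lp_pow p M (tw (enum K i @ tail K) U))"
    by (intro sum_mono lp_functionalD(3)[OF \<eta>] tail_tw_in assms)
  also have "\<dots> = (\<Sum>z\<in>(\<lambda>i. enum K i @ tail K) ` {1..level_dim K}. lp_pow p M (tw z U))"
    by (simp only: sum.reindex[OF inj_tails] comp_def)
  also have "\<dots> \<le> lp_pow p M U" by (rule antichain_tw_le[OF antichain_tails assms])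
  finally show ?thesis .
qed

definition compress :: "nat \<Rightarrow> 'a lp_op \<Rightarrow> nat lp_op" where
  "compress K a = (\<lambda>v\<in>Lp p (idx (level_dim K)). coord K (a (emb K v)))"

lemma compress_in_Mp:
  assumes "a \<in> carrier (Bop p M)"
  shows "compress K a \<in> Mp p (level_dim K)"
proof -
  obtain c where c: "opb p M M a c" using BopD(3)[OF p assms] by blast
  note a = BopD(2)[OF p assms]
  have "lp_linear p (idx (level_dim K)) (idx (level_dim K)) (\<lambda>v. coord K (a (emb K v)))"
    by (rule lp_linear_comp[OF lp_linear_comp[OF emb_linear a] coord_linear])
  then have lin: "lp_linear p (idx (level_dim K)) (idx (level_dim K)) (compress K a)"
    unfolding compress_def by (rule lp_linear_restrict[OF p])
  have "lp_pow p (idx (level_dim K)) (coord K (a (emb K v))) \<le> c * lp_pow p (idx (level_dim K)) v"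
    if v: "v \<in> Lp p (idx (level_dim K))" for v
  proof -
    note Jv = lp_linearD(1)[OF emb_linear v]
    have "lp_pow p (idx (level_dim K)) (coord K (a (emb K v))) \<le> lp_pow p M (a (emb K v))"
      by (intro lp_pow_coord lp_linearD(1)[OF a Jv])
    also have "\<dots> \<le> c * lp_pow p M (emb K v)" by (rule opbD[OF c Jv])
    finally show ?thesis by (simp add: lp_pow_emb)
  qed
  then have "opb p (idx (level_dim K)) (idx (level_dim K)) (compress K a) c"
    unfolding compress_def opb_restrict using opb_nonneg[OF c] by (simp add: opb_def)
  with lin show ?thesis unfolding Mp_def by (intro BopI[OF p]) (auto simp: compress_def)
qed

text \<open>An isometry on the right and a contraction on the left, applied to each component of a
  tuple, cannot increase a bound, whatever the matrix size.\<close>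

lemma mat_bound_compress:
  assumes "\<And>i j. i \<in> {1..m} \<Longrightarrow> j \<in> {1..m} \<Longrightarrow> a i j \<in> carrier (Bop p M)" "mat_bound p m M a c"
  shows "mat_bound p m (idx (level_dim K)) (\<lambda>i j. compress K (a i j)) c"
  unfolding mat_bound_def
proof (intro conjI allI impI)
  show "0 \<le> c" using assms(2) by (simp add: mat_bound_def)
  fix u :: "nat \<Rightarrow> (nat \<Rightarrow> complex) set" assume u: "\<forall>j\<in>{1..m}. u j \<in> Lp p (idx (level_dim K))"
  have Ju: "emb K (u j) \<in> Lp p M" if "j \<in> {1..m}" for j
    using lp_linearD(1)[OF emb_linear] u that by blast
  have aJu: "a i j (emb K (u j)) \<in> Lp p M" if "i \<in> {1..m}" "j \<in> {1..m}" for i j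
    using lp_linearD(1)[OF BopD(2)[OF p assms(1)[OF that]] Ju[OF that(2)]] .
  have "(\<Sum>i=1..m. lp_pow p (idx (level_dim K)) (lp_sum (idx (level_dim K)) {1..m} (\<lambda>j. compress K (a i j) (u j))))
      \<le> (\<Sum>i=1..m. lp_pow p M (lp_sum M {1..m} (\<lambda>j. a i j (emb K (u j)))))"
  proof (rule sum_mono)
    fix i assume i: "i \<in> {1..m}"
    have "lp_sum (idx (level_dim K)) {1..m} (\<lambda>j. compress K (a i j) (u j))
        = lp_sum (idx (level_dim K)) {1..m} (\<lambda>j. coord K (a i j (emb K (u j))))"
      using u by (intro lp_sum_cong refl) (auto simp: compress_def)
    also have "\<dots> = coord K (lp_sum M {1..m} (\<lambda>j. a i j (emb K (u j))))"
      using aJu[OF i] by (intro lp_linear_sum[OF p coord_linear, symmetric]) auto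
    finally show "lp_pow p (idx (level_dim K)) (lp_sum (idx (level_dim K)) {1..m} (\<lambda>j. compress K (a i j) (u j)))
        \<le> lp_pow p M (lp_sum M {1..m} (\<lambda>j. a i j (emb K (u j))))"
      using lp_pow_coord[OF Lp_sum[OF p _ aJu[OF i]], of "{1..m}"] by simp
  qed
  also have "\<dots> \<le> c * (\<Sum>j=1..m. lp_pow p M (emb K (u j)))"
    by (intro mat_boundD[OF assms(2)] Ju)
  finally show "(\<Sum>i=1..m. lp_pow p (idx (level_dim K)) (lp_sum (idx (level_dim K)) {1..m} (\<lambda>j. compress K (a i j) (u j))))
      \<le> c * (\<Sum>j=1..m. lp_pow p (idx (level_dim K)) (u j))"
    by (simp add: lp_pow_emb)
qed

definition expand :: "nat \<Rightarrow> nat lp_op \<Rightarrow> 'a lp_op" where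
  "expand K x = (\<lambda>U\<in>Lp p M. lp_sum M ({1..level_dim K} \<times> {1..level_dim K})
     (\<lambda>(k, l). lp_scale M (entry (level_dim K) x k l / of_nat K) (sw (enum K k) (tw (enum K l) U))))"

lemma enum_in: "i \<in> {1..level_dim K} \<Longrightarrow> U \<in> Lp p M \<Longrightarrow> sw (enum K i) U \<in> Lp p M"
  "i \<in> {1..level_dim K} \<Longrightarrow> U \<in> Lp p M \<Longrightarrow> tw (enum K i) U \<in> Lp p M"
  using enum_words by (auto intro!: sw_in tw_in)

lemma sum_enum_tw:
  assumes "U \<in> Lp p M"
  shows "(\<Sum>l=1..level_dim K. lp_pow p M (tw (enum K l) U)) = real K * lp_pow p M U"
proof -
  have "(\<Sum>l=1..level_dim K. lp_pow p M (tw (enum K l) U)) = (\<Sum>w\<in>V K. lp_pow p M (tw w U))"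
    by (rule sum.reindex_bij_betw[OF enum_bij])
  also have "\<dots> = (\<Sum>l\<in>{K..<2 * K}. \<Sum>w\<in>W l. lp_pow p M (tw w U))"
    unfolding V_def by (rule sum.UNION_disjoint) (auto simp: finite_W, auto simp: W_def)
  also have "\<dots> = (\<Sum>l\<in>{K..<2 * K}. lp_pow p M U)"
    by (intro sum.cong refl lp_pow_tw_sum[symmetric] assms)
  finally show ?thesis by simp
qed

text \<open>Within one level the summands have disjoint supports and the norm is exact. Only the
  addition of the K levels costs a factor, that of the power mean inequality.\<close>

lemma lp_pow_enum_sw_sum:
  assumes "K > 0" "\<And>k. k \<in> {1..level_dim K} \<Longrightarrow> Y k \<in> Lp p M"
  shows "lp_pow p M (lp_sum M {1..level_dim K} (\<lambda>k. sw (enum K k) (Y k)))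
    \<le> real K powr (p - 1) * (\<Sum>k=1..level_dim K. lp_pow p M (Y k))"
proof -
  define I where "I l = {k \<in> {1..level_dim K}. length (enum K k) = l}" for l
  have bij: "bij_betw snd (SIGMA l:{K..<2 * K}. I l) {1..level_dim K}"
    by (rule bij_betw_byWitness[of _ "\<lambda>k. (length (enum K k), k)"])
      (use enum_V[of _ K] in \<open>auto simp: I_def V_iff\<close>)
  have sY: "sw (enum K k) (Y k) \<in> Lp p M" if "k \<in> {1..level_dim K}" for k
    using that by (intro enum_in assms)
  have lev: "lp_pow p M (lp_sum M (I l) (\<lambda>k. sw (enum K k) (Y k))) = (\<Sum>k\<in>I l. lp_pow p M (Y k))" for l
  proof (rule antichain_sw_sum_index)
    show "inj_on (enum K) (I l)" by (rule inj_on_subset[OF enum_inj]) (auto simp: I_def)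
    show "antichain (enum K ` I l)"
      by (rule antichain_subset[OF antichain_W[of l]]) (use enum_words in \<open>auto simp: I_def W_def\<close>)
  qed (use assms in \<open>auto simp: I_def\<close>)
  have "lp_sum M {1..level_dim K} (\<lambda>k. sw (enum K k) (Y k))
      = lp_sum M (SIGMA l:{K..<2 * K}. I l) (\<lambda>(l, k). sw (enum K k) (Y k))"
    using lp_sum_reindex[OF bij, of M "\<lambda>k. sw (enum K k) (Y k)"] by (simp add: case_prod_unfold)
  also have "\<dots> = lp_sum M {K..<2 * K} (\<lambda>l. lp_sum M (I l) (\<lambda>k. sw (enum K k) (Y k)))"
    using sY by (intro lp_sum_Sigma[OF p, symmetric]) (auto simp: I_def)
  finally have "lp_pow p M (lp_sum M {1..level_dim K} (\<lambda>k. sw (enum K k) (Y k)))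
      \<le> real K powr (p - 1) * (\<Sum>l\<in>{K..<2 * K}. lp_pow p M (lp_sum M (I l) (\<lambda>k. sw (enum K k) (Y k))))"
    using lp_pow_sum_le[OF p, of "{K..<2 * K}" "\<lambda>l. lp_sum M (I l) (\<lambda>k. sw (enum K k) (Y k))" M]
      Lp_sum[OF p, of "I _" "\<lambda>k. sw (enum K k) (Y k)" M] sY by (simp add: I_def)
  also have "(\<Sum>l\<in>{K..<2 * K}. lp_pow p M (lp_sum M (I l) (\<lambda>k. sw (enum K k) (Y k))))
      = (\<Sum>(l, k)\<in>(SIGMA l:{K..<2 * K}. I l). lp_pow p M (Y k))"
    unfolding lev by (rule sum.Sigma) (auto simp: I_def)
  also have "\<dots> = (\<Sum>k=1..level_dim K. lp_pow p M (Y k))"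
    using sum.reindex_bij_betw[OF bij, of "\<lambda>k. lp_pow p M (Y k)"] by (simp add: case_prod_unfold)
  finally show ?thesis .
qed

text \<open>The scalar inequality expressing the norm of the matrix \<open>x\<close> is applied pointwise on \<open>M\<close> to
  the functions \<open>t\<^sub>\<nu> u\<^sub>j\<close>. The factors \<open>K\<^bsup>p-1\<^esup>\<close> (power mean over the levels), \<open>K\<^bsup>-p\<^esup>\<close> (normalisation)
  and \<open>K\<close> (each level contributes \<open>u\<^sub>j\<close> once) cancel.\<close>

lemma mat_bound_expand:
  assumes K: "K > 0" and x: "\<And>i j. i \<in> {1..m} \<Longrightarrow> j \<in> {1..m} \<Longrightarrow> x i j \<in> Mp p (level_dim K)"
    and bound: "mat_bound p m (idx (level_dim K)) x c"
  shows "mat_bound p m M (\<lambda>i j. expand K (x i j)) c"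
  unfolding mat_bound_def
proof (intro conjI allI impI)
  show c: "0 \<le> c" using bound by (simp add: mat_bound_def)
  fix u :: "nat \<Rightarrow> ('a \<Rightarrow> complex) set" assume u: "\<forall>j\<in>{1..m}. u j \<in> Lp p M"
  define n where "n = level_dim K"
  define T where "T j l = tw (enum K l) (u j)" for j l
  define r where "r i j k l = entry n (x i j) k l / of_nat K" for i j k l
  \<comment> \<open>Gathers all terms with the same left factor \<open>sw (enum K k)\<close>, so
    that the sum over \<open>k\<close> comes last and \<open>lp_pow_enum_sw_sum\<close> applies to
    it.\<close>
  define Y where "Y i k = lp_sum M ({1..m} \<times> {1..n}) (\<lambda>(j, l). lp_scale M (r i j k l) (T j l))" for i k
  define G where "G i k y = (\<Sum>j=1..m. \<Sum>l=1..n. r i j k l * rep (T j l) y)" for i k y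
  have T: "T j l \<in> Lp p M" if "j \<in> {1..m}" "l \<in> {1..n}" for j l
    using that u unfolding T_def n_def by (intro enum_in) auto
  have Y: "Y i k \<in> Lp p M" for i k
    unfolding Y_def by (intro Lp_sum p) (auto intro!: Lp_scale T)
  have sT: "lp_scale M e (sw (enum K k) (T j l)) \<in> Lp p M"
    if "j \<in> {1..m}" "k \<in> {1..n}" "l \<in> {1..n}" for e j k l
    using that unfolding n_def by (intro Lp_scale enum_in T) (auto simp: n_def)
  have "lp_sum M {1..m} (\<lambda>j. expand K (x i j) (u j)) = lp_sum M {1..n} (\<lambda>k. sw (enum K k) (Y i k))" for i
  proof -
    have "lp_sum M {1..m} (\<lambda>j. expand K (x i j) (u j))
        = lp_sum M {1..m} (\<lambda>j. lp_sum M ({1..n} \<times> {1..n}) (\<lambda>kl. lp_scale M (r i j (fst kl) (snd kl)) (sw (enum K (fst kl)) (T j (snd kl)))))"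
      using u by (intro lp_sum_cong refl) (auto simp: expand_def n_def r_def T_def case_prod_unfold)
    also have "\<dots> = lp_sum M ({1..m} \<times> ({1..n} \<times> {1..n}))
        (\<lambda>(j, kl). lp_scale M (r i j (fst kl) (snd kl)) (sw (enum K (fst kl)) (T j (snd kl))))"
      using sT by (intro lp_sum_Sigma[OF p]) auto
    also have "\<dots> = lp_sum M ({1..n} \<times> ({1..m} \<times> {1..n}))
        (\<lambda>(k, jl). lp_scale M (r i (fst jl) k (snd jl)) (sw (enum K k) (T (fst jl) (snd jl))))"
    proof -
      have "bij_betw (\<lambda>(k, jl). (fst jl, (k, snd jl))) ({1..n} \<times> ({1..m} \<times> {1..n})) ({1..m} \<times> ({1..n} \<times> {1..n}))"
        by (rule bij_betw_byWitness[of _ "\<lambda>(j, kl). (fst kl, (j, snd kl))"]) auto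
      from lp_sum_reindex[OF this, of M "\<lambda>(j, kl). lp_scale M (r i j (fst kl) (snd kl)) (sw (enum K (fst kl)) (T j (snd kl)))"]
      show ?thesis by (simp add: case_prod_unfold)
    qed
    also have "\<dots> = lp_sum M {1..n} (\<lambda>k. lp_sum M ({1..m} \<times> {1..n})
        (\<lambda>jl. lp_scale M (r i (fst jl) k (snd jl)) (sw (enum K k) (T (fst jl) (snd jl)))))"
      using sT by (intro lp_sum_Sigma[OF p, symmetric]) auto
    also have "\<dots> = lp_sum M {1..n} (\<lambda>k. sw (enum K k) (Y i k))"
    proof (intro lp_sum_cong refl)
      fix k assume k: "k \<in> {1..n}"
      then have lin: "lp_linear p M M (sw (enum K k))" unfolding n_def by (intro sw_linear enum_words)
      have "sw (enum K k) (Y i k) = lp_sum M ({1..m} \<times> {1..n}) (\<lambda>jl. sw (enum K k) (case jl of (j, l) \<Rightarrow> lp_scale M (r i j k l) (T j l)))"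
        unfolding Y_def by (intro lp_linear_sum[OF p lin]) (auto intro!: Lp_scale T)
      also have "\<dots> = lp_sum M ({1..m} \<times> {1..n})
          (\<lambda>jl. lp_scale M (r i (fst jl) k (snd jl)) (sw (enum K k) (T (fst jl) (snd jl))))"
        using T by (intro lp_sum_cong refl) (auto simp: lp_linearD(3)[OF lin])
      finally show "lp_sum M ({1..m} \<times> {1..n})
          (\<lambda>jl. lp_scale M (r i (fst jl) k (snd jl)) (sw (enum K k) (T (fst jl) (snd jl)))) = sw (enum K k) (Y i k)" ..
    qed
    finally show ?thesis .
  qed
  then have "(\<Sum>i=1..m. lp_pow p M (lp_sum M {1..m} (\<lambda>j. expand K (x i j) (u j))))
      \<le> (\<Sum>i=1..m. real K powr (p - 1) * (\<Sum>k=1..n. lp_pow p M (Y i k)))"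
    unfolding n_def using lp_pow_enum_sw_sum[OF K, of "Y _"] Y by (intro sum_mono) simp
  also have "\<dots> = real K powr (p - 1) * (\<Sum>i=1..m. \<Sum>k=1..n. lp_pow p M (Y i k))"
    by (simp add: sum_distrib_left)
  also have "(\<Sum>i=1..m. \<Sum>k=1..n. lp_pow p M (Y i k))
      \<le> real K powr (- p) * c * (\<Sum>j=1..m. \<Sum>l=1..n. lp_pow p M (T j l))"
  proof -
    have Yf: "lp_pow p M (Y i k) = (\<integral>y. cmod (G i k y) powr p \<partial>M)"
      and Yi: "integrable M (\<lambda>y. cmod (G i k y) powr p)"
      for i k
    proof -
      have "AE y in M. rep (lp_scale M (r i j k l) (T j l)) y = r i j k l * rep (T j l) y"
        if "j \<in> {1..m}" "l \<in> {1..n}" for j l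
        by (rule rep_lp_scale[OF T[OF that]])
      then have "AE y in M. \<forall>j\<in>{1..m}. \<forall>l\<in>{1..n}. rep (lp_scale M (r i j k l) (T j l)) y = r i j k l * rep (T j l) y"
        by (simp add: AE_finite_all)
      then have eq: "Y i k = ae_class M (G i k)"
        unfolding Y_def lp_sum_def G_def
        by (intro ae_class_cong, eventually_elim) (auto simp: sum.cartesian_product case_prod_unfold intro!: sum.cong)
      have meas: "G i k \<in> borel_measurable M"
        unfolding G_def using Lp_measurable[OF T] by (intro borel_measurable_sum borel_measurable_times) auto
      show "lp_pow p M (Y i k) = (\<integral>y. cmod (G i k y) powr p \<partial>M)"
        unfolding eq by (rule lp_pow_ae_class[OF meas])
      have "integrable M (\<lambda>y. cmod (rep (Y i k) y) powr p)" by (rule Lp_integrable[OF Y])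
      moreover have "AE y in M. rep (Y i k) y = G i k y"
        unfolding eq by (rule rep_ae_class(2)[OF meas])
      ultimately show "integrable M (\<lambda>y. cmod (G i k y) powr p)"
        using Lp_measurable[OF Y, of i k] meas
        by (subst (asm) integrable_cong_AE[where g = "\<lambda>y. cmod (G i k y) powr p"]) auto
    qed
    have Ti: "integrable M (\<lambda>y. cmod (rep (T j l) y) powr p)" if "j \<in> {1..m}" "l \<in> {1..n}" for j l
      by (rule Lp_integrable[OF T[OF that]])
    have "(\<Sum>i=1..m. \<Sum>k=1..n. lp_pow p M (Y i k))
        = (\<integral>y. (\<Sum>i=1..m. \<Sum>k=1..n. cmod (G i k y) powr p) \<partial>M)"
      unfolding Yf using Yi by (simp add: Bochner_Integration.integral_sum)
    also have "\<dots> \<le> (\<integral>y. real K powr (- p) * c * (\<Sum>j=1..m. \<Sum>l=1..n. cmod (rep (T j l) y) powr p) \<partial>M)"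
    proof (rule integral_mono)
      show "integrable M (\<lambda>y. \<Sum>i=1..m. \<Sum>k=1..n. cmod (G i k y) powr p)"
        using Yi by (intro Bochner_Integration.integrable_sum) auto
      show "integrable M (\<lambda>y. real K powr (- p) * c * (\<Sum>j=1..m. \<Sum>l=1..n. cmod (rep (T j l) y) powr p))"
        using Ti by (intro integrable_mult_right Bochner_Integration.integrable_sum) auto
      fix y
      \<comment> \<open>The division by K is moved from the matrix to the vector, so that the bound
        for \<open>x\<close> applies unchanged.\<close>
      have "(\<Sum>i=1..m. \<Sum>k=1..n. cmod (\<Sum>j=1..m. \<Sum>l=1..n. entry n (x i j) k l * (rep (T j l) y / of_nat K)) powr p)
          \<le> c * (\<Sum>j=1..m. \<Sum>l=1..n. cmod (rep (T j l) y / of_nat K) powr p)"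
        using x bound unfolding n_def Mp_def by (intro mat_bound_idx p BopD(2)[OF p]) auto
      also have "\<dots> = real K powr (- p) * c * (\<Sum>j=1..m. \<Sum>l=1..n. cmod (rep (T j l) y) powr p)"
        by (simp add: norm_divide powr_divide powr_minus_divide sum_distrib_left sum_divide_distrib)
      finally show "(\<Sum>i=1..m. \<Sum>k=1..n. cmod (G i k y) powr p)
          \<le> real K powr (- p) * c * (\<Sum>j=1..m. \<Sum>l=1..n. cmod (rep (T j l) y) powr p)"
        by (simp add: G_def r_def)
    qed
    also have "\<dots> = real K powr (- p) * c * (\<Sum>j=1..m. \<Sum>l=1..n. lp_pow p M (T j l))"
    proof -
      have "(\<integral>y. (\<Sum>j=1..m. \<Sum>l=1..n. cmod (rep (T j l) y) powr p) \<partial>M)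
          = (\<Sum>j=1..m. \<integral>y. (\<Sum>l=1..n. cmod (rep (T j l) y) powr p) \<partial>M)"
        using Ti by (intro Bochner_Integration.integral_sum Bochner_Integration.integrable_sum)
      also have "\<dots> = (\<Sum>j=1..m. \<Sum>l=1..n. lp_pow p M (T j l))"
        unfolding lp_pow_def using Ti by (intro sum.cong refl Bochner_Integration.integral_sum)
      finally show ?thesis by simp
    qed
    finally show ?thesis .
  qed
  also have "(\<Sum>j=1..m. \<Sum>l=1..n. lp_pow p M (T j l)) = real K * (\<Sum>j=1..m. lp_pow p M (u j))"
    unfolding T_def n_def sum_distrib_left using u by (intro sum.cong refl sum_enum_tw) auto
  finally have "(\<Sum>i=1..m. lp_pow p M (lp_sum M {1..m} (\<lambda>j. expand K (x i j) (u j))))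
      \<le> real K powr (p - 1) * (real K powr (- p) * c * (real K * (\<Sum>j=1..m. lp_pow p M (u j))))"
    by (simp add: mult_left_mono)
  also have "\<dots> = c * (\<Sum>j=1..m. lp_pow p M (u j))"
    using K by (simp add: powr_diff powr_minus_divide)
  finally show "(\<Sum>i=1..m. lp_pow p M (lp_sum M {1..m} (\<lambda>j. expand K (x i j) (u j))))
      \<le> c * (\<Sum>j=1..m. lp_pow p M (u j))" .
qed

end

section \<open>Approximation of the identity\<close>

lemma Bop_add_eq: "S \<oplus>\<^bsub>Bop p M\<^esub> T = (\<lambda>U\<in>Lp p M. lp_add M (S U) (T U))"
  and Bop_smult_eq: "c \<odot>\<^bsub>Bop p M\<^esub> T = (\<lambda>U\<in>Lp p M. lp_scale M c (T U))"
  and Bop_zero_eq: "\<zero>\<^bsub>Bop p M\<^esub> = (\<lambda>U\<in>Lp p M. lp_zero M)"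
  by (simp_all add: Bop_def)

lemma Bop_zero_closed: "p \<ge> 1 \<Longrightarrow> \<zero>\<^bsub>Bop p M\<^esub> \<in> carrier (Bop p M)"
proof -
  assume p: "p \<ge> 1"
  have "lp_add M (lp_zero M) (lp_zero M) = lp_zero M"
    using rep_lp_zero[of M] unfolding lp_add_def lp_zero_def[of M]
    by (intro ae_class_cong) (auto simp: lp_zero_def elim: eventually_mono)
  then have "lp_linear p M M (\<lambda>U. lp_zero M)"
    by (simp add: lp_linear_def Lp_zero lp_scale_zero)
  from lp_linear_restrict[OF p this] show ?thesis
    by (intro BopI[OF p, where c = 0]) (auto simp: Bop_zero_eq opb_def lp_pow_zero lp_pow_nonneg)
qed

lemma Bop_smult_closed:
  assumes "p \<ge> 1" "T \<in> carrier (Bop p M)"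
  shows "e \<odot>\<^bsub>Bop p M\<^esub> T \<in> carrier (Bop p M)"
proof -
  note T = BopD(2)[OF assms]
  obtain c where c: "opb p M M T c" using BopD(3)[OF assms] by blast
  have "opb p M M (\<lambda>U. lp_scale M e (T U)) (cmod e powr p * c)"
    unfolding opb_def using opb_nonneg[OF c] opbD[OF c] lp_linearD(1)[OF T]
    by (auto simp: lp_pow_scale mult.assoc intro!: mult_left_mono)
  then show ?thesis unfolding Bop_smult_eq
    by (intro BopI[OF assms(1), where c = "cmod e powr p * c"] lp_linear_restrict lp_linear_scale T assms)
      (auto simp: opb_restrict)
qed

lemma Bop_add_closed:
  assumes "p \<ge> 1" "S \<in> carrier (Bop p M)" "T \<in> carrier (Bop p M)"
  shows "S \<oplus>\<^bsub>Bop p M\<^esub> T \<in> carrier (Bop p M)"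
proof -
  note S = BopD(2)[OF assms(1,2)] and T = BopD(2)[OF assms(1,3)]
  obtain c e where c: "opb p M M S c" and e: "opb p M M T e"
    using BopD(3)[OF assms(1,2)] BopD(3)[OF assms(1,3)] by blast
  have "lp_linear p M M (\<lambda>U. lp_sum M UNIV (\<lambda>b. (if b then S else T) U))"
    by (intro lp_linear_lp_sum assms(1)) (auto simp: S T)
  moreover have "lp_sum M UNIV (\<lambda>b. (if b then S else T) U) = lp_add M (S U) (T U)" for U
    by (simp add: if_distribR lp_sum_pair)
  ultimately have lin: "lp_linear p M M (\<lambda>U. lp_add M (S U) (T U))" by simp
  have "opb p M M (\<lambda>U. lp_add M (S U) (T U)) (2 powr (p - 1) * (c + e))"
    unfolding opb_def
  proof (intro conjI ballI)
    show "0 \<le> 2 powr (p - 1) * (c + e)" using opb_nonneg[OF c] opb_nonneg[OF e] by simp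
    fix U assume U: "U \<in> Lp p M"
    have "lp_pow p M (lp_add M (S U) (T U)) \<le> 2 powr (p - 1) * (lp_pow p M (S U) + lp_pow p M (T U))"
      by (intro lp_pow_add_le assms(1) lp_linearD(1)[OF S U] lp_linearD(1)[OF T U])
    also have "\<dots> \<le> 2 powr (p - 1) * (c * lp_pow p M U + e * lp_pow p M U)"
      by (intro mult_left_mono add_mono opbD[OF c U] opbD[OF e U]) auto
    finally show "lp_pow p M (lp_add M (S U) (T U)) \<le> 2 powr (p - 1) * (c + e) * lp_pow p M U"
      by (simp add: algebra_simps)
  qed
  then show ?thesis unfolding Bop_add_eq
    by (intro BopI[OF assms(1), where c = "2 powr (p - 1) * (c + e)"] lp_linear_restrict lin assms(1))
      (auto simp: opb_restrict)
qed

lemma lp_sum_add: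
  assumes "finite I" "\<And>i. i \<in> I \<Longrightarrow> u i \<in> Lp p M" "\<And>i. i \<in> I \<Longrightarrow> v i \<in> Lp p M"
  shows "lp_sum M I (\<lambda>i. lp_add M (u i) (v i)) = lp_add M (lp_sum M I u) (lp_sum M I v)"
proof -
  have "AE x in M. rep (lp_add M (u i) (v i)) x = rep (u i) x + rep (v i) x" if "i \<in> I" for i
    by (rule rep_lp_add[OF assms(2)[OF that] assms(3)[OF that]])
  then have "AE x in M. \<forall>i\<in>I. rep (lp_add M (u i) (v i)) x = rep (u i) x + rep (v i) x"
    using assms(1) by (simp add: AE_finite_all)
  moreover have "AE x in M. rep (lp_sum M I u) x = (\<Sum>i\<in>I. rep (u i) x)"
    "AE x in M. rep (lp_sum M I v) x = (\<Sum>i\<in>I. rep (v i) x)"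
    using assms by (auto intro: rep_lp_sum)
  ultimately have "AE x in M. (\<Sum>i\<in>I. rep (lp_add M (u i) (v i)) x) = rep (lp_sum M I u) x + rep (lp_sum M I v) x"
    by eventually_elim (simp add: sum.distrib)
  then show ?thesis
    unfolding lp_sum_def[of M I "\<lambda>i. lp_add M (u i) (v i)"] lp_add_def[of M "lp_sum M I u"]
    by (rule ae_class_cong)
qed

lemma op_norm_cong: "(\<And>U. U \<in> Lp p M \<Longrightarrow> S U = T U) \<Longrightarrow> op_norm p M S = op_norm p M T"
  unfolding op_norm_def by (intro SUP_cong) auto

text \<open>Matrix size 1 turns complete contractivity back into an ordinary operator bound.\<close>

lemma mat_bound_1_iff:
  assumes "\<And>U. U \<in> Lp p M \<Longrightarrow> T U \<in> Lp p M"
  shows "mat_bound p 1 M (\<lambda>_ _. T) c \<longleftrightarrow> opb p M M T c"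
proof -
  have "lp_sum M {1..1} (\<lambda>j. T (u j)) = T (u 1)" if "u 1 \<in> Lp p M" for u :: "nat \<Rightarrow> _"
    using lp_sum_singleton[of "\<lambda>j. T (u j)" 1] assms[OF that] by simp
  then show ?thesis unfolding mat_bound_def opb_def
    by (auto dest: spec[of _ "\<lambda>_. _"])
qed

context cuntz_family
begin

definition st :: "nat list \<Rightarrow> nat list \<Rightarrow> 'a lp_op" where
  "st \<alpha> \<beta> = (\<lambda>U\<in>Lp p M. sw \<alpha> (tw \<beta> U))"

lemma st_linear: "\<alpha> \<in> words \<Longrightarrow> \<beta> \<in> words \<Longrightarrow> lp_linear p M M (st \<alpha> \<beta>)"
  unfolding st_def by (intro lp_linear_restrict p lp_linear_comp[OF tw_linear sw_linear])

lemma opb_st: "\<alpha> \<in> words \<Longrightarrow> \<beta> \<in> words \<Longrightarrow> opb p M M (st \<alpha> \<beta>) 1"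
  unfolding st_def opb_restrict by (simp add: opb_def lp_pow_sw tw_in lp_pow_tw_le)

lemma st_closed: "\<alpha> \<in> words \<Longrightarrow> \<beta> \<in> words \<Longrightarrow> st \<alpha> \<beta> \<in> carrier (Bop p M)"
  by (rule BopI[OF p _ st_linear opb_st]) (auto simp: st_def)

text \<open>The linear span of the products s_\<alpha> t_\<beta>, generated term by term in the same
  shape as \<open>leavitt_induct\<close>.\<close>

inductive_set mspan :: "'a lp_op set" where
  zero: "\<zero>\<^bsub>Bop p M\<^esub> \<in> mspan"
| step: "\<alpha> \<in> words \<Longrightarrow> \<beta> \<in> words \<Longrightarrow> T \<in> mspan \<Longrightarrow>
    c \<odot>\<^bsub>Bop p M\<^esub> st \<alpha> \<beta> \<oplus>\<^bsub>Bop p M\<^esub> T \<in> mspan"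

lemma mspan_closed: "T \<in> mspan \<Longrightarrow> T \<in> carrier (Bop p M)"
  by (induction rule: mspan.induct) (auto intro: Bop_zero_closed Bop_add_closed Bop_smult_closed st_closed p)

lemma lp_sum_in_mspan:
  assumes "finite I" "\<And>i. i \<in> I \<Longrightarrow> \<alpha> i \<in> words" "\<And>i. i \<in> I \<Longrightarrow> \<beta> i \<in> words"
  shows "(\<lambda>U\<in>Lp p M. lp_sum M I (\<lambda>i. lp_scale M (c i) (sw (\<alpha> i) (tw (\<beta> i) U)))) \<in> mspan"
  using assms
proof (induction I)
  case empty
  show ?case using mspan.zero by (simp only: lp_sum_empty Bop_zero_eq)
next
  case (insert i I)
  let ?T = "\<lambda>U\<in>Lp p M. lp_sum M I (\<lambda>i. lp_scale M (c i) (sw (\<alpha> i) (tw (\<beta> i) U)))"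
  have "c i \<odot>\<^bsub>Bop p M\<^esub> st (\<alpha> i) (\<beta> i) \<oplus>\<^bsub>Bop p M\<^esub> ?T \<in> mspan"
    using insert.prems by (intro mspan.step insert.IH) auto
  also have "c i \<odot>\<^bsub>Bop p M\<^esub> st (\<alpha> i) (\<beta> i) \<oplus>\<^bsub>Bop p M\<^esub> ?T
      = (\<lambda>U\<in>Lp p M. lp_sum M (insert i I) (\<lambda>i. lp_scale M (c i) (sw (\<alpha> i) (tw (\<beta> i) U))))"
  proof (rule extensionalityI)
    fix U assume U: "U \<in> Lp p M"
    then have "lp_scale M (c j) (sw (\<alpha> j) (tw (\<beta> j) U)) \<in> Lp p M" if "j \<in> insert i I" for j
      using insert.prems that by (intro Lp_scale sw_in tw_in) auto
    then show "(c i \<odot>\<^bsub>Bop p M\<^esub> st (\<alpha> i) (\<beta> i) \<oplus>\<^bsub>Bop p M\<^esub> ?T) U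
        = (\<lambda>U\<in>Lp p M. lp_sum M (insert i I) (\<lambda>i. lp_scale M (c i) (sw (\<alpha> i) (tw (\<beta> i) U)))) U"
      using U insert.hyps lp_sum_insert[OF p, of I i "\<lambda>i. lp_scale M (c i) (sw (\<alpha> i) (tw (\<beta> i) U))" M]
      by (simp add: Bop_add_eq Bop_smult_eq st_def)
  qed (auto simp: Bop_add_eq)
  finally show ?case .
qed

end

context cuntz_normed
begin

lemma expand_in_mspan: "expand K x \<in> mspan"
proof -
  have "expand K x = (\<lambda>U\<in>Lp p M. lp_sum M ({1..level_dim K} \<times> {1..level_dim K}) (\<lambda>kl. lp_scale M
      (entry (level_dim K) x (fst kl) (snd kl) / of_nat K) (sw (enum K (fst kl)) (tw (enum K (snd kl)) U))))"
    by (simp add: expand_def case_prod_unfold)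
  also have "\<dots> \<in> mspan"
    by (rule lp_sum_in_mspan[where c = "\<lambda>kl. entry (level_dim K) x (fst kl) (snd kl) / of_nat K"
          and \<alpha> = "\<lambda>kl. enum K (fst kl)" and \<beta> = "\<lambda>kl. enum K (snd kl)"])
      (auto intro: enum_words)
  finally show ?thesis .
qed

lemma expand_add:
  "expand K (x \<oplus>\<^bsub>Bop p (idx (level_dim K))\<^esub> y) = expand K x \<oplus>\<^bsub>Bop p M\<^esub> expand K y"
proof (rule extensionalityI)
  fix U assume U: "U \<in> Lp p M"
  let ?I = "{1..level_dim K} \<times> {1..level_dim K}"
  let ?F = "\<lambda>kl. sw (enum K (fst kl)) (tw (enum K (snd kl)) U)"
  let ?e = "\<lambda>x kl. entry (level_dim K) x (fst kl) (snd kl) / of_nat K"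
  have F: "?F kl \<in> Lp p M" if "kl \<in> ?I" for kl using that by (intro enum_in U) auto
  have "lp_sum M ?I (\<lambda>kl. lp_scale M (?e (x \<oplus>\<^bsub>Bop p (idx (level_dim K))\<^esub> y) kl) (?F kl))
      = lp_sum M ?I (\<lambda>kl. lp_add M (lp_scale M (?e x kl) (?F kl)) (lp_scale M (?e y kl) (?F kl)))"
  proof (intro lp_sum_cong refl)
    fix kl assume kl: "kl \<in> ?I"
    then have "?e (x \<oplus>\<^bsub>Bop p (idx (level_dim K))\<^esub> y) kl = ?e x kl + ?e y kl"
      by (auto simp: entry_def Bop_add_eq delta_in_Lp rep_idx_add add_divide_distrib)
    then show "lp_scale M (?e (x \<oplus>\<^bsub>Bop p (idx (level_dim K))\<^esub> y) kl) (?F kl)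
        = lp_add M (lp_scale M (?e x kl) (?F kl)) (lp_scale M (?e y kl) (?F kl))"
      using lp_scale_add_left[OF F[OF kl]] by simp
  qed
  also have "\<dots> = lp_add M (lp_sum M ?I (\<lambda>kl. lp_scale M (?e x kl) (?F kl))) (lp_sum M ?I (\<lambda>kl. lp_scale M (?e y kl) (?F kl)))"
    using F by (intro lp_sum_add[where p = p] Lp_scale) auto
  finally show "expand K (x \<oplus>\<^bsub>Bop p (idx (level_dim K))\<^esub> y) U = (expand K x \<oplus>\<^bsub>Bop p M\<^esub> expand K y) U"
    using U by (simp add: expand_def Bop_add_eq case_prod_unfold)
qed (auto simp: expand_def Bop_add_eq)

lemma expand_smult:
  "expand K (c \<odot>\<^bsub>Bop p (idx (level_dim K))\<^esub> x) = c \<odot>\<^bsub>Bop p M\<^esub> expand K x"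
proof (rule extensionalityI)
  fix U assume U: "U \<in> Lp p M"
  let ?I = "{1..level_dim K} \<times> {1..level_dim K}"
  let ?F = "\<lambda>kl. sw (enum K (fst kl)) (tw (enum K (snd kl)) U)"
  let ?e = "\<lambda>x kl. entry (level_dim K) x (fst kl) (snd kl) / of_nat K"
  have F: "?F kl \<in> Lp p M" if "kl \<in> ?I" for kl using that by (intro enum_in U) auto
  have "lp_sum M ?I (\<lambda>kl. lp_scale M (?e (c \<odot>\<^bsub>Bop p (idx (level_dim K))\<^esub> x) kl) (?F kl))
      = lp_sum M ?I (\<lambda>kl. lp_scale M c (lp_scale M (?e x kl) (?F kl)))"
  proof (intro lp_sum_cong refl)
    fix kl assume kl: "kl \<in> ?I"
    then have e: "?e (c \<odot>\<^bsub>Bop p (idx (level_dim K))\<^esub> x) kl = c * ?e x kl"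
      by (auto simp: entry_def Bop_smult_eq delta_in_Lp rep_idx_scale)
    show "lp_scale M (?e (c \<odot>\<^bsub>Bop p (idx (level_dim K))\<^esub> x) kl) (?F kl)
        = lp_scale M c (lp_scale M (?e x kl) (?F kl))"
      unfolding e by (rule lp_scale_scale[OF F[OF kl], symmetric])
  qed
  also have "\<dots> = lp_scale M c (lp_sum M ?I (\<lambda>kl. lp_scale M (?e x kl) (?F kl)))"
    using F by (intro lp_scale_sum[OF p, symmetric] Lp_scale) auto
  finally show "expand K (c \<odot>\<^bsub>Bop p (idx (level_dim K))\<^esub> x) U = (c \<odot>\<^bsub>Bop p M\<^esub> expand K x) U"
    using U by (simp add: expand_def Bop_smult_eq case_prod_unfold)
qed (auto simp: expand_def Bop_smult_eq)

lemma compress_add: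
  assumes "a \<in> carrier (Bop p M)" "b \<in> carrier (Bop p M)"
  shows "compress K (a \<oplus>\<^bsub>Bop p M\<^esub> b) = compress K a \<oplus>\<^bsub>Bop p (idx (level_dim K))\<^esub> compress K b"
proof (rule extensionalityI)
  fix v assume v: "v \<in> Lp p (idx (level_dim K))"
  note Jv = lp_linearD(1)[OF emb_linear v]
  show "compress K (a \<oplus>\<^bsub>Bop p M\<^esub> b) v = (compress K a \<oplus>\<^bsub>Bop p (idx (level_dim K))\<^esub> compress K b) v"
    using v Jv lp_linearD(2)[OF coord_linear lp_linearD(1)[OF BopD(2)[OF p assms(1)] Jv]
        lp_linearD(1)[OF BopD(2)[OF p assms(2)] Jv]]
    by (simp add: compress_def Bop_add_eq)
qed (auto simp: compress_def Bop_add_eq)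

lemma compress_smult:
  assumes "a \<in> carrier (Bop p M)"
  shows "compress K (c \<odot>\<^bsub>Bop p M\<^esub> a) = c \<odot>\<^bsub>Bop p (idx (level_dim K))\<^esub> compress K a"
proof (rule extensionalityI)
  fix v assume v: "v \<in> Lp p (idx (level_dim K))"
  note Jv = lp_linearD(1)[OF emb_linear v]
  show "compress K (c \<odot>\<^bsub>Bop p M\<^esub> a) v = (c \<odot>\<^bsub>Bop p (idx (level_dim K))\<^esub> compress K a) v"
    using v Jv lp_linearD(3)[OF coord_linear lp_linearD(1)[OF BopD(2)[OF p assms] Jv]]
    by (simp add: compress_def Bop_smult_eq)
qed (auto simp: compress_def Bop_smult_eq)

lemma entry_compress:
  assumes "k \<in> {1..level_dim K}" "l \<in> {1..level_dim K}"
  shows "entry (level_dim K) (compress K a) k l = \<eta> (tw (enum K k @ tail K) (a (sw (enum K l @ tail K) \<xi>)))"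
proof -
  let ?n = "level_dim K"
  have r: "rep (delta ?n l) i = (if i = l then 1 else 0)" if "i \<in> {1..?n}" for i
    unfolding delta_def using that by (rule rep_ae_class_idx)
  have "emb K (delta ?n l) = lp_sum M {l} (\<lambda>i. lp_scale M (rep (delta ?n l) i) (sw (enum K i @ tail K) \<xi>))"
    unfolding emb_def using assms(2) r by (intro lp_sum_neutral) (auto simp: lp_scale_0)
  also have "\<dots> = lp_scale M (rep (delta ?n l) l) (sw (enum K l @ tail K) \<xi>)"
    using lp_sum_singleton[of "\<lambda>i. lp_scale M (rep (delta ?n l) i) (sw (enum K i @ tail K) \<xi>)" l p M]
      tail_sw_in[OF assms(2) \<xi>] Lp_scale by blast
  also have "\<dots> = sw (enum K l @ tail K) \<xi>"
    using r[OF assms(2)] lp_scale_1[OF tail_sw_in[OF assms(2) \<xi>]] by simp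
  finally show ?thesis
    using assms by (simp add: entry_def compress_def delta_in_Lp coord_def rep_ae_class_idx)
qed

text \<open>As |\<beta>| \<le> K, the product of t_\<beta> with s of the column word vanishes unless
  \<beta> is a prefix of that word, and then equals s_\<gamma>. The tails force \<alpha>\<gamma> to
  equal the row word, and \<eta> \<xi> = 1 gives the value.\<close>

lemma entry_compress_st:
  assumes "\<alpha> \<in> words" "\<beta> \<in> words" "length \<alpha> \<le> K" "length \<beta> \<le> K"
    and kl: "k \<in> {1..level_dim K}" "l \<in> {1..level_dim K}"
  shows "entry (level_dim K) (compress K (st \<alpha> \<beta>)) k l
    = (if \<exists>\<gamma>. enum K k = \<alpha> @ \<gamma> \<and> enum K l = \<beta> @ \<gamma> then 1 else 0)"
proof -
  let ?u = "enum K k" and ?v = "enum K l"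
  have u: "?u \<in> words" "K \<le> length ?u" "length ?u < 2 * K"
    and v: "?v \<in> words" "K \<le> length ?v" "length ?v < 2 * K"
    using enum_V[OF kl(1)] enum_V[OF kl(2)] by (auto simp: V_iff)
  have e: "entry (level_dim K) (compress K (st \<alpha> \<beta>)) k l
      = \<eta> (tw (?u @ tail K) (sw \<alpha> (tw \<beta> (sw ?v (sw (tail K) \<xi>)))))"
    using tail_sw_in[OF kl(2) \<xi>] by (simp add: entry_compress[OF kl] st_def)
  have tx: "sw (tail K) \<xi> \<in> Lp p M" by (intro sw_in tail_words \<xi>)
  show ?thesis
  proof (cases "\<exists>\<gamma>. ?v = \<beta> @ \<gamma>")
    case True
    then obtain \<gamma> where \<gamma>: "?v = \<beta> @ \<gamma>" by blast
    then have gw: "\<gamma> \<in> words" using v(1) by simp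
    have "tw \<beta> (sw ?v (sw (tail K) \<xi>)) = sw \<gamma> (sw (tail K) \<xi>)"
      unfolding \<gamma> using assms(2) gw tx by (simp add: tw_sw sw_in)
    then have "tw (?u @ tail K) (sw \<alpha> (tw \<beta> (sw ?v (sw (tail K) \<xi>))))
        = tw (?u @ tail K) (sw ((\<alpha> @ \<gamma>) @ tail K) \<xi>)" by simp
    also have "\<dots> = (if ?u = \<alpha> @ \<gamma> then \<xi> else lp_zero M)"
      using u v \<gamma> gw assms by (intro tw_sw_tail \<xi>) auto
    finally show ?thesis unfolding e using \<gamma> by (auto simp: \<eta>_\<xi> lp_functional_zero[OF \<eta>])
  next
    case False
    \<comment> \<open>The column word has length at least K \<ge> |\<beta>|, so \<beta> could extend
      it only by being equal to it.\<close>
    have "\<nexists>w. \<beta> = ?v @ w"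
    proof
      assume "\<exists>w. \<beta> = ?v @ w"
      then obtain w where w: "\<beta> = ?v @ w" ..
      then have "w = []" using v(2) assms(4) by (simp flip: length_0_conv)
      with w False show False by auto
    qed
    then have "tw \<beta> (sw ?v (sw (tail K) \<xi>)) = lp_zero M"
      using False v assms(2) tx by (intro tw_sw_incomparable) auto
    then have "tw (?u @ tail K) (sw \<alpha> (tw \<beta> (sw ?v (sw (tail K) \<xi>)))) = lp_zero M"
      using u assms(1) tail_words lp_linear_zero[OF sw_linear[OF assms(1)]]
        lp_linear_zero[OF tw_linear, of "?u @ tail K"] by simp
    then show ?thesis unfolding e using False by (auto simp: lp_functional_zero[OF \<eta>])
  qed
qed

text \<open>The surviving pairs are \<alpha>\<gamma>, \<beta>\<gamma> with both words in the window.
  For each admissible length of \<gamma> the sum of s_\<gamma> t_\<gamma> is the identity and leaves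
  one copy of s_\<alpha> t_\<beta>, so the factor is the number of these lengths over K.\<close>

lemma expand_compress_st:
  assumes "\<alpha> \<in> words" "\<beta> \<in> words" "length \<alpha> \<le> K" "length \<beta> \<le> K" "U \<in> Lp p M"
  shows "expand K (compress K (st \<alpha> \<beta>)) U =
    lp_scale M (of_nat (K - (max (length \<alpha>) (length \<beta>) - min (length \<alpha>) (length \<beta>))) / of_nat K) (st \<alpha> \<beta> U)"
proof -
  let ?a = "length \<alpha>" and ?b = "length \<beta>" and ?n = "level_dim K"
  let ?e = "entry ?n (compress K (st \<alpha> \<beta>))"
  \<comment> \<open>The lengths of \<gamma> for which \<alpha>\<gamma> and \<beta>\<gamma> both lie
    in the window: the shorter of \<alpha> and \<beta> decides the lower end, the longer one the
    upper.\<close>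
  define G where "G = {K - min ?a ?b..<2 * K - max ?a ?b}"
  define F where "F = (\<lambda>(k, l). lp_scale M (?e k l / of_nat K) (sw (enum K k) (tw (enum K l) U)))"
  define S where "S = {(k, l) \<in> {1..?n} \<times> {1..?n}. \<exists>\<gamma>. enum K k = \<alpha> @ \<gamma> \<and> enum K l = \<beta> @ \<gamma>}"
  define H where "H \<gamma> = lp_scale M (1 / of_nat K) (sw \<alpha> (sw \<gamma> (tw \<gamma> (tw \<beta> U))))" for \<gamma>
  note bU = tw_in[OF assms(2,5)]
  have H: "H \<gamma> \<in> Lp p M" if "\<gamma> \<in> words" for \<gamma>
    unfolding H_def by (intro Lp_scale sw_in tw_in bU assms that)
  have "expand K (compress K (st \<alpha> \<beta>)) U = lp_sum M ({1..?n} \<times> {1..?n}) F"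
    using assms(5) by (simp add: expand_def F_def)
  also have "\<dots> = lp_sum M S F"
  proof (rule lp_sum_neutral)
    fix kl assume "kl \<in> {1..?n} \<times> {1..?n} - S"
    then have "fst kl \<in> {1..?n}" "snd kl \<in> {1..?n}"
      and "\<not> (\<exists>\<gamma>. enum K (fst kl) = \<alpha> @ \<gamma> \<and> enum K (snd kl) = \<beta> @ \<gamma>)" by (auto simp: S_def)
    then have "?e (fst kl) (snd kl) = 0" by (simp only: entry_compress_st[OF assms(1-4)] if_False)
    then show "F kl = lp_zero M" by (simp add: F_def case_prod_unfold lp_scale_0)
  qed (auto simp: S_def)
  also have "\<dots> = lp_sum M S (\<lambda>kl. H (drop ?a (enum K (fst kl))))"
  proof (intro lp_sum_cong refl)
    fix kl assume kl: "kl \<in> S"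
    then obtain \<gamma> where \<gamma>: "enum K (fst kl) = \<alpha> @ \<gamma>" "enum K (snd kl) = \<beta> @ \<gamma>" by (auto simp: S_def)
    have "?e (fst kl) (snd kl) = 1" using kl \<gamma> by (auto simp: S_def entry_compress_st[OF assms(1-4)])
    with \<gamma> show "F kl = H (drop ?a (enum K (fst kl)))"
      by (simp add: F_def H_def case_prod_unfold)
  qed
  also have "\<dots> = lp_sum M (SIGMA g:G. W g) (\<lambda>(g, \<gamma>). H \<gamma>)"
  proof -
    let ?inv = "the_inv_into {1..?n} (enum K)"
    have inv: "?inv w \<in> {1..?n}" "enum K (?inv w) = w" if "w \<in> V K" for w
      using that bij_betw_imp_surj_on[OF enum_bij[of K]]
        the_inv_into_into[OF enum_inj[of K], of w "{1..?n}"] f_the_inv_into_f[OF enum_inj[of K], of w]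
      by auto
    have inv': "?inv (enum K k) = k" if "k \<in> {1..?n}" for k
      by (rule the_inv_into_f_f[OF enum_inj that])
    \<comment> \<open>A surviving pair of indices is determined by \<gamma>; recording its length as
      well groups the pairs by level.\<close>
    have "bij_betw (\<lambda>kl. (length (drop ?a (enum K (fst kl))), drop ?a (enum K (fst kl)))) S (SIGMA g:G. W g)"
    proof (rule bij_betw_byWitness[of _ "\<lambda>(g, \<gamma>). (?inv (\<alpha> @ \<gamma>), ?inv (\<beta> @ \<gamma>))"])
      show "\<forall>kl\<in>S. (\<lambda>(g, \<gamma>). (?inv (\<alpha> @ \<gamma>), ?inv (\<beta> @ \<gamma>)))
          (length (drop ?a (enum K (fst kl))), drop ?a (enum K (fst kl))) = kl"
      proof
        fix kl assume kl: "kl \<in> S"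
        then obtain \<gamma> where \<gamma>: "enum K (fst kl) = \<alpha> @ \<gamma>" "enum K (snd kl) = \<beta> @ \<gamma>" by (auto simp: S_def)
        have "fst kl \<in> {1..?n}" "snd kl \<in> {1..?n}" using kl by (auto simp: S_def)
        with \<gamma> inv'[of "fst kl"] inv'[of "snd kl"]
        show "(\<lambda>(g, \<gamma>). (?inv (\<alpha> @ \<gamma>), ?inv (\<beta> @ \<gamma>)))
          (length (drop ?a (enum K (fst kl))), drop ?a (enum K (fst kl))) = kl" by simp
      qed
      have VG: "\<alpha> @ \<gamma> \<in> V K" "\<beta> @ \<gamma> \<in> V K" if "g \<in> G" "\<gamma> \<in> W g" for g \<gamma>
        using that assms by (auto simp: V_iff G_def W_def)
      show "\<forall>g\<gamma>\<in>SIGMA g:G. W g. (length (drop ?a (enum K (fst ((\<lambda>(g, \<gamma>). (?inv (\<alpha> @ \<gamma>), ?inv (\<beta> @ \<gamma>))) g\<gamma>)))),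
          drop ?a (enum K (fst ((\<lambda>(g, \<gamma>). (?inv (\<alpha> @ \<gamma>), ?inv (\<beta> @ \<gamma>))) g\<gamma>)))) = g\<gamma>"
      proof
        fix z assume "z \<in> (SIGMA g:G. W g)"
        then obtain g \<gamma> where g: "g \<in> G" "\<gamma> \<in> W g" and z: "z = (g, \<gamma>)" by auto
        show "(length (drop ?a (enum K (fst ((\<lambda>(g, \<gamma>). (?inv (\<alpha> @ \<gamma>), ?inv (\<beta> @ \<gamma>))) z)))),
          drop ?a (enum K (fst ((\<lambda>(g, \<gamma>). (?inv (\<alpha> @ \<gamma>), ?inv (\<beta> @ \<gamma>))) z)))) = z"
          using inv(2)[OF VG(1)[OF g]] g(2) unfolding z by (simp add: W_def)
      qed
      show "(\<lambda>kl. (length (drop ?a (enum K (fst kl))), drop ?a (enum K (fst kl)))) ` S \<subseteq> (SIGMA g:G. W g)"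
      proof
        fix z assume "z \<in> (\<lambda>kl. (length (drop ?a (enum K (fst kl))), drop ?a (enum K (fst kl)))) ` S"
        then obtain k l \<gamma> where k: "k \<in> {1..?n}" "l \<in> {1..?n}"
          and \<gamma>: "enum K k = \<alpha> @ \<gamma>" "enum K l = \<beta> @ \<gamma>" and z: "z = (length \<gamma>, \<gamma>)"
          by (auto simp: S_def)
        from enum_V[OF k(1)] enum_V[OF k(2)] show "z \<in> (SIGMA g:G. W g)"
          unfolding z \<gamma> by (auto simp: V_iff G_def W_def)
      qed
      show "(\<lambda>(g, \<gamma>). (?inv (\<alpha> @ \<gamma>), ?inv (\<beta> @ \<gamma>))) ` (SIGMA g:G. W g) \<subseteq> S"
      proof
        fix z assume "z \<in> (\<lambda>(g, \<gamma>). (?inv (\<alpha> @ \<gamma>), ?inv (\<beta> @ \<gamma>))) ` (SIGMA g:G. W g)"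
        then obtain g \<gamma> where g: "g \<in> G" "\<gamma> \<in> W g" and z: "z = (?inv (\<alpha> @ \<gamma>), ?inv (\<beta> @ \<gamma>))" by auto
        show "z \<in> S" unfolding z S_def using inv[OF VG(1)[OF g]] inv[OF VG(2)[OF g]] by auto
      qed
    qed
    from lp_sum_reindex[OF this, of M "\<lambda>(g, \<gamma>). H \<gamma>"] show ?thesis by simp
  qed
  also have "\<dots> = lp_sum M G (\<lambda>g. lp_sum M (W g) H)"
    using H by (intro lp_sum_Sigma[OF p, symmetric]) (auto simp: G_def finite_W W_words)
  also have "\<dots> = lp_sum M G (\<lambda>g. lp_scale M (1 / of_nat K) (st \<alpha> \<beta> U))"
  proof (intro lp_sum_cong refl)
    fix g
    have "lp_sum M (W g) H = lp_scale M (1 / of_nat K) (lp_sum M (W g) (\<lambda>\<gamma>. sw \<alpha> (sw \<gamma> (tw \<gamma> (tw \<beta> U)))))"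
      unfolding H_def by (intro lp_scale_sum[OF p, symmetric] finite_W sw_in tw_in bU assms W_words)
    also have "lp_sum M (W g) (\<lambda>\<gamma>. sw \<alpha> (sw \<gamma> (tw \<gamma> (tw \<beta> U)))) = sw \<alpha> (lp_sum M (W g) (\<lambda>\<gamma>. sw \<gamma> (tw \<gamma> (tw \<beta> U))))"
      by (intro lp_linear_sum[OF p sw_linear[OF assms(1)], symmetric] finite_W sw_in tw_in bU W_words)
    also have "lp_sum M (W g) (\<lambda>\<gamma>. sw \<gamma> (tw \<gamma> (tw \<beta> U))) = tw \<beta> U" by (rule sw_tw_sum[OF bU])
    finally show "lp_sum M (W g) H = lp_scale M (1 / of_nat K) (st \<alpha> \<beta> U)"
      using assms(5) by (simp add: st_def)
  qed
  also have "\<dots> = lp_scale M (of_nat (card G)) (lp_scale M (1 / of_nat K) (st \<alpha> \<beta> U))"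
    by (intro lp_sum_const[where p = p] Lp_scale lp_linearD(1)[OF st_linear] assms)
  also have "\<dots> = lp_scale M (of_nat (card G) * (1 / of_nat K)) (st \<alpha> \<beta> U)"
    by (intro lp_scale_scale[where p = p] lp_linearD(1)[OF st_linear] assms)
  also have "card G = K - (max ?a ?b - min ?a ?b)" using assms by (simp add: G_def)
  finally show ?thesis by simp
qed

text \<open>Left as a function without restriction to \<open>Lp p M\<close>; on
  \<open>Lp p M\<close> it agrees with the difference in \<open>Bop\<close>, and
  \<open>op_norm\<close> sees no more than that.\<close>

definition err :: "nat \<Rightarrow> 'a lp_op \<Rightarrow> 'a lp_op" where
  "err K a U = lp_add M (expand K (compress K a) U) (lp_scale M (- 1) (a U))"

text \<open>The bound does not depend on K, which is why approximability survives the passage to the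
  closure.\<close>

lemma opb_expand_compress:
  assumes "K > 0" "a \<in> carrier (Bop p M)" "opb p M M a c"
  shows "opb p M M (expand K (compress K a)) c"
proof -
  have "mat_bound p 1 M (\<lambda>_ _. a) c"
    using assms(3) mat_bound_1_iff[of p M a c] lp_linearD(1)[OF BopD(2)[OF p assms(2)]] by blast
  then have "mat_bound p 1 (idx (level_dim K)) (\<lambda>_ _. compress K a) c"
    using mat_bound_compress[of 1 "\<lambda>_ _. a"] assms(2) by blast
  then have "mat_bound p 1 M (\<lambda>_ _. expand K (compress K a)) c"
    using mat_bound_expand[OF assms(1), of 1 "\<lambda>_ _. compress K a"] compress_in_Mp[OF assms(2)] by blast
  then show ?thesis
    using mat_bound_1_iff[of p M "expand K (compress K a)" c]
      lp_linearD(1)[OF BopD(2)[OF p mspan_closed[OF expand_in_mspan]]] by blast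
qed

lemma err_comb:
  assumes b: "b \<in> carrier (Bop p M)" and T: "T \<in> carrier (Bop p M)" and U: "U \<in> Lp p M"
  shows "err K (c \<odot>\<^bsub>Bop p M\<^esub> b \<oplus>\<^bsub>Bop p M\<^esub> T) U = lp_add M (lp_scale M c (err K b U)) (err K T U)"
    and "err K b U \<in> Lp p M"
proof -
  define B where "B = expand K (compress K b) U"
  define A where "A = expand K (compress K T) U"
  have inL: "a U \<in> Lp p M" if "a \<in> carrier (Bop p M)" for a
    using lp_linearD(1)[OF BopD(2)[OF p that] U] .
  have BL: "B \<in> Lp p M" and AL: "A \<in> Lp p M" and bL: "b U \<in> Lp p M" and TL: "T U \<in> Lp p M"
    unfolding A_def B_def by (auto intro!: inL b T mspan_closed expand_in_mspan)
  show errL: "err K b U \<in> Lp p M"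
    unfolding err_def B_def[symmetric] by (intro Lp_add p Lp_scale BL bL)
  have "expand K (compress K (c \<odot>\<^bsub>Bop p M\<^esub> b \<oplus>\<^bsub>Bop p M\<^esub> T)) U = lp_add M (lp_scale M c B) A"
    using U b T Bop_smult_closed[OF p b]
    by (simp add: compress_add compress_smult expand_add expand_smult A_def B_def)
      (simp add: Bop_add_eq Bop_smult_eq)
  then have "err K (c \<odot>\<^bsub>Bop p M\<^esub> b \<oplus>\<^bsub>Bop p M\<^esub> T) U
      = lp_add M (lp_add M (lp_scale M c B) A) (lp_scale M (- 1) (lp_add M (lp_scale M c (b U)) (T U)))"
    using U by (simp add: err_def) (simp add: Bop_add_eq Bop_smult_eq)
  also have "\<dots> = lp_add M (lp_scale M c (lp_add M B (lp_scale M (- 1) (b U)))) (lp_add M A (lp_scale M (- 1) (T U)))"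
    (is "lp_add M ?X ?Y = lp_add M ?Z ?W")
  proof -
    \<comment> \<open>Each of the following statements evaluates one operation almost everywhere;
      together they reduce the claim to an identity of complex numbers.\<close>
    note L = BL AL bL TL Lp_scale Lp_add[OF p]
    have 1: "AE x in M. rep ?X x = rep (lp_scale M c B) x + rep A x" by (intro rep_lp_add[where p = p] L)
    have 2: "AE x in M. rep (lp_scale M c B) x = c * rep B x" by (intro rep_lp_scale[where p = p] L)
    have 3: "AE x in M. rep ?Y x = - 1 * rep (lp_add M (lp_scale M c (b U)) (T U)) x"
      by (intro rep_lp_scale[where p = p] L)
    have 4: "AE x in M. rep (lp_add M (lp_scale M c (b U)) (T U)) x = rep (lp_scale M c (b U)) x + rep (T U) x"
      by (intro rep_lp_add[where p = p] L)
    have 5: "AE x in M. rep (lp_scale M c (b U)) x = c * rep (b U) x" by (intro rep_lp_scale[where p = p] L)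
    have 6: "AE x in M. rep ?Z x = c * rep (lp_add M B (lp_scale M (- 1) (b U))) x"
      by (intro rep_lp_scale[where p = p] L)
    have 7: "AE x in M. rep (lp_add M B (lp_scale M (- 1) (b U))) x = rep B x + rep (lp_scale M (- 1) (b U)) x"
      by (intro rep_lp_add[where p = p] L)
    have 8: "AE x in M. rep (lp_scale M (- 1) (b U)) x = - 1 * rep (b U) x" by (intro rep_lp_scale[where p = p] L)
    have 9: "AE x in M. rep ?W x = rep A x + rep (lp_scale M (- 1) (T U)) x" by (intro rep_lp_add[where p = p] L)
    have 10: "AE x in M. rep (lp_scale M (- 1) (T U)) x = - 1 * rep (T U) x" by (intro rep_lp_scale[where p = p] L)
    from 1 2 3 4 5 6 7 8 9 10 have "AE x in M. rep ?X x + rep ?Y x = rep ?Z x + rep ?W x"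
    proof eventually_elim
      case (elim x)
      show ?case unfolding elim by (simp add: algebra_simps)
    qed
    then show ?thesis unfolding lp_add_def[of M ?X] lp_add_def[of M ?Z] by (rule ae_class_cong)
  qed
  finally show "err K (c \<odot>\<^bsub>Bop p M\<^esub> b \<oplus>\<^bsub>Bop p M\<^esub> T) U = lp_add M (lp_scale M c (err K b U)) (err K T U)"
    by (simp add: err_def A_def B_def)
qed

text \<open>Adding vectors costs the factor \<open>2 powr (p - 1)\<close> for p-th powers. It is
  independent of K and so harmless in the limit.\<close>

lemma opb_err_comb:
  assumes b: "b \<in> carrier (Bop p M)" and T: "T \<in> carrier (Bop p M)"
    and "opb p M M (err K b) \<delta>" "opb p M M (err K T) \<epsilon>"
  shows "opb p M M (err K (c \<odot>\<^bsub>Bop p M\<^esub> b \<oplus>\<^bsub>Bop p M\<^esub> T)) (2 powr (p - 1) * (cmod c powr p * \<delta> + \<epsilon>))"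
  unfolding opb_def
proof (intro conjI ballI)
  show "0 \<le> 2 powr (p - 1) * (cmod c powr p * \<delta> + \<epsilon>)"
    using opb_nonneg[OF assms(3)] opb_nonneg[OF assms(4)] by simp
  fix U assume U: "U \<in> Lp p M"
  have "lp_pow p M (lp_add M (lp_scale M c (err K b U)) (err K T U))
      \<le> 2 powr (p - 1) * (lp_pow p M (lp_scale M c (err K b U)) + lp_pow p M (err K T U))"
    by (intro lp_pow_add_le p Lp_scale err_comb(2)[OF b b U] err_comb(2)[OF T T U])
  also have "\<dots> \<le> 2 powr (p - 1) * (cmod c powr p * (\<delta> * lp_pow p M U) + \<epsilon> * lp_pow p M U)"
    unfolding lp_pow_scale[OF err_comb(2)[OF b b U]]
    by (intro mult_left_mono add_mono opbD[OF assms(3) U] opbD[OF assms(4) U]) auto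
  finally show "lp_pow p M (err K (c \<odot>\<^bsub>Bop p M\<^esub> b \<oplus>\<^bsub>Bop p M\<^esub> T) U)
      \<le> 2 powr (p - 1) * (cmod c powr p * \<delta> + \<epsilon>) * lp_pow p M U"
    unfolding err_comb(1)[OF b T U] by (simp add: algebra_simps)
qed

lemma opb_mono: "opb p M M T c \<Longrightarrow> c \<le> e \<Longrightarrow> opb p M M T e"
  unfolding opb_def by (meson lp_pow_nonneg mult_right_mono order_trans)

text \<open>Demanded for all large K and not just for some K, so that finitely many elements can
  share one K.\<close>

definition approximable :: "'a lp_op \<Rightarrow> bool" where
  "approximable a \<longleftrightarrow> (\<forall>\<epsilon>>0. \<forall>\<^sub>F K in sequentially. opb p M M (err K a) \<epsilon>)"

text \<open>Controls the error of an operator by its size alone; in the closure argument this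
  handles the small remainder.\<close>

lemma opb_err:
  assumes "K > 0" "a \<in> carrier (Bop p M)" "opb p M M a \<delta>"
  shows "opb p M M (err K a) (2 powr (p - 1) * (2 * \<delta>))"
  unfolding opb_def
proof (intro conjI ballI)
  show "0 \<le> 2 powr (p - 1) * (2 * \<delta>)" using opb_nonneg[OF assms(3)] by simp
  fix U assume U: "U \<in> Lp p M"
  note aU = lp_linearD(1)[OF BopD(2)[OF p assms(2)] U]
  have "lp_pow p M (err K a U)
      \<le> 2 powr (p - 1) * (lp_pow p M (expand K (compress K a) U) + lp_pow p M (lp_scale M (- 1) (a U)))"
    unfolding err_def
    by (intro lp_pow_add_le p Lp_scale aU lp_linearD(1)[OF BopD(2)[OF p mspan_closed[OF expand_in_mspan]] U])
  also have "\<dots> \<le> 2 powr (p - 1) * (\<delta> * lp_pow p M U + \<delta> * lp_pow p M U)"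
    using opbD[OF assms(3) U] opbD[OF opb_expand_compress[OF assms] U]
    by (intro mult_left_mono add_mono) (auto simp: lp_pow_scale[OF aU])
  finally show "lp_pow p M (err K a U) \<le> 2 powr (p - 1) * (2 * \<delta>) * lp_pow p M U"
    by (simp add: algebra_simps)
qed

lemma approximable_st:
  assumes "\<alpha> \<in> words" "\<beta> \<in> words"
  shows "approximable (st \<alpha> \<beta>)"
  unfolding approximable_def
proof (intro allI impI)
  fix \<epsilon> :: real assume \<epsilon>: "\<epsilon> > 0"
  define D where "D = max (length \<alpha>) (length \<beta>) - min (length \<alpha>) (length \<beta>)"
  have "(\<lambda>K. real D / real K) \<longlonglongrightarrow> 0" by (rule lim_const_over_n)
  then have "\<forall>\<^sub>F K in sequentially. real D / real K < \<epsilon> powr (1 / p)"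
    using \<epsilon> by (intro order_tendstoD(2)) auto
  then show "\<forall>\<^sub>F K in sequentially. opb p M M (err K (st \<alpha> \<beta>)) \<epsilon>"
    using eventually_ge_at_top[of "max 1 (max (length \<alpha>) (length \<beta>))"]
  proof eventually_elim
    case (elim K)
    \<comment> \<open>Here \<open>D \<le> K\<close> makes the truncated subtraction
      \<open>K - D\<close> exact, so the error factor is -D/K.\<close>
    then have K: "K > 0" "length \<alpha> \<le> K" "length \<beta> \<le> K" "D \<le> K" by (auto simp: D_def)
    show ?case unfolding opb_def
    proof (intro conjI ballI)
      fix U assume U: "U \<in> Lp p M"
      note sU = lp_linearD(1)[OF st_linear[OF assms] U]
      have "of_nat (K - D) / of_nat K + (- 1) = - (of_nat D / of_nat K :: complex)"
        using K by (simp add: of_nat_diff field_simps)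
      then have "err K (st \<alpha> \<beta>) U = lp_scale M (- (of_nat D / of_nat K)) (st \<alpha> \<beta> U)"
        using lp_scale_add_left[OF sU, of "of_nat (K - D) / of_nat K" "- 1"]
        by (simp add: err_def expand_compress_st[OF assms K(2,3) U] D_def)
      then have "lp_pow p M (err K (st \<alpha> \<beta>) U) = (real D / real K) powr p * lp_pow p M (st \<alpha> \<beta> U)"
        by (simp add: lp_pow_scale[OF sU] norm_divide)
      also have "\<dots> \<le> (\<epsilon> powr (1 / p)) powr p * (1 * lp_pow p M U)"
        using elim p by (intro mult_mono powr_mono2 opbD[OF opb_st[OF assms] U]) (auto simp: lp_pow_nonneg)
      finally show "lp_pow p M (err K (st \<alpha> \<beta>) U) \<le> \<epsilon> * lp_pow p M U"
        using \<epsilon> p by (simp add: powr_powr)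
    qed (use \<epsilon> in simp)
  qed
qed

lemma approximable_comb:
  assumes "b \<in> carrier (Bop p M)" "T \<in> carrier (Bop p M)" "approximable b" "approximable T"
  shows "approximable (c \<odot>\<^bsub>Bop p M\<^esub> b \<oplus>\<^bsub>Bop p M\<^esub> T)"
  unfolding approximable_def
proof (intro allI impI)
  fix \<epsilon> :: real assume \<epsilon>: "\<epsilon> > 0"
  define \<delta> where "\<delta> = \<epsilon> / (2 powr (p - 1) * (cmod c powr p + 1))"
  have pos: "2 powr (p - 1) * (cmod c powr p + 1) > 0" by (simp add: add_nonneg_pos)
  then have \<delta>: "\<delta> > 0" using \<epsilon> by (simp add: \<delta>_def)
  have "2 powr (p - 1) * (cmod c powr p * \<delta> + \<delta>) = 2 powr (p - 1) * (cmod c powr p + 1) * \<delta>"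
    by (simp add: algebra_simps)
  also have "\<dots> = \<epsilon>" unfolding \<delta>_def using pos
    by (metis nonzero_mult_div_cancel_left times_divide_eq_right less_irrefl)
  finally have eq: "2 powr (p - 1) * (cmod c powr p * \<delta> + \<delta>) = \<epsilon>" .
  have "\<forall>\<^sub>F K in sequentially. opb p M M (err K b) \<delta>" "\<forall>\<^sub>F K in sequentially. opb p M M (err K T) \<delta>"
    using assms(3,4) \<delta> by (auto simp: approximable_def)
  then show "\<forall>\<^sub>F K in sequentially. opb p M M (err K (c \<odot>\<^bsub>Bop p M\<^esub> b \<oplus>\<^bsub>Bop p M\<^esub> T)) \<epsilon>"
  proof eventually_elim
    case (elim K)
    from opb_err_comb[OF assms(1,2) elim, of c] show ?case unfolding eq .
  qed
qed

lemma approximable_zero: "approximable \<zero>\<^bsub>Bop p M\<^esub>"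
  unfolding approximable_def
proof (intro allI impI)
  fix \<epsilon> :: real assume \<epsilon>: "\<epsilon> > 0"
  have "opb p M M \<zero>\<^bsub>Bop p M\<^esub> 0" by (simp add: opb_def Bop_zero_eq lp_pow_zero)
  then have *: "opb p M M (err K \<zero>\<^bsub>Bop p M\<^esub>) \<epsilon>" if "K > 0" for K
    using \<epsilon> by (intro opb_mono[OF opb_err[OF that Bop_zero_closed[OF p]]]) auto
  show "\<forall>\<^sub>F K in sequentially. opb p M M (err K \<zero>\<^bsub>Bop p M\<^esub>) \<epsilon>"
    using eventually_gt_at_top[of 0] by eventually_elim (rule *)
qed

lemma approximable_mspan: "T \<in> mspan \<Longrightarrow> approximable T"
  by (induction rule: mspan.induct)
    (auto intro: approximable_zero approximable_comb approximable_st st_closed mspan_closed)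

lemma approximable_closure:
  assumes "a \<in> op_closure p M mspan"
  shows "approximable a"
  unfolding approximable_def
proof (intro allI impI)
  fix \<epsilon> :: real assume \<epsilon>: "\<epsilon> > 0"
  have a: "a \<in> carrier (Bop p M)" using assms by (simp add: op_closure_def)
  define q where "q = 2 powr (p - 1)"
  \<comment> \<open>Chosen so that the remainder contributes q * (q * (2 * \<delta>)) =
    \<epsilon>/2; the approximant \<open>S\<close> contributes the other half.\<close>
  define \<delta> where "\<delta> = \<epsilon> / (2 * q * (2 * q))"
  have q: "q > 0" by (simp add: q_def)
  have \<delta>: "\<delta> > 0" using \<epsilon> q by (simp add: \<delta>_def)
  then obtain S where S: "S \<in> mspan" "op_norm p M (a \<ominus>\<^bsub>Bop p M\<^esub> S) < \<delta> powr (1 / p)"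
    using assms unfolding op_closure_def by (auto dest: spec[of _ "\<delta> powr (1 / p)"])
  note SC = mspan_closed[OF S(1)]
  define R where "R = a \<oplus>\<^bsub>Bop p M\<^esub> (- 1) \<odot>\<^bsub>Bop p M\<^esub> S"
  have R: "R \<in> carrier (Bop p M)"
    unfolding R_def by (intro Bop_add_closed Bop_smult_closed p a SC)
  have RU: "R U = lp_add M (a U) (lp_scale M (- 1) (S U))" if "U \<in> Lp p M" for U
    using that by (simp add: R_def Bop_add_eq Bop_smult_eq)
  have "op_norm p M R = op_norm p M (a \<ominus>\<^bsub>Bop p M\<^esub> S)"
    by (intro op_norm_cong) (simp add: RU Bop_minus_apply[OF p a SC])
  with S(2) have "op_norm p M R powr p \<le> (\<delta> powr (1 / p)) powr p"
    using p Bop_op_norm(1)[OF p R] by (intro powr_mono2) auto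
  also have "\<dots> = \<delta>" using \<delta> p by (simp add: powr_powr)
  finally have opR: "opb p M M R \<delta>" by (rule opb_mono[OF Bop_op_norm(2)[OF p R]])
  have aeq: "a = 1 \<odot>\<^bsub>Bop p M\<^esub> S \<oplus>\<^bsub>Bop p M\<^esub> R"
  proof (rule extensionalityI[OF BopD(1)[OF p a]])
    fix U assume U: "U \<in> Lp p M"
    note aU = lp_linearD(1)[OF BopD(2)[OF p a] U] and SU = lp_linearD(1)[OF BopD(2)[OF p SC] U]
    have "AE x in M. rep (R U) x = rep (a U) x + rep (lp_scale M (- 1) (S U)) x"
      unfolding RU[OF U] by (rule rep_lp_add[OF aU Lp_scale[OF SU]])
    with rep_lp_scale[OF SU, of "- 1"] have "AE x in M. rep (a U) x = rep (S U) x + rep (R U) x"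
      by eventually_elim simp
    then have "lp_add M (S U) (R U) = ae_class M (rep (a U))"
      unfolding lp_add_def by (intro ae_class_cong) (auto elim: eventually_mono)
    then show "a U = (1 \<odot>\<^bsub>Bop p M\<^esub> S \<oplus>\<^bsub>Bop p M\<^esub> R) U"
      using U ae_class_rep[OF aU] by (simp add: Bop_add_eq Bop_smult_eq lp_scale_1[OF SU])
  qed (simp add: Bop_add_eq)
  have "\<forall>\<^sub>F K in sequentially. opb p M M (err K S) (\<epsilon> / (2 * q))"
    using approximable_mspan[OF S(1)] \<epsilon> q by (simp add: approximable_def)
  then show "\<forall>\<^sub>F K in sequentially. opb p M M (err K a) \<epsilon>"
    using eventually_gt_at_top[of 0]
  proof eventually_elim
    case (elim K)
    have "opb p M M (err K a) (q * (cmod 1 powr p * (\<epsilon> / (2 * q)) + q * (2 * \<delta>)))"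
      unfolding q_def by (subst aeq, rule opb_err_comb[OF SC R elim(1)[unfolded q_def] opb_err[OF elim(2) R opR]])
    also have "q * (cmod 1 powr p * (\<epsilon> / (2 * q)) + q * (2 * \<delta>)) = \<epsilon>"
      using q by (simp add: \<delta>_def field_simps)
    finally show ?case .
  qed
qed

lemma mspan_subset_closure: "mspan \<subseteq> op_closure p M mspan"
proof
  fix T assume T: "T \<in> mspan"
  note TC = mspan_closed[OF T]
  have "opb p M M (T \<ominus>\<^bsub>Bop p M\<^esub> T) 0"
    using lp_linearD(1)[OF BopD(2)[OF p TC]]
    by (simp add: opb_def Bop_minus_apply[OF p TC TC] lp_add_uminus_self[where p = p] lp_pow_zero)
  from op_norm_leI[OF p this] have "op_norm p M (T \<ominus>\<^bsub>Bop p M\<^esub> T) \<le> 0" by simp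
  then have "\<forall>\<epsilon>>0. \<exists>S\<in>mspan. op_norm p M (T \<ominus>\<^bsub>Bop p M\<^esub> S) < \<epsilon>"
    using T by (auto intro!: bexI[of _ T])
  with TC show "T \<in> op_closure p M mspan" by (simp add: op_closure_def)
qed

theorem p_nuclear_closure:
  assumes "sigma_finite_measure M"
  shows "p_nuclear p M (op_closure p M mspan)"
  unfolding p_nuclear_def
proof (intro allI impI)
  let ?A = "op_closure p M mspan"
  fix F and \<epsilon> :: real assume F: "finite F \<and> F \<subseteq> ?A \<and> \<epsilon> > 0"
  have A: "?A \<subseteq> carrier (Bop p M)" by (auto simp: op_closure_def)
  \<comment> \<open>Half of \<epsilon>, because \<open>op_norm_leI\<close> yields only a weak
    inequality.\<close>
  have "\<forall>\<^sub>F K in sequentially. \<forall>a\<in>F. opb p M M (err K a) ((\<epsilon> / 2) powr p)"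
    using F approximable_closure by (intro eventually_ball_finite) (auto simp: approximable_def)
  then have "\<forall>\<^sub>F K in sequentially. K > 0 \<and> (\<forall>a\<in>F. opb p M M (err K a) ((\<epsilon> / 2) powr p))"
    using eventually_gt_at_top[of 0] by eventually_elim simp
  then obtain K where K: "K > 0" and err: "\<And>a. a \<in> F \<Longrightarrow> opb p M M (err K a) ((\<epsilon> / 2) powr p)"
    by (auto dest!: eventually_happens)
  let ?n = "level_dim K"
  have "p_completely_contractive p M ?A (idx ?n) (Mp p ?n) (compress K)"
    using subsetD[OF A]
    by (intro p_completely_contractiveI p assms sigma_finite_idx A mat_bound_compress)
      (auto simp: Mp_def compress_in_Mp[unfolded Mp_def] compress_add compress_smult)
  moreover have "p_completely_contractive p (idx ?n) (Mp p ?n) M ?A (expand K)"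
    using expand_in_mspan mspan_subset_closure
    by (intro p_completely_contractiveI p assms sigma_finite_idx A mat_bound_expand K)
      (auto simp: Mp_def expand_add expand_smult)
  moreover have "op_norm p M (expand K (compress K a) \<ominus>\<^bsub>Bop p M\<^esub> a) < \<epsilon>" if a: "a \<in> F" for a
  proof -
    have aC: "a \<in> carrier (Bop p M)" using a F A by blast
    have "op_norm p M (expand K (compress K a) \<ominus>\<^bsub>Bop p M\<^esub> a) = op_norm p M (err K a)"
      by (intro op_norm_cong) (simp add: err_def Bop_minus_apply[OF p mspan_closed[OF expand_in_mspan] aC])
    also have "\<dots> \<le> ((\<epsilon> / 2) powr p) powr (1 / p)" by (rule op_norm_leI[OF p err[OF a]])
    also have "\<dots> = \<epsilon> / 2" using F p by (simp add: powr_powr)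
    also have "\<dots> < \<epsilon>" using F by simp
    finally show ?thesis .
  qed
  ultimately show "\<exists>n\<ge>1. \<exists>\<phi> \<psi>.
      p_completely_contractive p M ?A (idx n) (Mp p n) \<phi> \<and>
      p_completely_contractive p (idx n) (Mp p n) M ?A \<psi> \<and>
      (\<forall>a\<in>F. op_norm p M (\<psi> (\<phi> a) \<ominus>\<^bsub>Bop p M\<^esub> a) < \<epsilon>)"
    using level_dim_pos[OF K] by blast
qed

end

section \<open>Spatial representations\<close>

lemma AE_zero_on_set:
  assumes U: "U \<in> Lp p M" and A: "A \<in> sets M"
    and zero: "(\<integral>x. indicator A x * cmod (rep U x) powr p \<partial>M) = 0"
  shows "AE x in M. x \<in> A \<longrightarrow> rep U x = 0"
proof -
  have int: "integrable M (\<lambda>x. indicator A x * cmod (rep U x) powr p)"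
    using integrable_mult_indicator[OF A Lp_integrable[OF U]] by simp
  have "AE x in M. indicator A x * cmod (rep U x) powr p = 0"
    using zero by (subst (asm) integral_nonneg_eq_0_iff_AE[OF int]) auto
  then show ?thesis by eventually_elim (auto simp: indicator_def)
qed

text \<open>Only the supports of the \<open>t\<^sub>k\<close> matter: \<open>s\<^sub>k\<close> is isometric onto functions living on the initial
  support \<open>L\<^sub>k\<close> of \<open>t\<^sub>k\<close>, and the relations force the \<open>L\<^sub>k\<close> to partition the support of every vector.\<close>

lemma spatial_lp_pow_sum:
  fixes d :: nat
  assumes p: "p \<ge> 1" and sf: "sigma_finite_measure M"
    and s: "\<And>j. j \<in> {1..d} \<Longrightarrow> spatial_partial_isometry p M (s j)"
    and t: "\<And>j. j \<in> {1..d} \<Longrightarrow> spatial_partial_isometry p M (t j)"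
    and s_in: "\<And>j U. j \<in> {1..d} \<Longrightarrow> U \<in> Lp p M \<Longrightarrow> s j U \<in> Lp p M"
    and t_in: "\<And>j U. j \<in> {1..d} \<Longrightarrow> U \<in> Lp p M \<Longrightarrow> t j U \<in> Lp p M"
    and ts: "\<And>j k U. j \<in> {1..d} \<Longrightarrow> k \<in> {1..d} \<Longrightarrow> U \<in> Lp p M \<Longrightarrow>
      t j (s k U) = (if j = k then U else lp_zero M)"
    and st: "lp_sum M {1..d} (\<lambda>j. s j (t j U)) = U" and U: "U \<in> Lp p M"
  shows "lp_pow p M U = (\<Sum>j=1..d. lp_pow p M (t j U))"
proof -
  have spat: "\<exists>K\<in>sets M. \<forall>V\<in>Lp p M. lp_pow p M (T V) = (\<integral>x. indicator K x * cmod (rep V x) powr p \<partial>M)"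
    if T: "spatial_partial_isometry p M T" for T
  proof -
    obtain K L S g where sys: "spatial_system M K L S g" and "T = spatial_op p M K L S g"
      using T by (auto simp: spatial_partial_isometry_def)
    then show ?thesis using lp_pow_spatial_op[OF p sf sys]
      by (intro bexI[of _ K]) (auto simp: spatial_system_def)
  qed
  have "\<forall>j. \<exists>K. j \<in> {1..d} \<longrightarrow> K \<in> sets M \<and>
      (\<forall>V\<in>Lp p M. lp_pow p M (t j V) = (\<integral>x. indicator K x * cmod (rep V x) powr p \<partial>M))"
    using spat[OF t] by blast
  then obtain L where L: "\<And>j. j \<in> {1..d} \<Longrightarrow> L j \<in> sets M"
    and tL: "\<And>j V. j \<in> {1..d} \<Longrightarrow> V \<in> Lp p M \<Longrightarrow>
      lp_pow p M (t j V) = (\<integral>x. indicator (L j) x * cmod (rep V x) powr p \<partial>M)"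
    by metis
  have int: "integrable M (\<lambda>x. indicator A x * cmod (rep V x) powr p)" if "A \<in> sets M" "V \<in> Lp p M" for A V
    using integrable_mult_indicator[OF that(1) Lp_integrable[OF that(2)]] by simp
  have le: "(\<integral>x. indicator A x * cmod (rep V x) powr p \<partial>M) \<le> lp_pow p M V" if "A \<in> sets M" "V \<in> Lp p M" for A V
    unfolding lp_pow_def using that
    by (intro integral_mono int Lp_integrable) (auto simp: indicator_def)
  \<comment> \<open>The norm of s_k V is at most that of V, which is that of t_k s_k V, hence that
    of s_k V restricted to \<open>L k\<close>. Equality throughout leaves no mass off
    \<open>L k\<close>.\<close>
  have out: "AE x in M. x \<notin> L k \<longrightarrow> rep (s k V) x = 0" if k: "k \<in> {1..d}" and V: "V \<in> Lp p M" for k V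
  proof -
    note sV = s_in[OF k V]
    obtain K where K: "K \<in> sets M" "\<forall>V\<in>Lp p M. lp_pow p M (s k V) = (\<integral>x. indicator K x * cmod (rep V x) powr p \<partial>M)"
      using spat[OF s[OF k]] by blast
    have "lp_pow p M (s k V) \<le> lp_pow p M V" using le[OF K(1) V] K(2) V by simp
    also have "lp_pow p M V = lp_pow p M (t k (s k V))" using ts[OF k k V] by simp
    also have "\<dots> = (\<integral>x. indicator (L k) x * cmod (rep (s k V) x) powr p \<partial>M)" by (rule tL[OF k sV])
    finally have "lp_pow p M (s k V) = (\<integral>x. indicator (L k) x * cmod (rep (s k V) x) powr p \<partial>M)"
      using le[OF L[OF k] sV] by simp
    moreover have "(\<integral>x. indicator (space M - L k) x * cmod (rep (s k V) x) powr p \<partial>M)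
        = (\<integral>x. cmod (rep (s k V) x) powr p - indicator (L k) x * cmod (rep (s k V) x) powr p \<partial>M)"
      by (intro Bochner_Integration.integral_cong) (auto simp: indicator_def)
    ultimately have "(\<integral>x. indicator (space M - L k) x * cmod (rep (s k V) x) powr p \<partial>M) = 0"
      using Lp_integrable[OF sV] int[OF L[OF k] sV] by (simp add: lp_pow_def)
    from AE_zero_on_set[OF sV _ this] L[OF k] AE_space show ?thesis
      by (auto elim: eventually_elim2)
  qed
  \<comment> \<open>By \<open>spat\<close>, t_j annihilates exactly the vectors without mass on
    \<open>L j\<close>.\<close>
  have disj: "AE x in M. x \<in> L j \<longrightarrow> rep (s k V) x = 0"
    if "j \<in> {1..d}" "k \<in> {1..d}" "j \<noteq> k" and V: "V \<in> Lp p M" for j k V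
    using that tL[OF that(1) s_in[OF that(2) V]] ts[OF that(1,2) V]
    by (intro AE_zero_on_set[OF s_in[OF that(2) V]] L) (auto simp: lp_pow_zero)
  have "AE x in M. \<forall>k\<in>{1..d}. x \<notin> L k \<longrightarrow> rep (s k (t k U)) x = 0"
    using out[OF _ t_in[OF _ U]] by (simp add: AE_finite_all)
  moreover have "AE x in M. \<forall>j\<in>{1..d}. \<forall>k\<in>{1..d}. j \<noteq> k \<longrightarrow> x \<in> L j \<longrightarrow> rep (s k (t k U)) x = 0"
  proof -
    have "AE x in M. j \<noteq> k \<longrightarrow> x \<in> L j \<longrightarrow> rep (s k (t k U)) x = 0" if "j \<in> {1..d}" "k \<in> {1..d}" for j k
      using disj[OF that _ t_in[OF that(2) U]] by (cases "j = k") auto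
    then show ?thesis by (simp add: AE_finite_all)
  qed
  moreover have "AE x in M. rep U x = (\<Sum>j=1..d. rep (s j (t j U)) x)"
    using rep_lp_sum[of "{1..d}" "\<lambda>j. s j (t j U)" p M] s_in t_in U unfolding st by blast
  \<comment> \<open>Where U does not vanish, some s_k t_k U does not vanish either; such a point
    lies in \<open>L k\<close> and in no other \<open>L j\<close>.\<close>
  ultimately have "AE x in M. cmod (rep U x) powr p = (\<Sum>j=1..d. indicator (L j) x * cmod (rep U x) powr p)"
  proof eventually_elim
    case (elim x)
    show ?case
    proof (cases "rep U x = 0")
      case False
      with elim(3) have "(\<Sum>j=1..d. rep (s j (t j U)) x) \<noteq> 0" by simp
      then obtain k where k: "k \<in> {1..d}" "rep (s k (t k U)) x \<noteq> 0" by (rule sum.not_neutral_contains_not_neutral)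
      have "x \<in> L k" using elim(1) k by blast
      moreover have "x \<notin> L j" if "j \<in> {1..d}" "j \<noteq> k" for j
        using elim(2)[rule_format, OF that(1) k(1) that(2)] k(2) by blast
      ultimately have "(\<Sum>j=1..d. indicator (L j) x * cmod (rep U x) powr p)
          = (\<Sum>j=1..d. if j = k then cmod (rep U x) powr p else 0)"
        by (intro sum.cong refl) (auto simp: indicator_def)
      then show ?thesis using k by simp
    qed simp
  qed
  then have "lp_pow p M U = (\<integral>x. (\<Sum>j=1..d. indicator (L j) x * cmod (rep U x) powr p) \<partial>M)"
    unfolding lp_pow_def using Lp_measurable[OF U] L
    by (intro integral_cong_AE) (auto intro!: borel_measurable_sum)
  also have "\<dots> = (\<Sum>j=1..d. \<integral>x. indicator (L j) x * cmod (rep U x) powr p \<partial>M)"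
    by (intro Bochner_Integration.integral_sum int L U)
  also have "\<dots> = (\<Sum>j=1..d. lp_pow p M (t j U))"
    by (intro sum.cong refl tL[symmetric] U)
  finally show ?thesis .
qed

section \<open>Transfer from the Leavitt algebra to operators\<close>

locale leavitt_rep =
  fixes p :: real and M :: "'a measure" and d :: nat
    and \<rho> :: "(leavitt_gen list \<Rightarrow> complex) set \<Rightarrow> 'a lp_op"
  assumes p: "p \<ge> 1" and hom: "\<rho> \<in> algebra_hom (leavitt d) (Bop p M)"
begin

definition op :: "(leavitt_gen list \<Rightarrow> complex) \<Rightarrow> 'a lp_op" where
  "op f = \<rho> (leavitt_coset d f)"

lemma ring_hom: "\<rho> \<in> ring_hom (leavitt d) (Bop p M)"
  using hom by (simp add: algebra_hom_def)

lemma coset_closed: "f \<in> carrier (leavitt_free d) \<Longrightarrow> leavitt_coset d f \<in> carrier (leavitt d)"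
  by (auto simp: carrier_leavitt)

lemma smult_coset_closed:
  assumes "w \<in> lists (leavitt_gens d)"
  shows "c \<odot>\<^bsub>leavitt d\<^esub> leavitt_coset d (word w) \<in> carrier (leavitt d)"
proof -
  have "(\<lambda>v. c * word w v) \<in> carrier (leavitt_free d)"
    using free_algebra_smult_closed[OF word_in_free_algebra[OF assms], of c]
    by (simp add: leavitt_free_def) (simp add: free_algebra_def)
  then show ?thesis unfolding leavitt_smult[OF word_in_leavitt_free[OF assms]] by (rule coset_closed)
qed

lemma op_closed: "f \<in> carrier (leavitt_free d) \<Longrightarrow> op f \<in> carrier (Bop p M)"
  unfolding op_def by (intro ring_hom_closed[OF ring_hom] coset_closed)

lemma op_in: "f \<in> carrier (leavitt_free d) \<Longrightarrow> U \<in> Lp p M \<Longrightarrow> op f U \<in> Lp p M"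
  using lp_linearD(1)[OF BopD(2)[OF p op_closed]] by blast

lemma op_append:
  assumes "u \<in> lists (leavitt_gens d)" "v \<in> lists (leavitt_gens d)" "U \<in> Lp p M"
  shows "op (word (u @ v)) U = op (word u) (op (word v) U)"
proof -
  have "op (word (u @ v)) = op (word u) \<otimes>\<^bsub>Bop p M\<^esub> op (word v)"
    unfolding op_def leavitt_word_append[OF assms(1,2), symmetric]
    by (intro ring_hom_mult[OF ring_hom] coset_closed word_in_leavitt_free assms)
  then show ?thesis using assms(3) by (simp add: Bop_def compose_def)
qed

lemma op_Nil: "U \<in> Lp p M \<Longrightarrow> op (word []) U = U"
  using ring_hom_one[OF ring_hom] by (simp add: op_def leavitt_one[symmetric]) (simp add: Bop_def)

lemma op_add:
  assumes "f \<in> carrier (leavitt_free d)" "g \<in> carrier (leavitt_free d)" "U \<in> Lp p M"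
  shows "op (\<lambda>w. f w + g w) U = lp_add M (op f U) (op g U)"
proof -
  have "op (\<lambda>w. f w + g w) = op f \<oplus>\<^bsub>Bop p M\<^esub> op g"
    unfolding op_def leavitt_add[OF assms(1,2), symmetric]
    by (intro ring_hom_add[OF ring_hom] coset_closed assms)
  then show ?thesis using assms(3) by (simp add: Bop_add_eq)
qed

text \<open>Zero is written as 0 times the unit, so that the scalar clause of
  \<open>algebra_hom\<close> gives its image.\<close>

lemma op_zero: "op (\<lambda>w. 0) = \<zero>\<^bsub>Bop p M\<^esub>"
proof -
  have w: "word [] \<in> carrier (leavitt_free d)" by (intro word_in_leavitt_free) simp
  have "\<rho> (0 \<odot>\<^bsub>leavitt d\<^esub> leavitt_coset d (word [])) = 0 \<odot>\<^bsub>Bop p M\<^esub> op (word [])"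
    using hom coset_closed[OF w] by (simp add: algebra_hom_def op_def)
  then show ?thesis using leavitt_smult[OF w, of 0] by (simp add: op_def) (simp add: Bop_smult_eq Bop_zero_eq lp_scale_0)
qed

lemma op_sum:
  assumes "finite J" "\<And>j. j \<in> J \<Longrightarrow> f j \<in> carrier (leavitt_free d)" "U \<in> Lp p M"
  shows "op (\<lambda>w. \<Sum>j\<in>J. f j w) U = lp_sum M J (\<lambda>j. op (f j) U)"
  using assms(1,2)
proof (induction J)
  case empty
  then show ?case using assms(3) by (simp add: op_zero lp_sum_empty) (simp add: Bop_zero_eq)
next
  case (insert j J)
  then have "op (\<lambda>w. f j w + (\<Sum>j\<in>J. f j w)) U = lp_add M (op (f j) U) (op (\<lambda>w. \<Sum>j\<in>J. f j w) U)"
    using assms(3) by (intro op_add leavitt_free_sum_closed) auto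
  with insert show ?case
    using lp_sum_insert[OF p, of J j "\<lambda>j. op (f j) U" M] op_in assms(3) by simp
qed

abbreviation "s \<equiv> \<lambda>j. op (word [S_gen j])"
abbreviation "t \<equiv> \<lambda>j. op (word [T_gen j])"

lemma gen_closed:
  "j \<in> {1..d} \<Longrightarrow> word [S_gen j] \<in> carrier (leavitt_free d)"
  "j \<in> {1..d} \<Longrightarrow> word [T_gen j] \<in> carrier (leavitt_free d)"
  by (intro word_in_leavitt_free; auto)+

lemma t_s:
  assumes "j \<in> {1..d}" "k \<in> {1..d}" "U \<in> Lp p M"
  shows "t j (s k U) = (if j = k then U else lp_zero M)"
proof -
  have "t j (s k U) = op (word ([T_gen j] @ [S_gen k])) U"
    using assms by (intro op_append[symmetric]) auto
  also have "\<dots> = op (if j = k then word [] else (\<lambda>w. 0)) U"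
    by (simp only: append.simps op_def leavitt_ts[OF assms(1,2)])
  also have "\<dots> = (if j = k then U else lp_zero M)"
    using assms(3) by (simp add: op_Nil op_zero) (simp add: Bop_zero_eq)
  finally show ?thesis .
qed

lemma s_t_sum:
  assumes "U \<in> Lp p M"
  shows "lp_sum M {1..d} (\<lambda>j. s j (t j U)) = U"
proof -
  have "lp_sum M {1..d} (\<lambda>j. s j (t j U)) = lp_sum M {1..d} (\<lambda>j. op (word ([S_gen j] @ [T_gen j])) U)"
    using assms by (intro lp_sum_cong refl op_append[symmetric]) auto
  also have "\<dots> = op (\<lambda>w. \<Sum>j=1..d. word ([S_gen j] @ [T_gen j]) w) U"
    using assms by (intro op_sum[symmetric] word_in_leavitt_free) auto
  also have "\<dots> = op (word []) U" using leavitt_st_sum[of d] by (simp add: op_def)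
  finally show ?thesis by (simp add: op_Nil assms)
qed

lemma cuntz_family:
  assumes "d \<ge> 2" "sigma_finite_measure M"
    and "\<And>j. j \<in> {1..d} \<Longrightarrow> spatial_partial_isometry p M (s j)"
    and "\<And>j. j \<in> {1..d} \<Longrightarrow> spatial_partial_isometry p M (t j)"
  shows "cuntz_family p M d s t"
proof
  show "lp_linear p M M (s j)" "lp_linear p M M (t j)" if "j \<in> {1..d}" for j
    using gen_closed[OF that] by (auto intro!: BopD(2)[OF p] op_closed)
  show "lp_pow p M U = (\<Sum>j=1..d. lp_pow p M (t j U))" if U: "U \<in> Lp p M" for U
    by (rule spatial_lp_pow_sum[OF p assms(2,3,4) op_in[OF gen_closed(1)] op_in[OF gen_closed(2)] t_s s_t_sum[OF U] U])
qed (use p assms(1) t_s s_t_sum in auto)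

end

locale leavitt_cuntz = leavitt_rep p M d \<rho> + cuntz_family p M d
    "\<lambda>j. leavitt_rep.op d \<rho> (word [S_gen j])" "\<lambda>j. leavitt_rep.op d \<rho> (word [T_gen j])"
  for p M d \<rho>
begin

lemma S_words: "\<alpha> \<in> words \<Longrightarrow> map S_gen \<alpha> \<in> lists (leavitt_gens d)"
  and T_words: "\<beta> \<in> words \<Longrightarrow> map T_gen (rev \<beta>) \<in> lists (leavitt_gens d)"
  by (auto simp: words_def)

lemma op_S_word: "\<alpha> \<in> words \<Longrightarrow> U \<in> Lp p M \<Longrightarrow> op (word (map S_gen \<alpha>)) U = sw \<alpha> U"
proof (induction \<alpha>)
  case (Cons j \<alpha>)
  then have "op (word ([S_gen j] @ map S_gen \<alpha>)) U = s j (op (word (map S_gen \<alpha>)) U)"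
    using S_words[of \<alpha>] by (intro op_append) auto
  with Cons show ?case by simp
qed (simp add: op_Nil)

text \<open>The reversal is due to \<open>tw\<close> applying the first letter first.\<close>

lemma op_T_word: "\<beta> \<in> words \<Longrightarrow> U \<in> Lp p M \<Longrightarrow> op (word (map T_gen (rev \<beta>))) U = tw \<beta> U"
proof (induction \<beta> arbitrary: U)
  case (Cons j \<beta>)
  then have "op (word (map T_gen (rev \<beta>) @ [T_gen j])) U = op (word (map T_gen (rev \<beta>))) (t j U)"
    using T_words[of \<beta>] by (intro op_append) auto
  with Cons show ?case using op_in[OF gen_closed(2)] by simp
qed (simp add: op_Nil)

lemma st_eq_op:
  assumes "\<alpha> \<in> words" "\<beta> \<in> words"
  shows "st \<alpha> \<beta> = op (word (map S_gen \<alpha> @ map T_gen (rev \<beta>)))"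
proof (rule extensionalityI)
  have "word (map S_gen \<alpha> @ map T_gen (rev \<beta>)) \<in> carrier (leavitt_free d)"
    using S_words[OF assms(1)] T_words[OF assms(2)] by (intro word_in_leavitt_free) auto
  then show "op (word (map S_gen \<alpha> @ map T_gen (rev \<beta>))) \<in> extensional (Lp p M)"
    by (intro BopD(1)[OF p] op_closed)
  fix U assume U: "U \<in> Lp p M"
  then show "st \<alpha> \<beta> U = op (word (map S_gen \<alpha> @ map T_gen (rev \<beta>))) U"
    using op_append[OF S_words[OF assms(1)] T_words[OF assms(2)] U] assms
    by (simp add: st_def op_T_word op_S_word tw_in)
qed (simp add: st_def)

text \<open>Normal form under multiplication from the left: s_j lengthens \<alpha>, while t_j
  cancels or annihilates its first letter or, if \<alpha> is empty, extends \<beta> at its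
  end.\<close>

lemma op_word_cases:
  assumes "w \<in> lists (leavitt_gens d)"
  shows "(\<forall>U\<in>Lp p M. op (word w) U = lp_zero M) \<or>
    (\<exists>\<alpha>\<in>words. \<exists>\<beta>\<in>words. \<forall>U\<in>Lp p M. op (word w) U = sw \<alpha> (tw \<beta> U))"
  using assms
proof (induction rule: lists.induct)
  case Nil
  have "\<forall>U\<in>Lp p M. op (word []) U = sw [] (tw [] U)" by (simp add: op_Nil)
  then show ?case using words_simps(1) by blast
next
  case (Cons g w)
  have g: "[g] \<in> lists (leavitt_gens d)" and w: "w \<in> lists (leavitt_gens d)"
    using Cons.hyps by (auto intro!: lists.intros simp del: in_lists_conv_set)
  have app: "op (word (g # w)) U = op (word [g]) (op (word w) U)" if "U \<in> Lp p M" for U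
    using op_append[OF g w that] by simp
  from Cons.IH show ?case
  proof (elim disjE bexE)
    assume "\<forall>U\<in>Lp p M. op (word w) U = lp_zero M"
    then have "\<forall>U\<in>Lp p M. op (word (g # w)) U = lp_zero M"
      using app lp_linear_zero[OF BopD(2)[OF p op_closed[OF word_in_leavitt_free[OF g]]]] by simp
    then show ?thesis by blast
  next
    fix \<alpha> \<beta> assume ab: "\<alpha> \<in> words" "\<beta> \<in> words" and eq: "\<forall>U\<in>Lp p M. op (word w) U = sw \<alpha> (tw \<beta> U)"
    from g consider j where "g = S_gen j" "j \<in> {1..d}" | j where "g = T_gen j" "j \<in> {1..d}" by auto
    then show ?thesis
    proof cases
      case 1
      then have "j # \<alpha> \<in> words" "\<forall>U\<in>Lp p M. op (word (g # w)) U = sw (j # \<alpha>) (tw \<beta> U)"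
        using app eq ab by simp_all
      with ab(2) show ?thesis by blast
    next
      case (2 j)
      show ?thesis
      proof (cases \<alpha>)
        case Nil
        then have "\<beta> @ [j] \<in> words" "\<forall>U\<in>Lp p M. op (word (g # w)) U = sw [] (tw (\<beta> @ [j]) U)"
          using 2 app eq ab by simp_all
        with words_simps(1) show ?thesis by blast
      next
        case (Cons k \<alpha>')
        then have k: "k \<in> {1..d}" "\<alpha>' \<in> words" using ab by auto
        have "op (word (g # w)) U = (if j = k then sw \<alpha>' (tw \<beta> U) else lp_zero M)" if U: "U \<in> Lp p M" for U
          using app[OF U] eq U 2 t_s[OF 2(2) k(1) sw_in[OF k(2) tw_in[OF ab(2) U]]] by (simp add: Cons)
        then show ?thesis using k(2) ab(2) by (cases "j = k") auto
      qed
    qed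
  qed
qed

lemma range_eq_mspan: "\<rho> ` carrier (leavitt d) = mspan"
proof
  show "\<rho> ` carrier (leavitt d) \<subseteq> mspan"
  proof (rule image_subsetI)
    fix X assume "X \<in> carrier (leavitt d)"
    then show "\<rho> X \<in> mspan"
    proof (induction rule: leavitt_induct)
      case zero
      show ?case using mspan.zero op_zero by (simp add: op_def)
    next
      case (add c w X)
      note wc = word_in_leavitt_free[OF add.hyps(1)]
      note wl = smult_coset_closed[OF add.hyps(1), of c]
      have eq: "\<rho> ((c \<odot>\<^bsub>leavitt d\<^esub> leavitt_coset d (word w)) \<oplus>\<^bsub>leavitt d\<^esub> X)
          = c \<odot>\<^bsub>Bop p M\<^esub> op (word w) \<oplus>\<^bsub>Bop p M\<^esub> \<rho> X"
        using ring_hom_add[OF ring_hom wl add.hyps(2)] hom coset_closed[OF wc]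
        by (simp add: algebra_hom_def op_def)
      from op_word_cases[OF add.hyps(1)] show ?case
      proof (elim disjE bexE)
        assume "\<forall>U\<in>Lp p M. op (word w) U = lp_zero M"
        \<comment> \<open>A vanishing word is recast as the product of two empty words with
          coefficient 0, to fit the shape of \<open>mspan.step\<close>.\<close>
        then have "c \<odot>\<^bsub>Bop p M\<^esub> op (word w) = 0 \<odot>\<^bsub>Bop p M\<^esub> st [] []"
          unfolding Bop_smult_eq by (intro restrict_ext) (simp add: lp_scale_zero lp_scale_0)
        then show ?thesis unfolding eq using mspan.step[OF words_simps(1) words_simps(1) add.IH] by simp
      next
        fix \<alpha> \<beta> assume ab: "\<alpha> \<in> words" "\<beta> \<in> words" and "\<forall>U\<in>Lp p M. op (word w) U = sw \<alpha> (tw \<beta> U)"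
        then have "c \<odot>\<^bsub>Bop p M\<^esub> op (word w) = c \<odot>\<^bsub>Bop p M\<^esub> st \<alpha> \<beta>"
          unfolding Bop_smult_eq by (intro restrict_ext) (simp add: st_def)
        then show ?thesis unfolding eq using mspan.step[OF ab add.IH] by simp
      qed
    qed
  qed
  show "mspan \<subseteq> \<rho> ` carrier (leavitt d)"
  proof
    fix T assume "T \<in> mspan"
    then show "T \<in> \<rho> ` carrier (leavitt d)"
    proof (induction rule: mspan.induct)
      case zero
      have "(\<lambda>w. 0) \<in> carrier (leavitt_free d)" by (simp add: leavitt_free_def free_algebra_def)
      then show ?case using op_zero coset_closed by (force simp: op_def)
    next
      case (step \<alpha> \<beta> T c)
      then obtain X where X: "X \<in> carrier (leavitt d)" "T = \<rho> X" by auto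
      define w where "w = map S_gen \<alpha> @ map T_gen (rev \<beta>)"
      have w: "w \<in> lists (leavitt_gens d)" unfolding w_def using S_words T_words step by auto
      note wc = word_in_leavitt_free[OF w]
      note wl = smult_coset_closed[OF w, of c]
      obtain f where f: "f \<in> carrier (leavitt_free d)" "X = leavitt_coset d f"
        using X(1) by (auto simp: carrier_leavitt)
      obtain h where h: "h \<in> carrier (leavitt_free d)"
        "c \<odot>\<^bsub>leavitt d\<^esub> leavitt_coset d (word w) = leavitt_coset d h"
        using wl by (auto simp: carrier_leavitt)
      have "h \<oplus>\<^bsub>leavitt_free d\<^esub> f \<in> carrier (leavitt_free d)"
        using h(1) f(1) unfolding leavitt_free_def by (rule free_algebra_add_closed)
      then have "(c \<odot>\<^bsub>leavitt d\<^esub> leavitt_coset d (word w)) \<oplus>\<^bsub>leavitt d\<^esub> X \<in> carrier (leavitt d)"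
        unfolding h(2) f(2) leavitt_add[OF h(1) f(1)] leavitt_free_simps by (rule coset_closed)
      moreover have "\<rho> ((c \<odot>\<^bsub>leavitt d\<^esub> leavitt_coset d (word w)) \<oplus>\<^bsub>leavitt d\<^esub> X)
          = c \<odot>\<^bsub>Bop p M\<^esub> st \<alpha> \<beta> \<oplus>\<^bsub>Bop p M\<^esub> T"
      proof -
        have "st \<alpha> \<beta> = op (word w)" unfolding w_def by (rule st_eq_op[OF step.hyps(1,2)])
        moreover have "\<rho> (c \<odot>\<^bsub>leavitt d\<^esub> leavitt_coset d (word w)) = c \<odot>\<^bsub>Bop p M\<^esub> op (word w)"
          using hom coset_closed[OF wc] by (simp add: algebra_hom_def op_def)
        ultimately show ?thesis using ring_hom_add[OF ring_hom wl X(1)] X(2) by simp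
      qed
      ultimately show ?case by (metis image_eqI)
    qed
  qed
qed

end

theorem corollary1p5:
  fixes p :: real and d :: nat and M :: "'a measure"
    and \<rho> :: "(leavitt_gen list \<Rightarrow> complex) set \<Rightarrow> 'a lp_op"
  assumes "p \<ge> 1" and "d \<ge> 2"
    and "sigma_finite_measure M" and "Lp p M \<noteq> {lp_zero M}"
    and "spatial_representation p M d \<rho>"
  shows "p_nuclear p M (Lp_Cuntz p M d \<rho>)"
proof -
  interpret leavitt_rep p M d \<rho>
    using assms by unfold_locales (auto simp: spatial_representation_def)
  have "spatial_partial_isometry p M (s j)" "spatial_partial_isometry p M (t j)" if "j \<in> {1..d}" for j
    using assms(5) that
    by (auto simp: spatial_representation_def op_def leavitt_s_def leavitt_t_def leavitt_coset_def)
  with assms(2,3) interpret cuntz_family p M d s t by (intro cuntz_family) auto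
  interpret leavitt_cuntz p M d \<rho> by unfold_locales
  \<comment> \<open>A unit vector exists because the space is nonzero.\<close>
  obtain \<xi> \<eta> where "\<xi> \<in> Lp p M" "lp_pow p M \<xi> = 1" "\<eta> \<xi> = 1" "lp_functional p M \<eta>"
    using ex_norming_pair[OF assms(1,3,4)] by blast
  then interpret cuntz_normed p M d s t \<xi> \<eta> by unfold_locales
  show ?thesis
    unfolding Lp_Cuntz_def range_eq_mspan by (rule p_nuclear_closure[OF assms(3)])
qed

end
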